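(* Let $\mathcal K=(K,\mathcal F(K))$ be a field of definable characteristic zero, let $R$ be a definable subfield of $K$ and let $n\in\mathbf N=\mathbf N(\mathcal K)$. Then every definable ideal $\mathcal I$ in $R[x_i]^{\rm def}_{i<n}$ is hyperfinitely generated.
   Context: **Definable finite power sets.** "Definable" means first-order definable with parameters. Let $X,Y$ be definable sets in a structure and $\in^*\subseteq X\times Y$ a definable relation. $Y$ is a definable finite power set of $X$ with respect to $\in^*$ (written $\mathcal F(X)=Y$) if: (i) $B,C\in\mathcal F(X)$ are equal iff for all $x\in X$, $x\in^* B\iff x\in^* C$; (ii) there is $\emptyset^*\in\mathcal F(X)$ with $x\notin^*\emptyset^*$ for all $x\in X$; (iii) for each $a\in X$ there is $\{a\}^*\in\mathcal F(X)$ with $x\in^*\{a\}^*\iff x=a$; (iv) for $B,C\in\mathcal F(X)$ there is $B\cup^*C\in\mathcal F(X)$ with $x\in^* B\cup^* C\iff x\in^*B\lor x\in^*C$; (v) every definable $\mathcal U\subseteq\mathcal F(X)$ such that $\emptyset^*\in\mathcal U$ and $B\cup^*\{x\}^*\in\mathcal U$ for all $B\in\mathcal U$, $x\in X$, equals $\mathcal F(X)$. For $a\in\mathcal F(X)$ let $\operatorname{ext}(a)=\{x\in X: x\in^*a\}$. A definable set $X$ is hyperfinite if it has a definable finite power set $\mathcal F(X)$ and $X=\operatorname{ext}(a)$ for some $a\in\mathcal F(X)$. **Fields.** Consider structures $\mathcal K=(K,\mathcal F(K))$ with a field sort $K$, a second sort $\mathcal F(K)$ and a relation $\in^*$ making $\mathcal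 F(K)$ a definable finite power set of $K$; definability is meant in $\mathcal K^{eq}$. Let $K_0$ be the set of $x\in K$ for which there is $F\in\mathcal F(K)$ with $x\in^*F$ and, for all $z\in^* F$, if $z\ne0$ then $z-1\in^*F$. $\mathcal K$ has definable characteristic zero if $-1\notin K_0$. In that case put $\mathbf N(\mathcal K)=K_0$, which with $+,\cdot$ is a model of Peano Arithmetic (ordered by $x\le y\iff y-x\in\mathbf N$) satisfying induction for all $\mathcal K$-definable subsets. In $\mathcal K^{eq}$ every definable set $X$ has a definable finite power set $\mathcal F(X)$, unique up to a definable bijection preserving extensions. For $n\in\mathbf N$, $(n)=\{i\in\mathbf N:i<n\}$, and for a definable set $X$, $X^{(n)}$ is the (definable) set of hyperfinite functions $(n)\to X$ (elements of $\mathcal F((n)\times X)$ whose extension is such a function). **Non-standard polynomials.** For $R\subseteq K$ a definable subring and $n\in\mathbf N$, $R[x_i]^{\rm def}_{i<n}$ is the set of hyperfinite partial functions $p$ from $\mathbf N^{(n)}$ to $R\setminus\{0\}$ (with hyperfinite domain); $I\in\mathbf N^{(n)}$ is regarded as the monomial $x^I=\prod_{k<n}x_k^{I(k)}$, and $p_I$ is $p(I)$ if $I\in\operatorname{dom}(p)$ and $0$ otherwise. It is a definable ring: sums are computed coefficientwise; $x^Iq$ is the polynomial with coefficient $q_J$ at $x^{I+J}$; and $pq$ is defined by definable recursion on hyperfinite $A\subseteq\operatorname{dom}(p)$ via $p_{|\emptyset}q=0$, $p_{|A\cup\{I\}}q=p_{|A}q+p_Ix^Iq$ for $I\notin A$.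 For $m\in\mathbf N$ and a hyperfinite sequence $(p_i)_{i<m}$ in $(R[x_i]^{\rm def}_{i<n})^{(m)}$, the hyperfinite sum $\sum_{i<m}p_i$ is defined by definable recursion on $m\in\mathbf N$. A definable ideal $\mathcal I\subseteq R[x_i]^{\rm def}_{i<n}$ is hyperfinitely generated if there is a hyperfinite subset $J\subseteq\mathcal I$ such that every element of $\mathcal I$ has the form $\sum_{i<m}a_ig_i$ with $m\in\mathbf N$, $(g_i)_{i<m}\in J^{(m)}$ and $(a_i)_{i<m}\in(R[x_i]^{\rm def}_{i<n})^{(m)}$. *)

theory Defs
  imports "HOL-Algebra.Algebraic_Closure_Type"
begin

section \<open>Definability in many-sorted structures\<close>

text \<open>
  Formulas are many-sorted first-order formulas over relation symbols, with de Bruijn variables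
  (\<open>Ex s\<close> quantifies over the sort \<open>s\<close> and pushes the witness onto the front of the list of values).
  No sorting discipline is imposed on the syntax: an atom whose variables are out of range is false,
  and so is an atom whose variables have the wrong sorts, because a relation symbol holds only of
  tuples of the intended sorts.  This does not change which sets are definable.
\<close>

datatype ('s, 'r) fm =
    EqF nat nat
  | RelF 'r "nat list"
  | NegF "('s, 'r) fm"
  | ConjF "('s, 'r) fm" "('s, 'r) fm"
  | ExF 's "('s, 'r) fm"

record ('s, 'r, 'u) struct =
  dom :: "'s \<Rightarrow> 'u set"
  rel :: "'r \<Rightarrow> 'u list set"

primrec sat :: "('s, 'r, 'u) struct \<Rightarrow> ('s, 'r) fm \<Rightarrow> 'u list \<Rightarrow> bool" where
  "sat M (EqF i j) xs \<longleftrightarrow> i < length xs \<and> j < length xs \<and> xs ! i = xs ! j"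
| "sat M (RelF r is) xs \<longleftrightarrow> (\<forall>i\<in>set is. i < length xs) \<and> map (\<lambda>i. xs ! i) is \<in> rel M r"
| "sat M (NegF \<phi>) xs \<longleftrightarrow> \<not> sat M \<phi> xs"
| "sat M (ConjF \<phi> \<psi>) xs \<longleftrightarrow> sat M \<phi> xs \<and> sat M \<psi> xs"
| "sat M (ExF s \<phi>) xs \<longleftrightarrow> (\<exists>a\<in>dom M s. sat M \<phi> (a # xs))"

definition tuples :: "('s, 'r, 'u) struct \<Rightarrow> 's list \<Rightarrow> 'u list set" where
  "tuples M ss = {xs. list_all2 (\<lambda>x s. x \<in> dom M s) xs ss}"

text \<open>Definable sets, with parameters \<open>ps\<close>, are subsets of finite products of sorts.\<close>

definition definable :: "('s, 'r, 'u) struct \<Rightarrow> 'u list set \<Rightarrow> bool" where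
  "definable M V \<longleftrightarrow>
     (\<exists>ss \<phi> ps. set ps \<subseteq> (\<Union>s. dom M s) \<and> V = {xs \<in> tuples M ss. sat M \<phi> (xs @ ps)})"

text \<open>
  Products and binary relations are formed by concatenating tuples.  All elements of a definable set
  have the same length, so the components can be recovered.
\<close>

definition times_set :: "'u list set \<Rightarrow> 'u list set \<Rightarrow> 'u list set" where
  "times_set V W = {x @ y | x y. x \<in> V \<and> y \<in> W}"

definition definable_rel :: "('s, 'r, 'u) struct \<Rightarrow> ('u list \<times> 'u list) set \<Rightarrow> bool" where
  "definable_rel M r \<longleftrightarrow> definable M {x @ y | x y. (x, y) \<in> r}"

definition definable_fun ::
    "('s, 'r, 'u) struct \<Rightarrow> 'u list set \<Rightarrow> 'u list set \<Rightarrow> ('u list \<Rightarrow> 'u list) \<Rightarrow> bool" where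
  "definable_fun M V W f \<longleftrightarrow>
     definable M V \<and> definable M W \<and> f ` V \<subseteq> W \<and> definable_rel M {(x, f x) | x. x \<in> V}"


section \<open>Imaginaries\<close>

text \<open>
  For every parameter-free formula \<open>\<phi>\<close> defining an equivalence relation on a product \<open>ss\<close> of sorts,
  the structure \<open>eq_struct M\<close> has a new sort consisting of the equivalence classes, and a relation
  symbol for the graph of the projection onto it.  The sort belonging to a pair \<open>(ss, \<phi>)\<close> that does
  not define an equivalence relation is empty.
\<close>

datatype ('s, 'r, 'u) eqelem = Home 'u | Imag "'s list" "('s, 'r) fm" "'u list set"
datatype ('s, 'r) eqsort = HomeS 's | ImagS "'s list" "('s, 'r) fm"
datatype ('s, 'r) eqrel = HomeR 'r | ProjR "'s list" "('s, 'r) fm"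

definition fm_rel ::
    "('s, 'r, 'u) struct \<Rightarrow> 's list \<Rightarrow> ('s, 'r) fm \<Rightarrow> ('u list \<times> 'u list) set" where
  "fm_rel M ss \<phi> = {(xs, ys). xs \<in> tuples M ss \<and> ys \<in> tuples M ss \<and> sat M \<phi> (xs @ ys)}"

definition eq_struct ::
    "('s, 'r, 'u) struct \<Rightarrow>
      (('s, 'r) eqsort, ('s, 'r) eqrel, ('s, 'r, 'u) eqelem) struct" where
  "eq_struct M = \<lparr>
     dom = (\<lambda>S. case S of
         HomeS s \<Rightarrow> Home ` dom M s
       | ImagS ss \<phi> \<Rightarrow>
           (if equiv (tuples M ss) (fm_rel M ss \<phi>)
            then Imag ss \<phi> ` (tuples M ss // fm_rel M ss \<phi>) else {})),
     rel = (\<lambda>Q. case Q of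
         HomeR r \<Rightarrow> map Home ` rel M r
       | ProjR ss \<phi> \<Rightarrow>
           (if equiv (tuples M ss) (fm_rel M ss \<phi>)
            then {map Home xs @ [Imag ss \<phi> (fm_rel M ss \<phi> `` {xs})] | xs. xs \<in> tuples M ss}
            else {})) \<rparr>"


section \<open>Definable finite power sets\<close>

definition ext :: "('u list \<times> 'u list) set \<Rightarrow> 'u list \<Rightarrow> 'u list set" where
  "ext E b = {x. (x, b) \<in> E}"

definition is_fpow ::
    "('s, 'r, 'u) struct \<Rightarrow> 'u list set \<Rightarrow> 'u list set \<Rightarrow> ('u list \<times> 'u list) set \<Rightarrow> bool" where
  "is_fpow M V W E \<longleftrightarrow>
     definable M V \<and> definable M W \<and> E \<subseteq> V \<times> W \<and> definable_rel M E \<and>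
     (\<forall>B\<in>W. \<forall>C\<in>W. B = C \<longleftrightarrow> (\<forall>x\<in>V. (x, B) \<in> E \<longleftrightarrow> (x, C) \<in> E)) \<and>
     (\<exists>B\<in>W. \<forall>x\<in>V. (x, B) \<notin> E) \<and>
     (\<forall>a\<in>V. \<exists>B\<in>W. \<forall>x\<in>V. (x, B) \<in> E \<longleftrightarrow> x = a) \<and>
     (\<forall>B\<in>W. \<forall>C\<in>W. \<exists>D\<in>W. \<forall>x\<in>V. (x, D) \<in> E \<longleftrightarrow> (x, B) \<in> E \<or> (x, C) \<in> E) \<and>
     (\<forall>U. U \<subseteq> W \<and> definable M U \<and>
        (\<forall>B\<in>W. ext E B = {} \<longrightarrow> B \<in> U) \<and>
        (\<forall>B\<in>U. \<forall>x\<in>V. \<forall>C\<in>W. ext E C = ext E B \<union> {x} \<longrightarrow> C \<in> U)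
        \<longrightarrow> U = W)"

definition hyperfinite :: "('s, 'r, 'u) struct \<Rightarrow> 'u list set \<Rightarrow> bool" where
  "hyperfinite M V \<longleftrightarrow> (\<exists>W E. is_fpow M V W E \<and> (\<exists>a\<in>W. ext E a = V))"

text \<open>
  A fixed choice \<open>\<F>(V)\<close> of a definable finite power set and its membership relation.  In the
  structures considered below every definable set has one, unique up to a definable bijection
  preserving extensions, so that the choice is immaterial.
\<close>

definition fpow_pair ::
    "('s, 'r, 'u) struct \<Rightarrow> 'u list set \<Rightarrow> 'u list set \<times> ('u list \<times> 'u list) set" where
  "fpow_pair M V = (SOME (W, E). is_fpow M V W E)"

definition fpow :: "('s, 'r, 'u) struct \<Rightarrow> 'u list set \<Rightarrow> 'u list set" where
  "fpow M V = fst (fpow_pair M V)"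

definition fext :: "('s, 'r, 'u) struct \<Rightarrow> 'u list set \<Rightarrow> 'u list \<Rightarrow> 'u list set" where
  "fext M V b = ext (snd (fpow_pair M V)) b"


section \<open>Fields with a definable finite power set\<close>

datatype ksort = FieldS | FinS
datatype krel = AddR | MulR | MemR

text \<open>
  The structure is determined by the field, which is the whole type \<open>'k\<close>, the second sort, which is
  the whole type \<open>'f\<close>, and the membership relation \<open>mem\<close>.
\<close>

definition field_struct ::
    "('k::field \<Rightarrow> 'f \<Rightarrow> bool) \<Rightarrow> (ksort, krel, 'k + 'f) struct" where
  "field_struct mem = \<lparr>
     dom = (\<lambda>s. case s of FieldS \<Rightarrow> range Inl | FinS \<Rightarrow> range Inr),
     rel = (\<lambda>r. case r of
         AddR \<Rightarrow> {[Inl x, Inl y, Inl (x + y)] | x y. True}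
       | MulR \<Rightarrow> {[Inl x, Inl y, Inl (x * y)] | x y. True}
       | MemR \<Rightarrow> {[Inl x, Inr F] | x F. mem x F}) \<rparr>"

type_synonym ('k, 'f) elt = "(ksort, krel, 'k + 'f) eqelem list"

definition Keq ::
    "('k::field \<Rightarrow> 'f \<Rightarrow> bool) \<Rightarrow>
      ((ksort, krel) eqsort, (ksort, krel) eqrel, (ksort, krel, 'k + 'f) eqelem) struct" where
  "Keq mem = eq_struct (field_struct mem)"

definition el :: "'k \<Rightarrow> ('k, 'f) elt" where
  "el x = [Home (Inl x)]"

definition fin_field :: "('k::field \<Rightarrow> 'f \<Rightarrow> bool) \<Rightarrow> bool" where
  "fin_field mem \<longleftrightarrow>
     is_fpow (Keq mem) (range el) (range (\<lambda>F. [Home (Inr F)]))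
       {(el x, [Home (Inr F)]) | x F. mem x F}"

definition K0 :: "('k::field \<Rightarrow> 'f \<Rightarrow> bool) \<Rightarrow> 'k set" where
  "K0 mem = {x. \<exists>F. mem x F \<and> (\<forall>z. mem z F \<longrightarrow> z \<noteq> 0 \<longrightarrow> mem (z - 1) F)}"

definition def_char_zero :: "('k::field \<Rightarrow> 'f \<Rightarrow> bool) \<Rightarrow> bool" where
  "def_char_zero mem \<longleftrightarrow> - 1 \<notin> K0 mem"

abbreviation NN :: "('k::field \<Rightarrow> 'f \<Rightarrow> bool) \<Rightarrow> 'k set" where
  "NN mem \<equiv> K0 mem"

text \<open>The initial segment \<open>{i. i < n}\<close>, where \<open>x \<le> y\<close> means that \<open>y - x\<close> lies in \<open>NN mem\<close>.\<close>

definition seg :: "('k::field \<Rightarrow> 'f \<Rightarrow> bool) \<Rightarrow> 'k \<Rightarrow> 'k set" where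
  "seg mem n = {i \<in> NN mem. n - i \<in> NN mem \<and> i \<noteq> n}"

text \<open>The set \<open>V\<^sup>(\<^sup>n\<^sup>)\<close> of hyperfinite functions from \<open>seg mem n\<close> to \<open>V\<close>.\<close>

definition hf_fun ::
    "('k::field \<Rightarrow> 'f \<Rightarrow> bool) \<Rightarrow> 'k \<Rightarrow> ('k, 'f) elt set \<Rightarrow> ('k, 'f) elt set" where
  "hf_fun mem n V =
     {f \<in> fpow (Keq mem) (times_set (el ` seg mem n) V).
        \<forall>i\<in>seg mem n. \<exists>!x. el i @ x \<in> fext (Keq mem) (times_set (el ` seg mem n) V) f}"

definition hf_app ::
    "('k::field \<Rightarrow> 'f \<Rightarrow> bool) \<Rightarrow> 'k \<Rightarrow> ('k, 'f) elt set \<Rightarrow> ('k, 'f) elt \<Rightarrow> 'k \<Rightarrow> ('k, 'f) elt" where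
  "hf_app mem n V f i =
     (THE x. el i @ x \<in> fext (Keq mem) (times_set (el ` seg mem n) V) f)"


section \<open>Non-standard polynomials\<close>

definition expo :: "('k::field \<Rightarrow> 'f \<Rightarrow> bool) \<Rightarrow> 'k \<Rightarrow> ('k, 'f) elt set" where
  "expo mem n = hf_fun mem n (el ` NN mem)"

definition expo_at :: "('k::field \<Rightarrow> 'f \<Rightarrow> bool) \<Rightarrow> 'k \<Rightarrow> ('k, 'f) elt \<Rightarrow> 'k \<Rightarrow> 'k" where
  "expo_at mem n I k = (THE a. el a = hf_app mem n (el ` NN mem) I k)"

definition expo_add ::
    "('k::field \<Rightarrow> 'f \<Rightarrow> bool) \<Rightarrow> 'k \<Rightarrow> ('k, 'f) elt \<Rightarrow> ('k, 'f) elt \<Rightarrow> ('k, 'f) elt" where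
  "expo_add mem n I J =
     (THE L. L \<in> expo mem n \<and>
        (\<forall>k\<in>seg mem n. expo_at mem n L k = expo_at mem n I k + expo_at mem n J k))"

definition poly_graphs :: "('k::field \<Rightarrow> 'f \<Rightarrow> bool) \<Rightarrow> 'k set \<Rightarrow> 'k \<Rightarrow> ('k, 'f) elt set" where
  "poly_graphs mem R n = times_set (expo mem n) (el ` (R - {0}))"

text \<open>
  A polynomial is an element of \<open>\<F>(\<bbbN>\<^sup>(\<^sup>n\<^sup>) \<times> (R - {0}))\<close> whose extension is single-valued.  Its domain is
  a projection of a hyperfinite set and therefore automatically hyperfinite.
\<close>

definition polys :: "('k::field \<Rightarrow> 'f \<Rightarrow> bool) \<Rightarrow> 'k set \<Rightarrow> 'k \<Rightarrow> ('k, 'f) elt set" where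
  "polys mem R n =
     {p \<in> fpow (Keq mem) (poly_graphs mem R n).
        \<forall>I\<in>expo mem n. \<forall>a b.
          I @ el a \<in> fext (Keq mem) (poly_graphs mem R n) p \<longrightarrow>
          I @ el b \<in> fext (Keq mem) (poly_graphs mem R n) p \<longrightarrow> a = b}"

definition poly_dom ::
    "('k::field \<Rightarrow> 'f \<Rightarrow> bool) \<Rightarrow> 'k set \<Rightarrow> 'k \<Rightarrow> ('k, 'f) elt \<Rightarrow> ('k, 'f) elt set" where
  "poly_dom mem R n p =
     {I \<in> expo mem n. \<exists>a. I @ el a \<in> fext (Keq mem) (poly_graphs mem R n) p}"

definition poly_coeff ::
    "('k::field \<Rightarrow> 'f \<Rightarrow> bool) \<Rightarrow> 'k set \<Rightarrow> 'k \<Rightarrow> ('k, 'f) elt \<Rightarrow> ('k, 'f) elt \<Rightarrow> 'k" where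
  "poly_coeff mem R n p I =
     (if I \<in> poly_dom mem R n p
      then THE a. I @ el a \<in> fext (Keq mem) (poly_graphs mem R n) p else 0)"

definition poly_of ::
    "('k::field \<Rightarrow> 'f \<Rightarrow> bool) \<Rightarrow> 'k set \<Rightarrow> 'k \<Rightarrow> (('k, 'f) elt \<Rightarrow> 'k) \<Rightarrow> ('k, 'f) elt" where
  "poly_of mem R n c =
     (THE p. p \<in> polys mem R n \<and> (\<forall>I\<in>expo mem n. poly_coeff mem R n p I = c I))"

definition poly_zero :: "('k::field \<Rightarrow> 'f \<Rightarrow> bool) \<Rightarrow> 'k set \<Rightarrow> 'k \<Rightarrow> ('k, 'f) elt" where
  "poly_zero mem R n = poly_of mem R n (\<lambda>I. 0)"

definition poly_one :: "('k::field \<Rightarrow> 'f \<Rightarrow> bool) \<Rightarrow> 'k set \<Rightarrow> 'k \<Rightarrow> ('k, 'f) elt" where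
  "poly_one mem R n =
     poly_of mem R n (\<lambda>I. if \<forall>k\<in>seg mem n. expo_at mem n I k = 0 then 1 else 0)"

definition poly_add ::
    "('k::field \<Rightarrow> 'f \<Rightarrow> bool) \<Rightarrow> 'k set \<Rightarrow> 'k \<Rightarrow> ('k, 'f) elt \<Rightarrow> ('k, 'f) elt \<Rightarrow> ('k, 'f) elt" where
  "poly_add mem R n p q =
     poly_of mem R n (\<lambda>I. poly_coeff mem R n p I + poly_coeff mem R n q I)"

definition poly_scale ::
    "('k::field \<Rightarrow> 'f \<Rightarrow> bool) \<Rightarrow> 'k set \<Rightarrow> 'k \<Rightarrow> 'k \<Rightarrow> ('k, 'f) elt \<Rightarrow> ('k, 'f) elt" where
  "poly_scale mem R n c q = poly_of mem R n (\<lambda>I. c * poly_coeff mem R n q I)"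

text \<open>The product \<open>x\<^sup>I q\<close>.\<close>

definition poly_shift ::
    "('k::field \<Rightarrow> 'f \<Rightarrow> bool) \<Rightarrow> 'k set \<Rightarrow> 'k \<Rightarrow> ('k, 'f) elt \<Rightarrow> ('k, 'f) elt \<Rightarrow> ('k, 'f) elt" where
  "poly_shift mem R n I q =
     (THE r. r \<in> polys mem R n \<and>
        (\<forall>J\<in>expo mem n. poly_coeff mem R n r (expo_add mem n I J) = poly_coeff mem R n q J) \<and>
        (\<forall>L\<in>expo mem n - expo_add mem n I ` expo mem n. poly_coeff mem R n r L = 0))"

text \<open>
  The recursion defining \<open>p q\<close> runs over the hyperfinite \<open>A \<subseteq> dom(p)\<close>; \<open>G A\<close> is the
  value of \<open>p\<^sub>|\<^sub>A q\<close>.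
\<close>

definition poly_mult ::
    "('k::field \<Rightarrow> 'f \<Rightarrow> bool) \<Rightarrow> 'k set \<Rightarrow> 'k \<Rightarrow> ('k, 'f) elt \<Rightarrow> ('k, 'f) elt \<Rightarrow> ('k, 'f) elt" where
  "poly_mult mem R n p q = (THE r.
     let M = Keq mem; V = expo mem n; D = poly_dom mem R n p;
         \<A> = {A \<in> fpow M V. fext M V A \<subseteq> D}
     in \<exists>G. definable_fun M \<A> (polys mem R n) G \<and>
          (\<forall>A\<in>\<A>. fext M V A = {} \<longrightarrow> G A = poly_zero mem R n) \<and>
          (\<forall>A\<in>\<A>. \<forall>B\<in>\<A>. \<forall>I. I \<notin> fext M V A \<and> fext M V B = fext M V A \<union> {I} \<longrightarrow>
             G B = poly_add mem R n (G A)
                     (poly_scale mem R n (poly_coeff mem R n p I) (poly_shift mem R n I q))) \<and>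
          (\<exists>A\<in>\<A>. fext M V A = D \<and> r = G A))"

definition def_poly_ring ::
    "('k::field \<Rightarrow> 'f \<Rightarrow> bool) \<Rightarrow> 'k set \<Rightarrow> 'k \<Rightarrow> ('k, 'f) elt ring" where
  "def_poly_ring mem R n =
     \<lparr>carrier = polys mem R n, monoid.mult = poly_mult mem R n, one = poly_one mem R n,
      zero = poly_zero mem R n, add = poly_add mem R n\<rparr>"

text \<open>
  The hyperfinite sum \<open>\<Sum>\<^bsub>i<m\<^esub> s i\<close>: \<open>S k\<close> is the partial sum over \<open>i < k\<close>, for \<open>k \<le> m\<close>.
\<close>

definition hf_sum ::
    "('k::field \<Rightarrow> 'f \<Rightarrow> bool) \<Rightarrow> 'k set \<Rightarrow> 'k \<Rightarrow> 'k \<Rightarrow> ('k \<Rightarrow> ('k, 'f) elt) \<Rightarrow> ('k, 'f) elt" where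
  "hf_sum mem R n m s = (THE r.
     \<exists>S. definable_fun (Keq mem) (el ` (seg mem m \<union> {m})) (polys mem R n) S \<and>
         S (el 0) = poly_zero mem R n \<and>
         (\<forall>k\<in>seg mem m. S (el (k + 1)) = poly_add mem R n (S (el k)) (s k)) \<and>
         r = S (el m))"

definition hf_generated ::
    "('k::field \<Rightarrow> 'f \<Rightarrow> bool) \<Rightarrow> 'k set \<Rightarrow> 'k \<Rightarrow> ('k, 'f) elt set \<Rightarrow> bool" where
  "hf_generated mem R n \<I> \<longleftrightarrow>
     (\<exists>J\<subseteq>\<I>. hyperfinite (Keq mem) J \<and>
        (\<forall>f\<in>\<I>. \<exists>m\<in>NN mem. \<exists>g\<in>hf_fun mem m J. \<exists>a\<in>hf_fun mem m (polys mem R n).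
           f = hf_sum mem R n m
                 (\<lambda>i. poly_mult mem R n (hf_app mem m (polys mem R n) a i) (hf_app mem m J g i))))"

end

theory Submission
  imports Defs
begin

text \<open>
  With respect to the lexicographic order, every non-empty definable set of exponents has a least
  element and every non-zero polynomial has a leading exponent. A definable form of Dickson's
  lemma, proved by an induction for a single definable predicate although the number \<open>n\<close> of
  variables may be non-standard, yields a hyperfinite set \<open>J\<close> of elements of the ideal such that the
  leading exponent of each element is divisible by that of a member of \<open>J\<close>. Among the elements that
  are not hyperfinite combinations of members of \<open>J\<close>, choose one with the least leading exponent;
  subtracting a monomial multiple of a member of \<open>J\<close> makes the leading exponent smaller, a
  contradiction.

  For these arguments definable sets of imaginaries must have definable finite power sets.
  Hyperfinite sets of tuples are coded by tuples of elements of the two home sorts, using an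
  affine function \<open>(x, b) \<mapsto> x + c b\<close> that is injective on a given product of hyperfinite sets.
\<close>

section \<open>Definable predicates and terms\<close>

text \<open>Over a non-standard \<open>NN mem\<close> the usual well-foundedness arguments may fail:
  minima and induction are available for definable sets only. So every predicate used in such an
  argument must be shown to be first-order, and this shapes the whole proof. A calculus of definable
  predicates and terms makes these obligations syntax-directed. Being a hyperfinite combination of
  members of \<open>J\<close> must be first-order as well, so a combination is stored as a
  hyperfinite table of summands together with the table of its partial sums. The coefficients in
  such a table are single monomials: \<open>poly_mult\<close> is then evaluated only for a one-term
  first factor, where its recursion has two stages, and closure of the ideal under products comes
  from the hypothesis. The affine function of the coding exists because the quotients of differences
  of hyperfinite sets form a hyperfinite set, and no hyperfinite set exhausts the field: otherwise
  it would witness \<open>- 1 \<in> K0 mem\<close>. Definable characteristic zero takes the place of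
  the infinity of the field.\<close>

primrec rename_fm :: "(nat \<Rightarrow> nat) \<Rightarrow> ('s, 'r) fm \<Rightarrow> ('s, 'r) fm" where
  "rename_fm f (EqF i j) = EqF (f i) (f j)"
| "rename_fm f (RelF r js) = RelF r (map f js)"
| "rename_fm f (NegF \<phi>) = NegF (rename_fm f \<phi>)"
| "rename_fm f (ConjF \<phi> \<psi>) = ConjF (rename_fm f \<phi>) (rename_fm f \<psi>)"
| "rename_fm f (ExF s \<phi>) = ExF s (rename_fm (case_nat 0 (\<lambda>i. Suc (f i))) \<phi>)"

text \<open>Atoms with an out-of-range index are false, so a renaming must keep out-of-range indices
  out of range; this is the second assumption. Under a quantifier the renaming is lifted so that 0,
  the new witness, stays fixed.\<close>

lemma sat_rename_fm:
  assumes "\<And>i. i < length xs \<Longrightarrow> f i < length ys \<and> ys ! f i = xs ! i"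
    and "\<And>i. length xs \<le> i \<Longrightarrow> length ys \<le> f i"
  shows "sat M (rename_fm f \<phi>) ys \<longleftrightarrow> sat M \<phi> xs"
  using assms
proof (induction \<phi> arbitrary: f xs ys)
  case (EqF i j)
  then show ?case by (metis leD linorder_le_less_linear rename_fm.simps(1) sat.simps(1))
next
  case (RelF r js)
  have *: "f i < length ys \<longleftrightarrow> i < length xs" for i
    using RelF by (metis leD linorder_le_less_linear)
  have "map (\<lambda>i. ys ! f i) js = map (\<lambda>i. xs ! i) js" if "\<forall>i\<in>set js. i < length xs"
    using that RelF(1) by (intro map_cong) auto
  then show ?case by (auto simp: * o_def simp del: map_eq_conv)
next
  case (NegF \<phi>)
  have "sat M (rename_fm f \<phi>) ys = sat M \<phi> xs" by (rule NegF.IH) (use NegF.prems in auto)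
  then show ?case by simp
next
  case (ConjF \<phi>1 \<phi>2)
  have "sat M (rename_fm f \<phi>1) ys = sat M \<phi>1 xs" by (rule ConjF.IH(1)) (use ConjF.prems in auto)
  moreover have "sat M (rename_fm f \<phi>2) ys = sat M \<phi>2 xs" by (rule ConjF.IH(2)) (use ConjF.prems in
      auto)
  ultimately show ?case by simp
next
  case (ExF s \<phi>)
  have "sat M (rename_fm (case_nat 0 (\<lambda>i. Suc (f i))) \<phi>) (a # ys) \<longleftrightarrow>
      sat M \<phi> (a # xs)" for a
  proof (rule ExF.IH)
    fix i
    show "i < length (a # xs) \<Longrightarrow> case_nat 0 (\<lambda>i. Suc (f i)) i < length (a # ys) \<and>
        (a # ys) ! case_nat 0 (\<lambda>i. Suc (f i)) i = (a # xs) ! i"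
      using ExF.prems(1) by (cases i) auto
    show "length (a # xs) \<le> i \<Longrightarrow> length (a # ys) \<le> case_nat 0 (\<lambda>i. Suc (f i)) i"
      using ExF.prems(2) by (cases i) auto
  qed
  then show ?case by simp
qed

text \<open>
  A context \<open>\<Gamma>\<close> lists the sets over which the variables \<open>e 0\<close>, \<open>e 1\<close>, ... of an environment range.
  Environments are functions, so that the quantifier rules below can pass to the environment
  \<open>\<lambda>i. e (Suc i)\<close> of the outer variables, and beta-reduction alone renumbers the variables.
\<close>

definition env :: "'u list set list \<Rightarrow> (nat \<Rightarrow> 'u list) \<Rightarrow> bool" where
  "env \<Gamma> e \<longleftrightarrow> (\<forall>i<length \<Gamma>. e i \<in> \<Gamma> ! i)"

definition flat :: "'u list set list \<Rightarrow> (nat \<Rightarrow> 'u list) \<Rightarrow> 'u list" where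
  "flat \<Gamma> e = concat (map e [0..<length \<Gamma>])"

text \<open>The common length of the elements of \<open>V\<close>; for \<open>V = {}\<close> the value is arbitrary.\<close>

definition ar :: "'u list set \<Rightarrow> nat" where
  "ar V = length (SOME x. x \<in> V)"

lemma env_Cons: "env (Y # \<Gamma>) e \<longleftrightarrow> e 0 \<in> Y \<and>
    env \<Gamma> (\<lambda>i. e (Suc i))"
  by (auto simp: env_def less_Suc_eq_0_disj)

lemma env_Nil [simp]: "env [] e"
  by (auto simp: env_def)

lemma flat_Cons: "flat (Y # \<Gamma>) e = e 0 @ flat \<Gamma> (\<lambda>i. e (Suc i))"
  by (simp add: flat_def upt_conv_Cons map_Suc_upt[symmetric] o_def del: upt_Suc)

lemma flat_Nil [simp]: "flat [] e = []"
  by (simp add: flat_def)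

lemma map_nth_shift: "map (nth (xs @ ys)) [length xs + a..<length xs + b] = map (nth ys) [a..<b]"
  by (rule nth_equalityI) (auto simp: nth_append)

lemma ex_tuples_Cons: "(\<exists>ys\<in>tuples M (s # ss). P ys) \<longleftrightarrow>
    (\<exists>a\<in>dom M s. \<exists>ys\<in>tuples M ss. P (a # ys))"
  by (auto simp: tuples_def list_all2_Cons2)

lemma tuples_length: "ys \<in> tuples M ss \<Longrightarrow> length ys = length ss"
  by (auto simp: tuples_def list_all2_lengthD)

text \<open>The set \<open>A\<close> of admissible parameters is left open because two instances are
  used: all elements of the structure, for definability as in the theorem, and the empty set, for
  the home structure, whose formulas define the imaginary sorts and must be parameter-free.\<close>

locale definability =
  fixes M :: "('s, 'r, 'u) struct" and A :: "'u set"
begin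

section \<open>Definable predicates on lists of a fixed length\<close>

definition dfn_list :: "nat \<Rightarrow> ('u list \<Rightarrow> bool) \<Rightarrow> bool" where
  "dfn_list k Q \<longleftrightarrow> (\<exists>\<phi> ps. set ps \<subseteq> A \<and>
      (\<forall>xs. length xs = k \<longrightarrow> (Q xs \<longleftrightarrow> sat M \<phi> (xs @ ps))))"

lemma dfn_list_cong: "(\<And>xs. length xs = k \<Longrightarrow> Q xs = Q' xs) \<Longrightarrow>
    dfn_list k Q \<longleftrightarrow> dfn_list k Q'"
  by (simp add: dfn_list_def)

lemma dfn_list_map:
  assumes "dfn_list k Q" "length js = k" "set js \<subseteq> {..<k'}"
  shows "dfn_list k' (\<lambda>xs. Q (map (nth xs) js))"
proof -
  obtain \<phi> ps where *: "set ps \<subseteq> A" "\<And>xs. length xs = k \<Longrightarrow>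
      (Q xs \<longleftrightarrow> sat M \<phi> (xs @ ps))"
    using assms unfolding dfn_list_def by blast
  \<comment> \<open>Variables are redirected through \<open>js\<close>; the remaining indices point
    to parameters, which move from position \<open>k\<close> to position \<open>k'\<close>.\<close>
  define f where "f i = (if i < k then js ! i else i - k + k')" for i
  have "Q (map (nth xs) js) \<longleftrightarrow> sat M (rename_fm f \<phi>) (xs @ ps)" if "length xs = k'"
      for xs
  proof -
    have js: "js ! i < k'" if "i < k" for i using assms that by (metis lessThan_iff nth_mem subsetD)
    have "sat M (rename_fm f \<phi>) (xs @ ps) = sat M \<phi> (map (nth xs) js @ ps)"
      by (rule sat_rename_fm) (use assms that js in \<open>auto simp: f_def nth_append trans_less_add1\<close>)
    then show ?thesis using *(2) assms by simp
  qed
  then show ?thesis using *(1) unfolding dfn_list_def by blast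
qed

lemma dfn_list_Not: "dfn_list k Q \<Longrightarrow> dfn_list k (\<lambda>xs. \<not> Q xs)"
  unfolding dfn_list_def
proof (elim exE conjE)
  fix \<phi> ps assume "set ps \<subseteq> A" "\<forall>xs. length xs = k \<longrightarrow>
      Q xs = sat M \<phi> (xs @ ps)"
  then show "\<exists>\<phi> ps. set ps \<subseteq> A \<and> (\<forall>xs. length xs = k \<longrightarrow>
      (\<not> Q xs) = sat M \<phi> (xs @ ps))"
    by (intro exI[of _ "NegF \<phi>"] exI[of _ ps]) simp
qed

lemma dfn_list_conj:
  assumes "dfn_list k P" "dfn_list k Q"
  shows "dfn_list k (\<lambda>xs. P xs \<and> Q xs)"
proof -
  obtain \<phi> ps where 1: "set ps \<subseteq> A" "\<And>xs. length xs = k \<Longrightarrow>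
      (P xs \<longleftrightarrow> sat M \<phi> (xs @ ps))"
    using assms unfolding dfn_list_def by blast
  obtain \<psi> qs where 2: "set qs \<subseteq> A" "\<And>xs. length xs = k \<Longrightarrow>
      (Q xs \<longleftrightarrow> sat M \<psi> (xs @ qs))"
    using assms unfolding dfn_list_def by blast
  \<comment> \<open>The two parameter lists are concatenated. The parameters of the first formula
    keep their places, but its out-of-range indices must jump over \<open>qs\<close> to remain out
    of range; the parameters of the second formula move behind \<open>ps\<close>.\<close>
  define f where "f i = (if i < k + length ps then i else i + length qs)" for i
  define g where "g i = (if i < k then i else i + length ps)" for i
  have "sat M (rename_fm f \<phi>) (xs @ ps @ qs) = sat M \<phi> (xs @ ps)" if "length xs = k" for xs
    by (rule sat_rename_fm) (use that in \<open>auto simp: f_def nth_append\<close>)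
  moreover have "sat M (rename_fm g \<psi>) (xs @ ps @ qs) = sat M \<psi> (xs @ qs)" if "length xs = k" for xs
    by (rule sat_rename_fm) (use that in \<open>auto simp: g_def nth_append\<close>)
  ultimately have "length xs = k \<Longrightarrow> (P xs \<and> Q xs) = sat M (ConjF (rename_fm f \<phi>)
      (rename_fm g \<psi>)) (xs @ ps @ qs)" for xs
    by (simp add: 1 2)
  then show ?thesis unfolding dfn_list_def using 1(1) 2(1)
    by (intro exI[of _ "ConjF (rename_fm f \<phi>) (rename_fm g \<psi>)"] exI[of _ "ps @ qs"]) auto
qed

lemma dfn_list_const: "dfn_list k (\<lambda>xs. b)"
proof -
  have "dfn_list k (\<lambda>xs. False)"
    unfolding dfn_list_def
    by (intro exI[of _ "ConjF (EqF 0 0) (NegF (EqF 0 0))"] exI[of _ "[]"]) auto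
  from this dfn_list_Not[OF this] show ?thesis by (cases b) auto
qed

lemma dfn_list_ex:
  assumes "dfn_list (Suc k) Q"
  shows "dfn_list k (\<lambda>xs. \<exists>a\<in>dom M s. Q (a # xs))"
proof -
  obtain \<phi> ps where 1: "set ps \<subseteq> A" "\<And>xs. length xs = Suc k \<Longrightarrow>
      (Q xs \<longleftrightarrow> sat M \<phi> (xs @ ps))"
    using assms unfolding dfn_list_def by blast
  then have "length xs = k \<Longrightarrow> (\<exists>a\<in>dom M s. Q (a # xs)) = sat M (ExF s \<phi>) (xs
      @ ps)" for xs
    by simp
  with 1(1) show ?thesis unfolding dfn_list_def by blast
qed

lemma dfn_list_eq: "i < k \<Longrightarrow> j < k \<Longrightarrow> dfn_list k (\<lambda>xs. xs ! i = xs ! j)"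
  unfolding dfn_list_def by (intro exI[of _ "EqF i j"] exI[of _ "[]"]) auto

lemma dfn_list_eq_param:
  assumes "i < k" "a \<in> A"
  shows "dfn_list k (\<lambda>xs. xs ! i = a)"
  unfolding dfn_list_def using assms
  by (intro exI[of _ "EqF i k"] exI[of _ "[a]"]) (auto simp: nth_append)

lemma dfn_list_rel: "set js \<subseteq> {..<k} \<Longrightarrow> dfn_list k (\<lambda>xs. map (nth xs) js
    \<in> rel M r)"
  unfolding dfn_list_def
proof (intro exI[of _ "RelF r js"] exI[of _ "[]"] conjI allI impI)
  fix xs :: "'u list" assume "set js \<subseteq> {..<k}" "length xs = k"
  then show "(map ((!) xs) js \<in> rel M r) = sat M (RelF r js) (xs @ [])"
    by (auto simp: subset_iff)
qed auto

text \<open>Sort membership is not an atom of the language; it is expressed by a quantifier over the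
  sort and an equation.\<close>

lemma dfn_list_dom:
  assumes "i < k" shows "dfn_list k (\<lambda>xs. xs ! i \<in> dom M s)"
proof -
  have "dfn_list k (\<lambda>xs. \<exists>a\<in>dom M s. (a # xs) ! Suc i = (a # xs) ! 0)"
    by (rule dfn_list_ex, rule dfn_list_eq) (use assms in auto)
  then show ?thesis by simp
qed

lemma dfn_list_All_less:
  fixes n :: nat
  shows "(\<And>j. j < n \<Longrightarrow> dfn_list k (Q j)) \<Longrightarrow>
      dfn_list k (\<lambda>xs. \<forall>j<n. Q j xs)"
proof (induction n)
  case 0 show ?case using dfn_list_const[of k True] by simp
next
  case (Suc n)
  then have "dfn_list k (\<lambda>xs. Q n xs \<and> (\<forall>j<n. Q j xs))" by (intro dfn_list_conj) auto
  then show ?case by (simp add: All_less_Suc)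
qed

lemma dfn_list_tuples: "length ss \<le> k \<Longrightarrow> dfn_list k (\<lambda>xs. take (length ss) xs
    \<in> tuples M ss)"
proof -
  assume *: "length ss \<le> k"
  have "dfn_list k (\<lambda>xs. \<forall>j<length ss. xs ! j \<in> dom M (ss ! j))"
    by (intro dfn_list_All_less dfn_list_dom) (use * in auto)
  then show ?thesis
    using * by (subst dfn_list_cong[where Q' = "\<lambda>xs. \<forall>j<length ss. xs ! j \<in> dom M (ss !
        j)"])
      (auto simp: tuples_def list_all2_conv_all_nth)
qed

lemma dfn_list_ex_tuples: "dfn_list (length ss + k) Q \<Longrightarrow>
    dfn_list k (\<lambda>xs. \<exists>ys\<in>tuples M ss. Q (ys @ xs))"
proof (induction ss arbitrary: k Q)
  case Nil
  then show ?case by (simp add: tuples_def)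
next
  case (Cons s ss)
  \<comment> \<open>Quantifying the head of the tuple last puts it behind the other components;
    \<open>js\<close> turns \<open>ys @ a # xs\<close> back into \<open>a # ys @ xs\<close>.\<close>
  define js where "js = [length ss] @ [0..<length ss] @ [Suc (length ss)..<Suc (length ss + k)]"
  have 1: "map (nth (ys @ a # xs)) js = a # ys @ xs"
    if "length ys = length ss" "length xs = k" for ys a xs
  proof -
    have "map (nth (ys @ a # xs)) [0..<length ss] = ys"
      using that by (auto intro!: nth_equalityI simp: nth_append)
    moreover have "map (nth (ys @ a # xs)) [Suc (length ss)..<Suc (length ss + k)] = xs"
      using that by (auto intro!: nth_equalityI simp: nth_append simp del: upt_Suc)
    ultimately show ?thesis using that by (simp add: js_def nth_append del: upt_Suc)
  qed
  have "dfn_list (length ss + Suc k) (\<lambda>zs. Q (map (nth zs) js))"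
    by (rule dfn_list_map[OF Cons.prems]) (auto simp: js_def)
  from dfn_list_ex[OF Cons.IH[OF this]]
  have "dfn_list k (\<lambda>xs. \<exists>a\<in>dom M s. \<exists>ys\<in>tuples M ss. Q (map (nth (ys @ a #
      xs)) js))" .
  then show ?case
  proof (subst dfn_list_cong)
    fix xs :: "'u list" assume "length xs = k"
    then show "(\<exists>ys\<in>tuples M (s # ss). Q (ys @ xs)) =
      (\<exists>a\<in>dom M s. \<exists>ys\<in>tuples M ss. Q (map (nth (ys @ a # xs)) js))"
      by (simp add: ex_tuples_Cons 1 tuples_length cong: bex_cong)
  qed auto
qed

definition dset :: "'u list set \<Rightarrow> bool" where
  "dset V \<longleftrightarrow> (\<exists>ss. V \<subseteq> tuples M ss \<and>
      dfn_list (length ss) (\<lambda>xs. xs \<in> V))"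

lemma dset_tuples_ar: "V \<subseteq> tuples M ss \<Longrightarrow> V \<noteq> {} \<Longrightarrow>
    length ss = ar V"
proof -
  assume "V \<subseteq> tuples M ss" "V \<noteq> {}"
  moreover from this have "(SOME x. x \<in> V) \<in> V" by (auto intro: someI_ex)
  ultimately show ?thesis unfolding ar_def by (metis tuples_length subsetD)
qed

lemma dset_length: "dset V \<Longrightarrow> x \<in> V \<Longrightarrow> length x = ar V"
proof -
  assume "dset V" "x \<in> V"
  then obtain ss where ss: "V \<subseteq> tuples M ss" by (auto simp: dset_def)
  then have "length x = length ss" using \<open>x \<in> V\<close> by (auto intro: tuples_length)
  then show ?thesis using dset_tuples_ar[OF ss] \<open>x \<in> V\<close> by auto
qed

lemma dset_dfn_list: "dset V \<Longrightarrow> dfn_list (ar V) (\<lambda>xs. xs \<in> V)"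
proof (cases "V = {}")
  case True
  then show ?thesis using dfn_list_const[of _ False] by simp
next
  case False
  assume V: "dset V"
  then obtain ss where ss: "V \<subseteq> tuples M ss" "dfn_list (length ss) (\<lambda>xs. xs \<in> V)"
      by (auto simp: dset_def)
  obtain x where "x \<in> V" using False by auto
  then have "length ss = ar V" using dset_tuples_ar ss(1) by blast
  then show ?thesis using ss by simp
qed

lemma dset_tuples [simp]: "dset (tuples M ss)"
proof -
  have "dfn_list (length ss) (\<lambda>xs. xs \<in> tuples M ss)"
    using dfn_list_tuples[of ss "length ss"]
      dfn_list_cong[of "length ss" "\<lambda>xs. take (length ss) xs \<in> tuples M ss"
          "\<lambda>xs. xs \<in> tuples M ss"] by simp
  then show ?thesis unfolding dset_def by blast
qed

lemma dset_empty [simp]: "dset {}"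
  unfolding dset_def using dfn_list_const[of _ False] by auto

definition arsum :: "'u list set list \<Rightarrow> nat" where
  "arsum \<Gamma> = sum_list (map ar \<Gamma>)"

text \<open>
  The hypothesis that the members of \<open>\<Gamma>\<close> are definable is part of the definition, which frees most
  rules from side conditions on the context.
\<close>

definition dfn :: "'u list set list \<Rightarrow> ((nat \<Rightarrow> 'u list) \<Rightarrow> bool)
    \<Rightarrow> bool" where
  "dfn \<Gamma> P \<longleftrightarrow> ((\<forall>V\<in>set \<Gamma>. dset V) \<longrightarrow>
     (\<exists>Q. dfn_list (arsum \<Gamma>) Q \<and> (\<forall>e. env \<Gamma> e \<longrightarrow>
         (P e \<longleftrightarrow> Q (flat \<Gamma> e)))))"

section \<open>Definable predicates of environments\<close>

lemma env_dset_length: "\<forall>V\<in>set \<Gamma>. dset V \<Longrightarrow>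
    env \<Gamma> e \<Longrightarrow> i < length \<Gamma> \<Longrightarrow> length (e i) = ar (\<Gamma> ! i)"
  using dset_length by (auto simp: env_def)

lemma length_flat: "\<forall>V\<in>set \<Gamma>. dset V \<Longrightarrow> env \<Gamma> e \<Longrightarrow>
    length (flat \<Gamma> e) = arsum \<Gamma>"
  by (induction \<Gamma> arbitrary: e) (auto simp: flat_Cons env_Cons dset_length arsum_def)

lemma dfn_cong: "(\<And>e. env \<Gamma> e \<Longrightarrow> P e = P' e) \<Longrightarrow>
    dfn \<Gamma> P \<longleftrightarrow> dfn \<Gamma> P'"
  unfolding dfn_def by simp

lemma dfn_congI: "dfn \<Gamma> P' \<Longrightarrow> (\<And>e. env \<Gamma> e \<Longrightarrow>
    P e = P' e) \<Longrightarrow> dfn \<Gamma> P"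
  using dfn_cong[of \<Gamma> P P'] by blast

lemma dfn_Not: "dfn \<Gamma> P \<Longrightarrow> dfn \<Gamma> (\<lambda>e. \<not> P e)"
  unfolding dfn_def
proof (intro impI)
  assume *: "\<forall>V\<in>set \<Gamma>. dset V"
    and P: "(\<forall>V\<in>set \<Gamma>. dset V) \<longrightarrow> (\<exists>Q. dfn_list (arsum \<Gamma>) Q
        \<and> (\<forall>e. env \<Gamma> e \<longrightarrow> P e = Q (flat \<Gamma> e)))"
  from * P obtain P' where P': "dfn_list (arsum \<Gamma>) P'" "\<forall>e. env \<Gamma> e \<longrightarrow>
      P e = P' (flat \<Gamma> e)" by blast
  show "\<exists>Q. dfn_list (arsum \<Gamma>) Q \<and> (\<forall>e. env \<Gamma> e \<longrightarrow>
      (\<not> P e) = Q (flat \<Gamma> e))"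
    by (intro exI[of _ "\<lambda>xs. \<not> P' xs"]) (use P' dfn_list_Not in auto)
qed

lemma dfn_conj: "dfn \<Gamma> P \<Longrightarrow> dfn \<Gamma> Q \<Longrightarrow>
    dfn \<Gamma> (\<lambda>e. P e \<and> Q e)"
  unfolding dfn_def
proof (intro impI)
  assume *: "\<forall>V\<in>set \<Gamma>. dset V"
    and P: "(\<forall>V\<in>set \<Gamma>. dset V) \<longrightarrow> (\<exists>Q. dfn_list (arsum \<Gamma>) Q
        \<and> (\<forall>e. env \<Gamma> e \<longrightarrow> P e = Q (flat \<Gamma> e)))"
    and Q: "(\<forall>V\<in>set \<Gamma>. dset V) \<longrightarrow>
        (\<exists>Qa. dfn_list (arsum \<Gamma>) Qa \<and> (\<forall>e. env \<Gamma> e \<longrightarrow>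
        Q e = Qa (flat \<Gamma> e)))"
  from * P obtain P' where P': "dfn_list (arsum \<Gamma>) P'" "\<forall>e. env \<Gamma> e \<longrightarrow>
      P e = P' (flat \<Gamma> e)" by blast
  from * Q obtain Q' where Q': "dfn_list (arsum \<Gamma>) Q'" "\<forall>e. env \<Gamma> e \<longrightarrow>
      Q e = Q' (flat \<Gamma> e)" by blast
  show "\<exists>Qa. dfn_list (arsum \<Gamma>) Qa \<and> (\<forall>e. env \<Gamma> e \<longrightarrow>
      (P e \<and> Q e) = Qa (flat \<Gamma> e))"
    by (intro exI[of _ "\<lambda>xs. P' xs \<and> Q' xs"]) (use P' Q' dfn_list_conj in auto)
qed

lemma dfn_disj: "dfn \<Gamma> P \<Longrightarrow> dfn \<Gamma> Q \<Longrightarrow>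
    dfn \<Gamma> (\<lambda>e. P e \<or> Q e)"
  using dfn_Not[OF dfn_conj[OF dfn_Not[of \<Gamma> P] dfn_Not[of \<Gamma> Q]]] by simp

lemma dfn_imp: "dfn \<Gamma> P \<Longrightarrow> dfn \<Gamma> Q \<Longrightarrow>
    dfn \<Gamma> (\<lambda>e. P e \<longrightarrow> Q e)"
  unfolding imp_conv_disj by (rule dfn_disj; (rule dfn_Not)?)

lemma dfn_iff: "dfn \<Gamma> P \<Longrightarrow> dfn \<Gamma> Q \<Longrightarrow>
    dfn \<Gamma> (\<lambda>e. P e \<longleftrightarrow> Q e)"
  unfolding iff_conv_conj_imp by (rule dfn_conj; rule dfn_imp)

lemma dfn_const: "dfn \<Gamma> (\<lambda>e. b)"
  unfolding dfn_def using dfn_list_const[of _ b] by (intro impI exI[of _ "\<lambda>_. b"]) auto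

lemma dfn_All_less:
  fixes n :: nat
  shows "(\<And>j. j < n \<Longrightarrow> dfn \<Gamma> (Q j)) \<Longrightarrow>
      dfn \<Gamma> (\<lambda>xs. \<forall>j<n. Q j xs)"
proof (induction n)
  case 0 show ?case using dfn_const[of \<Gamma> True] by simp
next
  case (Suc n)
  then have "dfn \<Gamma> (\<lambda>xs. Q n xs \<and> (\<forall>j<n. Q j xs))" by (intro dfn_conj) auto
  then show ?case by (simp add: All_less_Suc)
qed

text \<open>A quantifier over a definable set is a quantifier over a product of sorts with
  membership in \<open>Y\<close> as an additional conjunct. The case of empty \<open>Y\<close> is
  separate because \<open>ar Y\<close> then says nothing about the sorts.\<close>

lemma dfn_bex:
  assumes Y: "dset Y" and P: "dfn (Y # \<Gamma>) (\<lambda>e. P (e 0) (\<lambda>i. e (Suc i)))"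
  shows "dfn \<Gamma> (\<lambda>e. \<exists>y\<in>Y. P y e)"
proof (cases "Y = {}")
  case True
  then show ?thesis using dfn_const[of \<Gamma> False] by simp
next
  case False
  show ?thesis unfolding dfn_def
  proof (intro impI)
    assume *: "\<forall>V\<in>set \<Gamma>. dset V"
    with P Y obtain Q where Q: "dfn_list (arsum (Y # \<Gamma>)) Q"
      "\<And>e. env (Y # \<Gamma>) e \<Longrightarrow> P (e 0) (\<lambda>i. e (Suc i)) = Q (flat (Y #
          \<Gamma>) e)"
      unfolding dfn_def by (auto 0 3)
    obtain ss where ss: "Y \<subseteq> tuples M ss" using Y by (auto simp: dset_def)
    obtain y0 where "y0 \<in> Y" using False by auto
    then have l: "length ss = ar Y" using dset_tuples_ar ss by blast
    have "dfn_list (length ss + arsum \<Gamma>) (\<lambda>xs. map (nth xs) [0..<ar Y] \<in> Y \<and> Q xs)"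
      by (intro dfn_list_conj dfn_list_map[OF dset_dfn_list[OF Y]]) (use Q l in \<open>auto simp:
          arsum_def\<close>)
    from dfn_list_ex_tuples[OF this]
    have D: "dfn_list (arsum \<Gamma>) (\<lambda>xs. \<exists>ys\<in>tuples M ss. map ((!) (ys @ xs)) [0..<ar
        Y] \<in> Y \<and> Q (ys @ xs))" .
    have "(\<exists>y\<in>Y. P y e) = (\<exists>ys\<in>tuples M ss. map ((!) (ys @ flat \<Gamma> e)) [0..<ar
        Y] \<in> Y \<and> Q (ys @ flat \<Gamma> e))"
      if e: "env \<Gamma> e" for e
    proof -
      have "P y e = Q (y @ flat \<Gamma> e)" if "y \<in> Y" for y
        using Q(2)[of "case_nat y e"] that e by (simp add: env_Cons flat_Cons)
      moreover have "map ((!) (ys @ flat \<Gamma> e)) [0..<ar Y] = ys" if "ys \<in> tuples M ss" for ys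
        using that l by (auto intro!: nth_equalityI simp: nth_append tuples_def dest: list_all2_lengthD)
      ultimately show ?thesis using ss by auto
    qed
    with D show "\<exists>Q. dfn_list (arsum \<Gamma>) Q \<and> (\<forall>e. env \<Gamma> e \<longrightarrow>
        (\<exists>y\<in>Y. P y e) = Q (flat \<Gamma> e))" by blast
  qed
qed

lemma dfn_ball:
  "dset Y \<Longrightarrow> dfn (Y # \<Gamma>) (\<lambda>e. P (e 0) (\<lambda>i. e (Suc i)))
      \<Longrightarrow> dfn \<Gamma> (\<lambda>e. \<forall>y\<in>Y. P y e)"
  using dfn_Not[OF dfn_bex[of Y \<Gamma> "\<lambda>y e. \<not> P y e"]] dfn_Not[of "Y # \<Gamma>"
      "\<lambda>e. P (e 0) (\<lambda>i. e (Suc i))"]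
  by simp

lemma flat_nth:
  assumes "\<forall>V\<in>set \<Gamma>. dset V" "env \<Gamma> e" "i < length \<Gamma>"
  shows "map (nth (flat \<Gamma> e)) [arsum (take i \<Gamma>)..<arsum (take i \<Gamma>) + ar (\<Gamma> ! i)]
      = e i"
    and "arsum (take i \<Gamma>) + ar (\<Gamma> ! i) \<le> arsum \<Gamma>"
  using assms
proof (induction \<Gamma> arbitrary: e i)
  case (Cons Y \<Gamma>)
  { case 1
    show ?case
    proof (cases i)
      case 0
      then show ?thesis using 1
        by (auto intro!: nth_equalityI simp: flat_Cons arsum_def env_Cons nth_append dset_length)
    next
      case (Suc j)
      then have "length (e 0) = ar Y" using 1 by (simp add: env_Cons dset_length)
      then show ?thesis using 1 Suc Cons.IH(1)[of "\<lambda>i. e (Suc i)" j]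
        map_nth_shift[of "e 0" "flat \<Gamma> (\<lambda>i. e (Suc i))" "arsum (take j \<Gamma>)"
            "arsum (take j \<Gamma>) + ar (\<Gamma> ! j)"]
        by (simp add: env_Cons flat_Cons arsum_def add.assoc)
    qed
  next
    case 2
    then show ?case using Cons.IH(2)[of "\<lambda>i. e (Suc i)" "i - 1"]
      by (cases i) (auto simp: env_Cons arsum_def)
  }
qed auto

text \<open>A variable of the new context may range over a smaller set than the one it replaces.
  That both sets have the same arity can be seen only from an element of the smaller one, whence the
  case distinction on the existence of an environment.\<close>

lemma dfn_rename_fm:
  assumes P: "dfn \<Delta> P" and \<Delta>: "\<forall>V\<in>set \<Delta>. dset V"
    and \<rho>: "\<And>i. i < length \<Delta> \<Longrightarrow> \<rho> i < length \<Gamma> \<and>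
        \<Gamma> ! \<rho> i \<subseteq> \<Delta> ! i"
  shows "dfn \<Gamma> (\<lambda>e. P (\<lambda>i. e (\<rho> i)))"
proof (cases "\<exists>e. env \<Gamma> e")
  case False
  then show ?thesis by (subst dfn_cong[of _ _ "\<lambda>_. True"]) (auto intro: dfn_const)
next
  case True
  then obtain e0 where e0: "env \<Gamma> e0" by auto
  show ?thesis unfolding dfn_def
  proof (intro impI)
    assume *: "\<forall>V\<in>set \<Gamma>. dset V"
    have ar: "ar (\<Gamma> ! \<rho> i) = ar (\<Delta> ! i)" if "i < length \<Delta>" for i
    proof -
      have "e0 (\<rho> i) \<in> \<Gamma> ! \<rho> i" "dset (\<Gamma> ! \<rho> i)"
          "e0 (\<rho> i) \<in> \<Delta> ! i" "dset (\<Delta> ! i)"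
        using e0 \<rho>[OF that] * \<Delta> that by (auto simp: env_def)
      then show ?thesis using dset_length by metis
    qed
    obtain Q where Q: "dfn_list (arsum \<Delta>) Q" "\<And>e. env \<Delta> e \<Longrightarrow>
        P e = Q (flat \<Delta> e)"
      using P \<Delta> unfolding dfn_def by blast
    define js where
      "js = concat (map (\<lambda>i. [arsum (take (\<rho> i) \<Gamma>)..<arsum (take (\<rho> i) \<Gamma>) +
          ar (\<Gamma> ! \<rho> i)]) [0..<length \<Delta>])"
    have "length js = sum_list (map (\<lambda>i. ar (\<Gamma> ! \<rho> i)) [0..<length \<Delta>])"
      by (simp add: js_def length_concat o_def)
    also have "\<dots> = sum_list (map (\<lambda>i. ar (\<Delta> ! i)) [0..<length \<Delta>])"
      by (intro arg_cong[of _ _ sum_list] map_cong) (auto simp: ar)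
    also have "\<dots> = arsum \<Delta>" unfolding arsum_def
      by (intro arg_cong[of _ _ sum_list]) (auto intro: nth_equalityI)
    finally have 1: "length js = arsum \<Delta>" .
    have 2: "set js \<subseteq> {..<arsum \<Gamma>}"
      using flat_nth(2)[OF * e0] \<rho> unfolding js_def by fastforce
    have 3: "map (nth (flat \<Gamma> e)) js = flat \<Delta> (\<lambda>i. e (\<rho> i))" if "env \<Gamma> e"
        for e
      unfolding js_def flat_def[of \<Delta>] map_concat map_map
      by (intro arg_cong[of _ _ concat] map_cong refl) (use flat_nth(1)[OF * that] \<rho> in auto)
    have "env \<Delta> (\<lambda>i. e (\<rho> i))" if "env \<Gamma> e" for e
      using that \<rho> unfolding env_def by (meson subsetD)
    with 3 Q(2) dfn_list_map[OF Q(1) 1 2]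
    show "\<exists>Q. dfn_list (arsum \<Gamma>) Q \<and> (\<forall>e. env \<Gamma> e \<longrightarrow>
        P (\<lambda>i. e (\<rho> i)) = Q (flat \<Gamma> e))"
      by (intro exI[of _ "\<lambda>xs. Q (map (nth xs) js)"]) auto
  qed
qed

text \<open>Atoms speak of single elements whereas variables stand for tuples; a coordinate term
  reads one fixed position of the flattened environment.\<close>

definition dfn_coord :: "'u list set list \<Rightarrow> ((nat \<Rightarrow> 'u list) \<Rightarrow> 'u)
    \<Rightarrow> bool" where
  "dfn_coord \<Gamma> t \<longleftrightarrow> ((\<forall>V\<in>set \<Gamma>. dset V) \<longrightarrow>
    (\<exists>e. env \<Gamma> e) \<longrightarrow> (\<exists>i<arsum \<Gamma>. \<forall>e. env \<Gamma> e
        \<longrightarrow> t e = flat \<Gamma> e ! i))"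

lemma dfn_coord_var:
  assumes "i < length \<Gamma>" "\<And>x. x \<in> \<Gamma> ! i \<Longrightarrow> j < length x"
  shows "dfn_coord \<Gamma> (\<lambda>e. e i ! j)"
  unfolding dfn_coord_def
proof (intro impI)
  assume *: "\<forall>V\<in>set \<Gamma>. dset V" "\<exists>e. env \<Gamma> e"
  then obtain e0 where e0: "env \<Gamma> e0" by auto
  then have "e0 i \<in> \<Gamma> ! i" using assms by (auto simp: env_def)
  then have j: "j < ar (\<Gamma> ! i)" using assms(2) dset_length * assms(1) by (metis nth_mem)
  have "e i ! j = flat \<Gamma> e ! (arsum (take i \<Gamma>) + j)" if "env \<Gamma> e" for e
    using arg_cong[OF flat_nth(1)[OF *(1) that assms(1)], of "\<lambda>x. x ! j"] j by simp
  moreover have "arsum (take i \<Gamma>) + j < arsum \<Gamma>" using j flat_nth(2)[OF *(1) e0 assms(1)] by simp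
  ultimately show "\<exists>k<arsum \<Gamma>. \<forall>e. env \<Gamma> e \<longrightarrow>
      e i ! j = flat \<Gamma> e ! k" by blast
qed

text \<open>The common source of the rules for atoms: since each coordinate term is a fixed position
  of the flat list, it suffices that \<open>Q\<close> is definable after every selection of
  positions.\<close>

lemma dfn_dcI:
  assumes "\<And>t. t \<in> set ts \<Longrightarrow> dfn_coord \<Gamma> t" "\<And>js k. set js \<subseteq>
      {..<k} \<Longrightarrow> length js = length ts \<Longrightarrow>
      dfn_list k (\<lambda>xs. Q (map (nth xs) js))"
  shows "dfn \<Gamma> (\<lambda>e. Q (map (\<lambda>t. t e) ts))"
proof (cases "\<exists>e. env \<Gamma> e")
  case False
  then show ?thesis by (subst dfn_cong[of _ _ "\<lambda>_. True"]) (auto intro: dfn_const)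
next
  case True
  show ?thesis unfolding dfn_def
  proof (intro impI)
    assume *: "\<forall>V\<in>set \<Gamma>. dset V"
    with True assms(1) have "\<forall>t\<in>set ts. \<exists>i<arsum \<Gamma>. \<forall>e. env \<Gamma> e
        \<longrightarrow> t e = flat \<Gamma> e ! i"
      unfolding dfn_coord_def by blast
    then obtain f where f: "\<And>t. t \<in> set ts \<Longrightarrow> f t < arsum \<Gamma> \<and>
        (\<forall>e. env \<Gamma> e \<longrightarrow> t e = flat \<Gamma> e ! f t)"
      by metis
    have "dfn_list (arsum \<Gamma>) (\<lambda>xs. Q (map (nth xs) (map f ts)))"
      by (rule assms(2)) (use f in auto)
    moreover have "Q (map (\<lambda>t. t e) ts) = Q (map (nth (flat \<Gamma> e)) (map f ts))"
        if "env \<Gamma> e" for e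
      using f that by (intro arg_cong[of _ _ Q]) auto
    ultimately show "\<exists>R. dfn_list (arsum \<Gamma>) R \<and>
        (\<forall>e. env \<Gamma> e \<longrightarrow> Q (map (\<lambda>t. t e) ts) = R (flat \<Gamma> e))"
      by blast
  qed
qed

lemma dfn_rel: "(\<And>t. t \<in> set ts \<Longrightarrow> dfn_coord \<Gamma> t) \<Longrightarrow>
    dfn \<Gamma> (\<lambda>e. map (\<lambda>t. t e) ts \<in> rel M r)"
  by (rule dfn_dcI[where Q = "\<lambda>xs. xs \<in> rel M r"]) (use dfn_list_rel in auto)

lemma dfn_rel2: "dfn_coord \<Gamma> t \<Longrightarrow> dfn_coord \<Gamma> s \<Longrightarrow>
    dfn \<Gamma> (\<lambda>e. [t e, s e] \<in> rel M r)"
  using dfn_rel[of "[t, s]" \<Gamma> r] by auto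

lemma dfn_rel3: "dfn_coord \<Gamma> t \<Longrightarrow> dfn_coord \<Gamma> s \<Longrightarrow>
    dfn_coord \<Gamma> u \<Longrightarrow> dfn \<Gamma> (\<lambda>e. [t e, s e, u e] \<in> rel M r)"
  using dfn_rel[of "[t, s, u]" \<Gamma> r] by auto

lemma dfn_eqc: "dfn_coord \<Gamma> t \<Longrightarrow> dfn_coord \<Gamma> s \<Longrightarrow>
    dfn \<Gamma> (\<lambda>e. t e = s e)"
proof -
  assume "dfn_coord \<Gamma> t" "dfn_coord \<Gamma> s"
  then have "dfn \<Gamma> (\<lambda>e. (\<lambda>xs. xs ! 0 = xs ! 1) (map (\<lambda>t. t e) [t, s]))"
    by (intro dfn_dcI) (auto simp: subset_iff intro!: dfn_list_eq)
  then show ?thesis by simp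
qed

lemma dfn_eqc_param: "dfn_coord \<Gamma> t \<Longrightarrow> a \<in> A \<Longrightarrow>
    dfn \<Gamma> (\<lambda>e. t e = a)"
proof -
  assume "dfn_coord \<Gamma> t" "a \<in> A"
  then have "dfn \<Gamma> (\<lambda>e. (\<lambda>xs. xs ! 0 = a) (map (\<lambda>t. t e) [t]))"
    by (intro dfn_dcI) (auto simp: subset_iff intro!: dfn_list_eq_param)
  then show ?thesis by simp
qed

lemma dfn_bex_dom:
  assumes "dfn (tuples M [s] # \<Gamma>) (\<lambda>e. P (e 0 ! 0) (\<lambda>i. e (Suc i)))"
  shows "dfn \<Gamma> (\<lambda>e. \<exists>y\<in>dom M s. P y e)"
proof -
  have "dfn \<Gamma> (\<lambda>e. \<exists>y\<in>tuples M [s]. P (y ! 0) e)"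
      by (rule dfn_bex) (use assms in auto)
  moreover have "(\<exists>y\<in>tuples M [s]. P (y ! 0) e) = (\<exists>y\<in>dom M s. P y e)" for e
    unfolding ex_tuples_Cons by (simp add: tuples_def)
  ultimately show ?thesis by simp
qed

lemma dfn_ball_dom:
  "dfn (tuples M [s] # \<Gamma>) (\<lambda>e. P (e 0 ! 0) (\<lambda>i. e (Suc i))) \<Longrightarrow>
      dfn \<Gamma> (\<lambda>e. \<forall>y\<in>dom M s. P y e)"
  using dfn_Not[OF dfn_bex_dom[of s \<Gamma> "\<lambda>y e. \<not> P y e"]]
    dfn_Not[of "tuples M [s] # \<Gamma>" "\<lambda>e. P (e 0 ! 0) (\<lambda>i. e (Suc i))"] by simp

lemma dset_Collect:
  assumes "dset Y" "dfn [Y] (\<lambda>e. P (e 0))"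
  shows "dset {y\<in>Y. P y}"
proof (cases "Y = {}")
  case False
  obtain ss where ss: "Y \<subseteq> tuples M ss" "dfn_list (length ss) (\<lambda>xs. xs \<in> Y)"
      using assms by (auto simp: dset_def)
  obtain y0 where "y0 \<in> Y" using False by auto
  then have l: "length ss = ar Y" using dset_tuples_ar ss by blast
  obtain Q where Q: "dfn_list (ar Y) Q" "\<And>e. env [Y] e \<Longrightarrow> P (e 0) = Q (flat [Y] e)"
    using assms unfolding dfn_def by (auto simp: arsum_def)
  have "P y = Q y" if "y \<in> Y" for y
    using Q(2)[of "\<lambda>_. y"] that by (simp add: env_Cons flat_Cons)
  then have "(\<lambda>xs. xs \<in> {y\<in>Y. P y}) = (\<lambda>xs. xs \<in> Y \<and> Q xs)" by auto
  then show ?thesis unfolding dset_def using ss l Q(1) dfn_list_conj by (intro exI[of _ ss]) auto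
qed auto

text \<open>The language is relational, so a term is given by its definable graph together with a
  definable set containing its values. Substitution then becomes an existential quantifier over that
  set, see \<open>dfn_subst\<close>.\<close>

definition dfn_term :: "'u list set list \<Rightarrow> 'u list set \<Rightarrow> ((nat \<Rightarrow> 'u list)
    \<Rightarrow> 'u list) \<Rightarrow> bool" where
  "dfn_term \<Gamma> Y t \<longleftrightarrow> dset Y \<and> (\<forall>e. env \<Gamma> e \<longrightarrow>
      t e \<in> Y) \<and> dfn (Y # \<Gamma>) (\<lambda>e. e 0 = t (\<lambda>i. e (Suc i)))"

lemma dfn_eq_vars:
  assumes "i < length \<Gamma>" "j < length \<Gamma>" "\<And>x y. x \<in> \<Gamma> ! i \<Longrightarrow>
      y \<in> \<Gamma> ! j \<Longrightarrow> length x = length y"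
  shows "dfn \<Gamma> (\<lambda>e. e i = e j)"
proof (cases "\<exists>e. env \<Gamma> e \<and> (\<forall>V\<in>set \<Gamma>. dset V)")
  case False
  then show ?thesis unfolding dfn_def using dfn_list_const by blast
next
  case True
  then obtain e0 where e0: "env \<Gamma> e0" "\<forall>V\<in>set \<Gamma>. dset V" by auto
  have l: "length (e k) = ar (\<Gamma> ! k)" if "env \<Gamma> e" "k < length \<Gamma>" for e k
    using env_dset_length e0 that by blast
  have ij: "ar (\<Gamma> ! i) = ar (\<Gamma> ! j)"
    using assms e0(1) l[OF e0(1)] unfolding env_def by metis
  have "dfn \<Gamma> (\<lambda>e. \<forall>k<ar (\<Gamma> ! i). e i ! k = e j ! k)"
    by (intro dfn_All_less dfn_eqc dfn_coord_var) (use assms e0(2) dset_length ij in \<open>metis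
        nth_mem\<close>)+
  then show ?thesis
    by (rule dfn_congI) (use l ij assms in \<open>auto intro: nth_equalityI\<close>)
qed

lemma dfn_term_var: "i < length \<Gamma> \<Longrightarrow> \<Gamma> ! i \<subseteq> Y \<Longrightarrow>
    dset Y \<Longrightarrow> dfn_term \<Gamma> Y (\<lambda>e. e i)"
  unfolding dfn_term_def
proof (intro conjI)
  assume *: "i < length \<Gamma>" "\<Gamma> ! i \<subseteq> Y" "dset Y"
  show "dfn (Y # \<Gamma>) (\<lambda>e. e 0 = e (Suc i))"
    by (rule dfn_eq_vars[where i = 0 and j = "Suc i" and \<Gamma> = "Y # \<Gamma>"]) (use * dset_length in
        \<open>auto simp: subset_iff\<close>)
qed (auto simp: env_def)

lemma dfn_term_const:
  assumes "c \<in> Y" "set c \<subseteq> A" "dset Y"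
  shows "dfn_term \<Gamma> Y (\<lambda>e. c)"
  unfolding dfn_term_def
proof (intro conjI)
  have "dfn (Y # \<Gamma>) (\<lambda>e. \<forall>k<length c. e 0 ! k = c ! k)"
    by (intro dfn_All_less dfn_eqc_param dfn_coord_var) (use assms dset_length in auto)
  then show "dfn (Y # \<Gamma>) (\<lambda>e. e 0 = c)"
    by (rule dfn_congI) (use assms dset_length in \<open>auto simp: env_Cons intro: nth_equalityI\<close>)
qed (use assms in auto)

lemma dfn_term_dset: "dfn_term \<Gamma> Y t \<Longrightarrow> dset Y" by (simp add: dfn_term_def)
lemma dfn_term_in: "dfn_term \<Gamma> Y t \<Longrightarrow> env \<Gamma> e \<Longrightarrow> t e \<in> Y"
    by (simp add: dfn_term_def)

lemma dfn_subst:
  assumes P: "dfn (Y # \<Gamma>) (\<lambda>e. P (e 0) (\<lambda>i. e (Suc i)))" and t: "dfn_term \<Gamma> Y t"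
  shows "dfn \<Gamma> (\<lambda>e. P (t e) e)"
proof -
  have "dfn \<Gamma> (\<lambda>e. \<exists>y\<in>Y. y = t e \<and> P y e)"
    using t P unfolding dfn_term_def by (intro dfn_bex dfn_conj) auto
  then show ?thesis by (rule dfn_congI) (use t in \<open>auto simp: dfn_term_def\<close>)
qed

lemma dfn_comp:
  assumes P: "dfn \<Delta> P" and len: "length ts = length \<Delta>"
    and t: "\<And>i. i < length \<Delta> \<Longrightarrow> dfn_term \<Gamma> (\<Delta> ! i) (ts ! i)"
    and \<Gamma>: "\<forall>V\<in>set \<Gamma>. dset V"
  shows "dfn \<Gamma> (\<lambda>e. P (\<lambda>i. (ts ! i) e))"
proof -
  have \<Delta>: "\<forall>V\<in>set \<Delta>. dset V" using t unfolding dfn_term_def by (metis in_set_conv_nth)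
  define n where "n = length \<Delta>"
  \<comment> \<open>The terms are substituted one at a time. After \<open>k\<close> of them the
    context still starts with the remaining \<open>n - k\<close> variables, so the terms read their
    own variables at positions shifted by \<open>n - k\<close>.\<close>
  have main: "dfn (drop k \<Delta> @ \<Gamma>)
      (\<lambda>e. P (\<lambda>i. if i < k then (ts ! i) (\<lambda>j. e (j + (n - k))) else e (i - k)))" if
          "k \<le> n" for k
    using that
  proof (induction k)
    case 0
    have "dfn (\<Delta> @ \<Gamma>) (\<lambda>e. P (\<lambda>i. e i))"
        by (rule dfn_rename_fm[OF P \<Delta>]) (auto simp: nth_append)
    then show ?case by simp
  next
    case (Suc k)
    then have k: "k < length \<Delta>" by (simp add: n_def)
    have "drop k \<Delta> = \<Delta> ! k # drop (Suc k) \<Delta>" using k by (simp add: Cons_nth_drop_Suc)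
    with Suc have 1: "dfn (\<Delta> ! k # (drop (Suc k) \<Delta> @ \<Gamma>))
      (\<lambda>e. P (\<lambda>i. if i < k then (ts ! i) (\<lambda>j. e (j + (n - k))) else e (i - k)))" by simp
    have tk: "dfn_term \<Gamma> (\<Delta> ! k) (ts ! k)" using t k by simp
    let ?\<rho> = "case_nat 0 (\<lambda>i. Suc (i + (n - Suc k)))"
    have "dfn (\<Delta> ! k # \<Gamma>) (\<lambda>e. e 0 = (ts ! k) (\<lambda>i. e (Suc i)))" using tk
        by (simp add: dfn_term_def)
    moreover have "\<forall>V\<in>set (\<Delta> ! k # \<Gamma>). dset V" using \<Delta> \<Gamma> k by simp
    moreover have "?\<rho> i < length (\<Delta> ! k # (drop (Suc k) \<Delta> @ \<Gamma>)) \<and>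
      (\<Delta> ! k # (drop (Suc k) \<Delta> @ \<Gamma>)) ! ?\<rho> i \<subseteq> (\<Delta> ! k # \<Gamma>) !
          i" if "i < length (\<Delta> ! k # \<Gamma>)" for i
      using that k by (cases i) (auto simp: n_def nth_append)
    ultimately have "dfn (\<Delta> ! k # (drop (Suc k) \<Delta> @ \<Gamma>)) (\<lambda>e. e (?\<rho> 0) = (ts
        ! k) (\<lambda>i. e (?\<rho> (Suc i))))"
      by (rule dfn_rename_fm)
    then have 2: "dfn (\<Delta> ! k # (drop (Suc k) \<Delta> @ \<Gamma>)) (\<lambda>e. e 0 = (ts ! k)
        (\<lambda>i. e (Suc (i + (n - Suc k)))))"
      by simp
    have 3: "dfn_term (drop (Suc k) \<Delta> @ \<Gamma>) (\<Delta> ! k) (\<lambda>e. (ts ! k) (\<lambda>i. e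
        (i + (n - Suc k))))"
      unfolding dfn_term_def
    proof (intro conjI allI impI)
      show "dset (\<Delta> ! k)" using \<Delta> k by auto
      show "(ts ! k) (\<lambda>i. e (i + (n - Suc k))) \<in> \<Delta> ! k"
          if "env (drop (Suc k) \<Delta> @ \<Gamma>) e" for e
      proof (rule dfn_term_in[OF tk])
        show "env \<Gamma> (\<lambda>i. e (i + (n - Suc k)))"
          unfolding env_def
        proof (intro allI impI)
          fix i assume "i < length \<Gamma>"
          with that[unfolded env_def, rule_format, of "i + (n - Suc k)"]
          show "e (i + (n - Suc k)) \<in> \<Gamma> ! i" by (simp add: nth_append n_def)
        qed
      qed
    qed (use 2 in simp)
    have 4: "dfn (drop (Suc k) \<Delta> @ \<Gamma>) (\<lambda>e. (\<lambda>y e. P (\<lambda>i. if i < k then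
        (ts ! i) (\<lambda>j. e (j + (n - Suc k)))
        else if i = k then y else e (i - Suc k))) ((ts ! k) (\<lambda>i. e (i + (n - Suc k)))) e)"
    proof (rule dfn_subst[OF _ 3])
      have "j + (n - k) = Suc (j + (n - Suc k))" for j using k by (simp add: n_def)
      moreover have "(if i = k then e 0 else e (Suc (i - Suc k))) = e (i - k)" if "\<not> i < k"
          for i and e :: "nat \<Rightarrow> 'u list"
        using that by (auto simp: Suc_diff_Suc)
      ultimately show "dfn (\<Delta> ! k # drop (Suc k) \<Delta> @ \<Gamma>)
        (\<lambda>e. P (\<lambda>i. if i < k then (ts ! i) (\<lambda>j. e (Suc (j + (n - Suc k))))
                   else if i = k then e 0 else e (Suc (i - Suc k))))"
        using 1 by (simp cong: if_cong)
    qed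
    have "(if i < Suc k then (ts ! i) (\<lambda>j. e (j + (n - Suc k))) else e (i - Suc k)) =
        (if i < k then (ts ! i) (\<lambda>j. e (j + (n - Suc k)))
        else if i = k then (ts ! k) (\<lambda>i. e (i + (n - Suc k))) else e (i - Suc k))" for i and e ::
            "nat \<Rightarrow> 'u list"
      by (auto simp: less_Suc_eq)
    then show ?case using 4 by simp
  qed
  from main[of n]
  have "dfn \<Gamma> (\<lambda>e. P (\<lambda>i. if i < n then (ts ! i) e else e (i - n)))"
    unfolding n_def by (simp cong: if_cong)
  then obtain Q where "dfn \<Gamma> Q" and Q: "Q = (\<lambda>e. P (\<lambda>i. if i < n then (ts ! i) e else
      e (i - n)))" by blast
  \<comment> \<open>As a HOL function \<open>P\<close> could look at values beyond its context,
    where the two environments differ. Definability excludes this, because \<open>P\<close> is then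
    decided by the flattened list alone.\<close>
  have coh: "P e = P e'" if "env \<Delta> e" "\<And>i. i < length \<Delta> \<Longrightarrow> e i = e' i"
      for e e'
  proof -
    have "env \<Delta> e'" using that by (simp add: env_def)
    moreover have "flat \<Delta> e = flat \<Delta> e'" unfolding flat_def using that(2)
        by (intro arg_cong[of _ _ concat] map_cong) auto
    ultimately show ?thesis using P \<Delta> that(1) unfolding dfn_def by metis
  qed
  show ?thesis
  proof (rule dfn_congI[OF \<open>dfn \<Gamma> Q\<close>], unfold Q, rule coh)
    fix e assume "env \<Gamma> e"
    then show "env \<Delta> (\<lambda>i. (ts ! i) e)" using t dfn_term_in unfolding env_def by (metis env_def)
  qed (simp add: n_def)
qed

end

section \<open>Definable finite power sets in general\<close>

context definability
begin

section \<open>Substitution of definable terms and concatenation of tuples\<close>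

lemma dfn_dsetI: "(\<forall>V\<in>set \<Gamma>. dset V \<Longrightarrow> dfn \<Gamma> P) \<Longrightarrow>
    dfn \<Gamma> P"
  unfolding dfn_def by blast

lemma dfn_comp1:
  assumes "dfn [Y] (\<lambda>e. P (e 0))" "dfn_term \<Gamma> Y t"
  shows "dfn \<Gamma> (\<lambda>e. P (t e))"
proof (rule dfn_dsetI)
  assume "\<forall>V\<in>set \<Gamma>. dset V"
  from dfn_comp[OF assms(1) _ _ this, of "[t]"] assms(2)
  show "dfn \<Gamma> (\<lambda>e. P (t e))" by simp
qed

lemma dfn_comp2:
  assumes "dfn [Ya, Yb] (\<lambda>e. P (e 0) (e (Suc 0)))" "dfn_term \<Gamma> Ya t1" "dfn_term \<Gamma> Yb t2"
  shows "dfn \<Gamma> (\<lambda>e. P (t1 e) (t2 e))"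
proof (rule dfn_dsetI)
  assume "\<forall>V\<in>set \<Gamma>. dset V"
  from dfn_comp[OF assms(1) _ _ this, of "[t1, t2]"] assms(2-)
  show "dfn \<Gamma> (\<lambda>e. P (t1 e) (t2 e))" by (simp add: All_less_Suc nth_Cons split: nat.splits)
qed

lemma dfn_comp3:
  assumes "dfn [Ya, Yb, Yc] (\<lambda>e. P (e 0) (e (Suc 0)) (e (Suc (Suc 0))))"
    "dfn_term \<Gamma> Ya t1" "dfn_term \<Gamma> Yb t2" "dfn_term \<Gamma> Yc t3"
  shows "dfn \<Gamma> (\<lambda>e. P (t1 e) (t2 e) (t3 e))"
proof (rule dfn_dsetI)
  assume "\<forall>V\<in>set \<Gamma>. dset V"
  from dfn_comp[OF assms(1) _ _ this, of "[t1, t2, t3]"] assms(2-)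
  show "dfn \<Gamma> (\<lambda>e. P (t1 e) (t2 e) (t3 e))" by (simp add: All_less_Suc nth_Cons split:
      nat.splits)
qed

lemma dfn_comp4:
  assumes "dfn [Ya, Yb, Yc, Yd] (\<lambda>e. P (e 0) (e (Suc 0)) (e (Suc (Suc 0))) (e (Suc (Suc (Suc 0)))))"
    "dfn_term \<Gamma> Ya t1" "dfn_term \<Gamma> Yb t2" "dfn_term \<Gamma> Yc t3" "dfn_term \<Gamma> Yd t4"
  shows "dfn \<Gamma> (\<lambda>e. P (t1 e) (t2 e) (t3 e) (t4 e))"
proof (rule dfn_dsetI)
  assume "\<forall>V\<in>set \<Gamma>. dset V"
  from dfn_comp[OF assms(1) _ _ this, of "[t1, t2, t3, t4]"] assms(2-)
  show "dfn \<Gamma> (\<lambda>e. P (t1 e) (t2 e) (t3 e) (t4 e))" by (simp add: All_less_Suc nth_Cons split: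
      nat.splits)
qed

lemma dfn_term_weaken:
  assumes "dfn_term \<Gamma> Y t"
  shows "dfn_term (Z # \<Gamma>) Y (\<lambda>e. t (\<lambda>i. e (Suc i)))"
proof (cases "\<forall>V\<in>set \<Gamma>. dset V")
  case True
  have 1: "dfn (Y # \<Gamma>) (\<lambda>e. e 0 = t (\<lambda>i. e (Suc i)))" "dset Y" using assms
      by (auto simp: dfn_term_def)
  have "dfn (Y # Z # \<Gamma>) (\<lambda>e. (\<lambda>e. e 0 = t (\<lambda>i. e (Suc i))) (\<lambda>i. e
      (case_nat 0 (\<lambda>i. Suc (Suc i)) i)))"
    by (rule dfn_rename_fm[OF 1(1)]) (use 1 True in \<open>auto split: nat.splits simp:
        less_Suc_eq_0_disj\<close>)
  then show ?thesis using assms by (simp add: dfn_term_def env_Cons)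
next
  case False
  then have "dfn (Y # Z # \<Gamma>) (\<lambda>e. e 0 = t (\<lambda>i. e (Suc (Suc i))))" by (auto simp: dfn_def)
  then show ?thesis using assms by (simp add: dfn_term_def env_Cons)
qed

lemma dfn_term_comp1:
  assumes f: "dfn_term [Y] Z (\<lambda>e. f (e 0))" and t: "dfn_term \<Gamma> Y t"
  shows "dfn_term \<Gamma> Z (\<lambda>e. f (t e))"
proof -
  have Z: "dset Z" using f by (simp add: dfn_term_def)
  have "dfn (Z # \<Gamma>) (\<lambda>e. e 0 = f (t (\<lambda>i. e (Suc i))))"
    by (rule dfn_comp2[where P = "\<lambda>z y. z = f y"])
      (use f dfn_term_weaken[OF t] Z in \<open>auto simp: dfn_term_def[of "[Y]"] intro!: dfn_term_var\<close>)
  moreover have "f y \<in> Z" if "y \<in> Y" for y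
    using f that unfolding dfn_term_def by (auto simp: env_Cons dest!: spec[of _ "\<lambda>_. y"])
  ultimately show ?thesis using Z t by (auto simp: dfn_term_def)
qed

lemma dfn_term_comp2:
  assumes f: "dfn_term [Ya, Yb] Z (\<lambda>e. f (e 0) (e (Suc 0)))" and t: "dfn_term \<Gamma> Ya t1"
      "dfn_term \<Gamma> Yb t2"
  shows "dfn_term \<Gamma> Z (\<lambda>e. f (t1 e) (t2 e))"
proof -
  have Z: "dset Z" using f by (simp add: dfn_term_def)
  have "dfn (Z # \<Gamma>) (\<lambda>e. e 0 = f (t1 (\<lambda>i. e (Suc i))) (t2 (\<lambda>i. e (Suc i))))"
    by (rule dfn_comp3[where P = "\<lambda>z y1 y2. z = f y1 y2"])
      (use f dfn_term_weaken[OF t(1)] dfn_term_weaken[OF t(2)] Z in \<open>auto simp: dfn_term_def[of "[Ya,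
          Yb]"] intro!: dfn_term_var\<close>)
  moreover have "f y1 y2 \<in> Z" if "y1 \<in> Ya" "y2 \<in> Yb" for y1 y2
    using f that unfolding dfn_term_def by (auto simp: env_Cons dest!: spec[of _ "case_nat y1 (\<lambda>_.
        y2)"])
  ultimately show ?thesis using Z t by (auto simp: dfn_term_def)
qed

lemma dfn_term_comp3:
  assumes f: "dfn_term [Ya, Yb, Yc] Z (\<lambda>e. f (e 0) (e (Suc 0)) (e (Suc (Suc 0))))"
    and t: "dfn_term \<Gamma> Ya t1" "dfn_term \<Gamma> Yb t2" "dfn_term \<Gamma> Yc t3"
  shows "dfn_term \<Gamma> Z (\<lambda>e. f (t1 e) (t2 e) (t3 e))"
proof -
  have Z: "dset Z" using f by (simp add: dfn_term_def)
  have "dfn (Z # \<Gamma>) (\<lambda>e. e 0 = f (t1 (\<lambda>i. e (Suc i))) (t2 (\<lambda>i. e (Suc i))) (t3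
      (\<lambda>i. e (Suc i))))"
    by (rule dfn_comp4[where P = "\<lambda>z y1 y2 y3. z = f y1 y2 y3"])
      (use f dfn_term_weaken[OF t(1)] dfn_term_weaken[OF t(2)] dfn_term_weaken[OF t(3)] Z in
        \<open>auto simp: dfn_term_def[of "[Ya, Yb, Yc]"] intro!: dfn_term_var\<close>)
  moreover have "f y1 y2 y3 \<in> Z" if "y1 \<in> Ya" "y2 \<in> Yb" "y3 \<in> Yc" for y1 y2 y3
    using f that unfolding dfn_term_def
    by (auto simp: env_Cons dest!: spec[of _ "case_nat y1 (case_nat y2 (\<lambda>_. y3))"])
  ultimately show ?thesis using Z t by (auto simp: dfn_term_def)
qed

lemma dfn_eq:
  assumes t: "dfn_term \<Gamma> Y t" "dfn_term \<Gamma> Z s"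
  shows "dfn \<Gamma> (\<lambda>e. t e = s e)"
proof (rule dfn_comp2[OF _ t])
  have Y: "dset Y" "dset Z" using t by (auto simp: dfn_term_def)
  show "dfn [Y, Z] (\<lambda>e. e 0 = e (Suc 0))"
  proof (cases "ar Y = ar Z")
    case True
    then show ?thesis using dset_length[OF Y(1)] dset_length[OF Y(2)] by (intro dfn_eq_vars) auto
  next
    case False
    show ?thesis
    proof (rule dfn_congI[OF dfn_const[of _ False]])
      fix e assume "env [Y, Z] e"
      then have "length (e 0) = ar Y" "length (e (Suc 0)) = ar Z"
        using dset_length[OF Y(1)] dset_length[OF Y(2)] by (auto simp: env_Cons)
      with False show "(e 0 = e (Suc 0)) = False" by auto
    qed
  qed
qed

lemma dfn_mem:
  assumes Y: "dset Y" and t: "dfn_term \<Gamma> Z t"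
  shows "dfn \<Gamma> (\<lambda>e. t e \<in> Y)"
proof (rule dfn_comp1[OF _ t])
  have "dfn [Z] (\<lambda>e. \<exists>y\<in>Y. y = e 0)"
    by (intro dfn_bex Y dfn_eq[where Y = Y and Z = Z] dfn_term_var) (use Y t in \<open>auto simp:
        dfn_term_def\<close>)
  then show "dfn [Z] (\<lambda>e. e 0 \<in> Y)" by simp
qed

lemma dset_times:
  assumes V: "dset V" and W: "dset W"
  shows "dset (times_set V W)"
proof (cases "V = {} \<or> W = {}")
  case False
  obtain ss where ss: "V \<subseteq> tuples M ss" using V by (auto simp: dset_def)
  obtain ss' where ss': "W \<subseteq> tuples M ss'" using W by (auto simp: dset_def)
  have l: "length ss = ar V" "length ss' = ar W" using dset_tuples_ar ss ss' False by blast+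
  have "times_set V W \<subseteq> tuples M (ss @ ss')"
    using ss ss' by (auto simp: times_set_def tuples_def intro: list_all2_appendI)
  moreover have "dfn_list (length (ss @ ss')) (\<lambda>xs. xs \<in> times_set V W)"
  proof -
    let ?Q = "\<lambda>xs. map (nth xs) [0..<ar V] \<in> V \<and> map (nth xs) [ar V..<ar V + ar W] \<in> W"
    have *: "(map (nth xs) [0..<ar V] \<in> V \<and> map (nth xs) [ar V..<ar V + ar W] \<in> W)
        \<longleftrightarrow> xs \<in> times_set V W"
      if xs: "length xs = length (ss @ ss')" for xs
    proof
      assume a: "map (nth xs) [0..<ar V] \<in> V \<and> map (nth xs) [ar V..<ar V + ar W] \<in> W"
      have "xs = map (nth xs) [0..<ar V] @ map (nth xs) [ar V..<ar V + ar W]"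
        using xs l by (auto intro!: nth_equalityI simp: nth_append)
      with a show "xs \<in> times_set V W" unfolding times_set_def by blast
    next
      assume "xs \<in> times_set V W"
      then obtain x y where xy: "xs = x @ y" "x \<in> V" "y \<in> W" by (auto simp: times_set_def)
      then have "length x = ar V" "length y = ar W" using dset_length[OF V] dset_length[OF W] by auto
      then have "map (nth xs) [0..<ar V] = x" "map (nth xs) [ar V..<ar V + ar W] = y"
        using xy by (auto intro!: nth_equalityI simp: nth_append)
      then show "map (nth xs) [0..<ar V] \<in> V \<and> map (nth xs) [ar V..<ar V + ar W] \<in> W"
        using xy by simp
    qed
    have "dfn_list (length (ss @ ss')) (\<lambda>xs. map (nth xs) [0..<ar V] \<in> V \<and>
        map (nth xs) [ar V..<ar V + ar W] \<in> W)"
      by (intro dfn_list_conj dfn_list_map[OF dset_dfn_list[OF V]] dfn_list_map[OF dset_dfn_list[OF W]]) (use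
          l in auto)
    then show ?thesis using dfn_list_cong[of "length (ss @ ss')" ?Q "\<lambda>xs. xs \<in> times_set V W"] *
        by simp
  qed
  ultimately show ?thesis unfolding dset_def by blast
qed (auto simp: times_set_def)

lemma append_mem_times [simp]:
  "x \<in> V \<Longrightarrow> y \<in> W \<Longrightarrow> x @ y \<in> times_set V W"
  by (auto simp: times_set_def)

lemma dfn_term_append:
  assumes t: "dfn_term \<Gamma> V t" "dfn_term \<Gamma> W s"
  shows "dfn_term \<Gamma> (times_set V W) (\<lambda>e. t e @ s e)"
proof (rule dfn_term_comp2[OF _ t])
  have V: "dset V" "dset W" using t by (auto simp: dfn_term_def)
  let ?T = "times_set V W"
  have T: "dset ?T" using V by (rule dset_times)
  have l: "length x = ar V + ar W" if "x \<in> ?T" for x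
    using that dset_length[OF V(1)] dset_length[OF V(2)] by (auto simp: times_set_def)
  have "dfn [?T, V, W] (\<lambda>e. (\<forall>k<ar V. e 0 ! k = e (Suc 0) ! k) \<and>
      (\<forall>k<ar W. e 0 ! (ar V + k) = e (Suc (Suc 0)) ! k))"
    by (intro dfn_conj dfn_All_less dfn_eqc dfn_coord_var) (use l dset_length[OF V(1)] dset_length[OF V(2)]
        in auto)
  then have "dfn [?T, V, W] (\<lambda>e. e 0 = e (Suc 0) @ e (Suc (Suc 0)))"
  proof (rule dfn_congI)
    fix e assume "env [?T, V, W] e"
    then have e: "e 0 \<in> ?T" "e (Suc 0) \<in> V" "e (Suc (Suc 0)) \<in> W" by (auto simp: env_Cons)
    then have le: "length (e 0) = ar V + ar W" "length (e (Suc 0)) = ar V" "length (e (Suc (Suc 0))) = ar W"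
      using l dset_length[OF V(1)] dset_length[OF V(2)] by auto
    show "(e 0 = e (Suc 0) @ e (Suc (Suc 0))) = ((\<forall>k<ar V. e 0 ! k = e (Suc 0) ! k) \<and>
       (\<forall>k<ar W. e 0 ! (ar V + k) = e (Suc (Suc 0)) ! k))" (is "?l = ?r")
    proof
      assume ?r
      then have "e 0 ! k = e (Suc 0) ! k" if "k < ar V" for k using that by blast
      moreover have "e 0 ! k = e (Suc (Suc 0)) ! (k - ar V)" if "ar V \<le> k" "k < ar V + ar W" for k
        using \<open>?r\<close> that by (metis add_diff_inverse_nat leD nat_add_left_cancel_less)
      ultimately show ?l by (intro nth_equalityI) (auto simp: le nth_append)
    qed (auto simp: nth_append le)
  qed
  then show "dfn_term [V, W] ?T (\<lambda>e. e 0 @ e (Suc 0))"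
    using T by (auto simp: dfn_term_def env_Cons)
qed

lemma append_inj_dset:
  "dset V \<Longrightarrow> x \<in> V \<Longrightarrow> x' \<in> V \<Longrightarrow>
      x @ y = x' @ y' \<longleftrightarrow> x = x' \<and> y = y'"
  using dset_length[of V x] dset_length[of V x'] by auto

text \<open>All elements of \<open>Y\<close> have the same length, so concatenation is injective on
  \<open>Y \<times> Z\<close>; a relation stored as a set of concatenated tuples is therefore the
  same thing as a predicate of two variables.\<close>

lemma dset_rel:
  assumes "dset Y" "dset Z" "E \<subseteq> Y \<times> Z"
  shows "dset {x @ y | x y. (x, y) \<in> E} \<longleftrightarrow> dfn [Y, Z] (\<lambda>e. (e 0, e (Suc 0))
      \<in> E)"
proof
  assume "dset {x @ y | x y. (x, y) \<in> E}"
  then have "dfn [Y, Z] (\<lambda>e. e 0 @ e (Suc 0) \<in> {x @ y | x y. (x, y) \<in> E})"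
    by (intro dfn_mem[where Z = "times_set Y Z"] dfn_term_append dfn_term_var) (use assms in auto)
  then show "dfn [Y, Z] (\<lambda>e. (e 0, e (Suc 0)) \<in> E)"
  proof (rule dfn_congI)
    fix e assume "env [Y, Z] e"
    then have "e 0 \<in> Y" by (simp add: env_Cons)
    then show "((e 0, e (Suc 0)) \<in> E) = (e 0 @ e (Suc 0) \<in> {x @ y | x y. (x, y) \<in> E})"
      using append_inj_dset[OF assms(1)] assms(3) by auto
  qed
next
  assume *: "dfn [Y, Z] (\<lambda>e. (e 0, e (Suc 0)) \<in> E)"
  have "dset {p \<in> times_set Y Z. \<exists>x\<in>Y. \<exists>y\<in>Z. p = x @ y \<and> (x, y) \<in> E}"
    by (intro dset_Collect dset_times assms dfn_bex dfn_conj
        dfn_eq[where Y = "times_set Y Z" and Z = "times_set Y Z"] dfn_term_append dfn_term_var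
        dfn_comp2[OF *]) (use assms dset_times in auto)
  also have "{p \<in> times_set Y Z. \<exists>x\<in>Y. \<exists>y\<in>Z. p = x @ y \<and>
      (x, y) \<in> E} = {x @ y | x y. (x, y) \<in> E}"
    using assms(3) by (auto simp: times_set_def)
  finally show "dset {x @ y | x y. (x, y) \<in> E}" .
qed

end

locale full_definability = fixes M :: "('s, 'r, 'u) struct"

sublocale full_definability \<subseteq> definability M "\<Union>s. dom M s" .

context full_definability
begin

lemma dset_subset: "dset V \<Longrightarrow> x \<in> V \<Longrightarrow> set x \<subseteq> (\<Union>s. dom M s)"
  by (auto simp: dset_def tuples_def subset_iff list_all2_conv_all_nth in_set_conv_nth)

lemma definable_iff: "definable M V \<longleftrightarrow> dset V"
proof
  assume "definable M V"
  then obtain ss \<phi> ps where V: "set ps \<subseteq> (\<Union>s. dom M s)" "V = {xs \<in> tuples M ss. sat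
      M \<phi> (xs @ ps)}"
    unfolding definable_def by blast
  have "dfn_list (length ss) (\<lambda>xs. sat M \<phi> (xs @ ps))" unfolding dfn_list_def using V(1) by blast
  moreover have "dfn_list (length ss) (\<lambda>xs. take (length ss) xs \<in> tuples M ss)"
      by (rule dfn_list_tuples) simp
  ultimately have "dfn_list (length ss) (\<lambda>xs. take (length ss) xs \<in> tuples M ss \<and>
      sat M \<phi> (xs @ ps))"
    by (intro dfn_list_conj)
  moreover have "(take (length ss) xs \<in> tuples M ss \<and> sat M \<phi> (xs @ ps)) \<longleftrightarrow>
      xs \<in> V"
    if "length xs = length ss" for xs using that V by auto
  ultimately have "dfn_list (length ss) (\<lambda>xs. xs \<in> V)" 
    using dfn_list_cong[of "length ss" "\<lambda>xs. take (length ss) xs \<in> tuples M ss \<and>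
        sat M \<phi> (xs @ ps)" "\<lambda>xs. xs \<in> V"] by simp
  then show "dset V" unfolding dset_def using V by blast
next
  assume "dset V"
  then obtain ss where ss: "V \<subseteq> tuples M ss" "dfn_list (length ss) (\<lambda>xs. xs \<in> V)"
      by (auto simp: dset_def)
  then obtain \<phi> ps where *: "set ps \<subseteq> (\<Union>s. dom M s)"
    "\<And>xs. length xs = length ss \<Longrightarrow> (xs \<in> V) = sat M \<phi> (xs @ ps)"
        unfolding dfn_list_def by blast
  then have "V = {xs \<in> tuples M ss. sat M \<phi> (xs @ ps)}" using ss(1) by (auto dest: tuples_length)
  with *(1) show "definable M V" unfolding definable_def by blast
qed

lemma dfn_term_const': "c \<in> Y \<Longrightarrow> dset Y \<Longrightarrow>
    dfn_term \<Gamma> Y (\<lambda>e. c)"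
  by (intro dfn_term_const dset_subset)

lemma definable_funI:
  assumes "dfn_term [V] W (\<lambda>e. f (e 0))" "dset V"
  shows "definable_fun M V W f"
proof -
  have W: "dset W" using assms by (simp add: dfn_term_def)
  have f: "f x \<in> W" if "x \<in> V" for x using dfn_term_in[OF assms(1), of "\<lambda>_. x"] that
      by (simp add: env_Cons)
  have "dfn [V, W] (\<lambda>e. (e 0, e (Suc 0)) \<in> {(x, f x) | x. x \<in> V})"
  proof (rule dfn_congI[where P' = "\<lambda>e. e (Suc 0) = f (e 0)"])
    show "dfn [V, W] (\<lambda>e. e (Suc 0) = f (e 0))"
      by (rule dfn_comp2[where Ya = W and Yb = V and P = "\<lambda>y x. y = f x"])
        (use assms W in \<open>auto simp: dfn_term_def[of "[V]"] intro!: dfn_term_var\<close>)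
  qed (auto simp: env_Cons)
  then have "dset {x @ y | x y. (x, y) \<in> {(x, f x) | x. x \<in> V}}"
    by (subst dset_rel[of V W]) (use assms W f in auto)
  then show ?thesis using assms W f unfolding definable_fun_def definable_rel_def definable_iff by auto
qed

lemma definable_funD:
  assumes "definable_fun M V W f"
  shows "dfn_term [V] W (\<lambda>e. f (e 0))"
proof -
  have V: "dset V" "dset W" "f ` V \<subseteq> W" "dset {x @ y | x y. (x, y) \<in> {(x, f x) | x. x \<in> V}}"
    using assms unfolding definable_fun_def definable_rel_def definable_iff by auto
  have "{(x, f x) | x. x \<in> V} \<subseteq> V \<times> W" using V(3) by auto
  from dset_rel[OF V(1,2) this] V(4)
  have *: "dfn [V, W] (\<lambda>e. (e 0, e (Suc 0)) \<in> {(x, f x) | x. x \<in> V})" by blast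
  have "dfn [W, V] (\<lambda>e. (e (Suc 0), e 0) \<in> {(x, f x) | x. x \<in> V})"
    by (rule dfn_comp2[where P = "\<lambda>x y. (x, y) \<in> {(x, f x) | x. x \<in> V}", OF *])
      (use V in \<open>auto intro!: dfn_term_var\<close>)
  then have "dfn [W, V] (\<lambda>e. e 0 = f (e (Suc 0)))"
    by (rule dfn_congI) (auto simp: env_Cons)
  then show ?thesis using V by (auto simp: dfn_term_def env_Cons)
qed

section \<open>Consequences of the axioms of a definable finite power set\<close>

lemma fp_dset: "is_fpow M V W E \<Longrightarrow> dset V \<and> dset W"
  by (auto simp: is_fpow_def definable_iff)

lemma fp_ext: "is_fpow M V W E \<Longrightarrow> ext E b \<subseteq> V"
  by (auto simp: is_fpow_def ext_def)

lemma fp_inj: "is_fpow M V W E \<Longrightarrow> b \<in> W \<Longrightarrow> c \<in> W \<Longrightarrow>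
    b = c \<longleftrightarrow> ext E b = ext E c"
proof -
  assume fp: "is_fpow M V W E" and bc: "b \<in> W" "c \<in> W"
  from fp have "\<forall>B\<in>W. \<forall>C\<in>W. B = C \<longleftrightarrow>
      (\<forall>x\<in>V. (x, B) \<in> E \<longleftrightarrow> (x, C) \<in> E)"
    unfolding is_fpow_def by (elim conjE)
  then have "b = c \<longleftrightarrow> (\<forall>x\<in>V. (x, b) \<in> E \<longleftrightarrow>
      (x, c) \<in> E)" using bc by simp
  then show ?thesis using fp_ext[OF fp, of b] fp_ext[OF fp, of c] unfolding ext_def by auto
qed

lemma fp_dfn:
  assumes fp: "is_fpow M V W E" and t: "dfn_term \<Gamma> V t" "dfn_term \<Gamma> W b"
  shows "dfn \<Gamma> (\<lambda>e. t e \<in> ext E (b e))"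
proof (rule dfn_comp2[OF _ t])
  have "dset V" "dset W" "E \<subseteq> V \<times> W" "dset {x @ y | x y. (x, y) \<in> E}"
    using fp by (auto simp: is_fpow_def definable_rel_def definable_iff)
  then show "dfn [V, W] (\<lambda>e. e 0 \<in> ext E (e (Suc 0)))"
    unfolding ext_def by (simp add: dset_rel)
qed

lemma fp_empty: "is_fpow M V W E \<Longrightarrow> \<exists>b\<in>W. ext E b = {}"
proof -
  assume fp: "is_fpow M V W E"
  then have "\<exists>B\<in>W. \<forall>x\<in>V. (x, B) \<notin> E" unfolding is_fpow_def by (elim conjE)
  then show ?thesis using fp_ext[OF fp] unfolding ext_def by blast
qed

lemma fp_single:
  assumes "is_fpow M V W E" "a \<in> V"
  shows "\<exists>b\<in>W. ext E b = {a}"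
proof -
  from assms(1) have "\<forall>a\<in>V. \<exists>B\<in>W. \<forall>x\<in>V. ((x, B) \<in> E) = (x = a)"
    unfolding is_fpow_def by (elim conjE)
  with assms(2) have "\<exists>B\<in>W. \<forall>x\<in>V. ((x, B) \<in> E) = (x = a)" by blast
  then show ?thesis using fp_ext[OF assms(1)] assms(2) unfolding ext_def by blast
qed

lemma fp_Un:
  assumes "is_fpow M V W E" "b \<in> W" "c \<in> W"
  shows "\<exists>d\<in>W. ext E d = ext E b \<union> ext E c"
proof -
  from assms(1) have "\<forall>B\<in>W. \<forall>C\<in>W. \<exists>D\<in>W. \<forall>x\<in>V. ((x, D) \<in>
      E) = ((x, B) \<in> E \<or> (x, C) \<in> E)"
    unfolding is_fpow_def by (elim conjE)
  with assms(2,3) have "\<exists>D\<in>W. \<forall>x\<in>V. ((x, D) \<in> E) = ((x, b) \<in> E \<or>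
      (x, c) \<in> E)" by simp
  then show ?thesis using fp_ext[OF assms(1)] unfolding ext_def by blast
qed

text \<open>Axiom (v) as an induction rule. It applies to definable \<open>P\<close> only, and this
  is the source of the definability goal in every later induction over hyperfinite sets.\<close>

lemma fp_induct:
  assumes fp: "is_fpow M V W E" and b: "b \<in> W"
    and P: "dfn [W] (\<lambda>e. P (e 0))"
    and 0: "\<And>b. b \<in> W \<Longrightarrow> ext E b = {} \<Longrightarrow> P b"
    and S: "\<And>b x c. b \<in> W \<Longrightarrow> P b \<Longrightarrow> x \<in> V \<Longrightarrow>
        c \<in> W \<Longrightarrow> ext E c = insert x (ext E b) \<Longrightarrow> P c"
  shows "P b"
proof -
  have 1: "dset {b\<in>W. P b}" by (intro dset_Collect P) (use fp_dset[OF fp] in auto)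
  have 2: "\<forall>U. U \<subseteq> W \<and> definable M U \<and>
        (\<forall>B\<in>W. ext E B = {} \<longrightarrow> B \<in> U) \<and>
        (\<forall>B\<in>U. \<forall>x\<in>V. \<forall>C\<in>W. ext E C = ext E B \<union>
            {x} \<longrightarrow> C \<in> U)
        \<longrightarrow> U = W" using fp unfolding is_fpow_def by (elim conjE)
  have "{b\<in>W. P b} = W"
  proof (rule 2[rule_format], intro conjI ballI impI)
    fix B x C assume "B \<in> {b\<in>W. P b}" "x \<in> V" "C \<in> W" "ext E C = ext E B \<union> {x}"
    then show "C \<in> {b\<in>W. P b}" using S[of B x C] by simp
  qed (use 0 1 in \<open>auto simp: definable_iff\<close>)
  then show ?thesis using b by blast
qed

text \<open>Hyperfinite unions of hyperfinite fibres. The two power sets need not be related, so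
  separation, comparison of different power sets and images are all instances of this lemma.\<close>

lemma fp_bind:
  assumes fp: "is_fpow M V W E" and fp': "is_fpow M V' W' E'" and b: "b \<in> W"
    and R: "dfn [V, V'] (\<lambda>e. R (e 0) (e (Suc 0)))"
    and xval: "\<And>x. x \<in> ext E b \<Longrightarrow> \<exists>a\<in>W'. ext E' a = {y\<in>V'. R x y}"
  shows "\<exists>a\<in>W'. ext E' a = {y\<in>V'. \<exists>x\<in>ext E b. R x y}"
proof -
  note [simp] = fp_dset[OF fp] fp_dset[OF fp']
  \<comment> \<open>The induction runs over all \<open>c\<close>, but only the elements of
    \<open>c\<close> that lie in \<open>b\<close> are counted: the fibres are known to be
    hyperfinite only over \<open>b\<close>.\<close>
  define P where "P c \<longleftrightarrow> (\<exists>a\<in>W'. \<forall>y\<in>V'. y \<in> ext E' a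
      \<longleftrightarrow> (\<exists>x\<in>V. x \<in> ext E c \<and> x \<in> ext E b \<and> R x y))" for c
  have "P b"
  proof (rule fp_induct[OF fp b])
    show "dfn [W] (\<lambda>e. P (e 0))"
      unfolding P_def
      by (intro dfn_bex dfn_ball dfn_iff dfn_conj fp_dfn[OF fp] fp_dfn[OF fp'] dfn_comp2[OF R] dfn_term_var
          dfn_term_const')
        (use b in auto)
  next
    fix c assume "c \<in> W" "ext E c = {}"
    then show "P c" using fp_empty[OF fp'] by (auto simp: P_def)
  next
    fix c x d assume c: "c \<in> W" "P c" "x \<in> V" "d \<in> W" "ext E d = insert x (ext E c)"
    then obtain a where a: "a \<in> W'" "\<forall>y\<in>V'. y \<in> ext E' a \<longleftrightarrow>
        (\<exists>x\<in>V. x \<in> ext E c \<and> x \<in> ext E b \<and> R x y)"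
      by (auto simp: P_def)
    show "P d"
    proof (cases "x \<in> ext E b")
      case True
      then obtain a' where a': "a' \<in> W'" "ext E' a' = {y\<in>V'. R x y}" using xval by blast
      from fp_Un[OF fp' a(1) a'(1)] obtain f where "f \<in> W'" "ext E' f = ext E' a \<union> ext E' a'"
          by blast
      then show ?thesis unfolding P_def using a a' True c by (intro bexI[of _ f]) auto
    next
      case False
      then show ?thesis unfolding P_def using a c by (intro bexI[of _ a]) auto
    qed
  qed
  then obtain a where "a \<in> W'" "\<forall>y\<in>V'. y \<in> ext E' a \<longleftrightarrow>
      (\<exists>x\<in>V. x \<in> ext E b \<and> x \<in> ext E b \<and> R x y)"
    unfolding P_def by blast
  then show ?thesis using fp_ext[OF fp, of b] fp_ext[OF fp', of a] by (intro bexI[of _ a]) auto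
qed

lemma fp_sep:
  assumes fp: "is_fpow M V W E" and b: "b \<in> W" and P: "dfn [V] (\<lambda>e. P (e 0))"
  shows "\<exists>a\<in>W. ext E a = {x\<in>ext E b. P x}"
proof -
  note V = fp_dset[OF fp]
  have "\<exists>a\<in>W. ext E a = {y\<in>V. \<exists>x\<in>ext E b. x = y \<and> P x}"
  proof (rule fp_bind[OF fp fp b])
    show "dfn [V, V] (\<lambda>e. e 0 = e (Suc 0) \<and> P (e 0))"
      by (intro dfn_conj dfn_eq[where Y = V and Z = V] dfn_comp1[OF P] dfn_term_var) (use V in auto)
    fix x assume x: "x \<in> ext E b"
    then have "{y\<in>V. x = y \<and> P x} = (if P x then {x} else {})" using fp_ext[OF fp] by auto
    then show "\<exists>a\<in>W. ext E a = {y\<in>V. x = y \<and> P x}"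
      using fp_empty[OF fp] fp_single[OF fp, of x] x fp_ext[OF fp, of b] by auto
  qed
  moreover have "{y\<in>V. \<exists>x\<in>ext E b. x = y \<and> P x} = {x\<in>ext E b. P x}"
      using fp_ext[OF fp, of b] by auto
  ultimately show ?thesis by simp
qed

text \<open>Any two power sets code the same hyperfinite sets as far as both base sets reach; in
  this form the uniqueness of power sets is used below.\<close>

lemma fp_transfer:
  assumes fp: "is_fpow M V W E" and fp': "is_fpow M V' W' E'" and b: "b \<in> W"
  shows "\<exists>a\<in>W'. ext E' a = ext E b \<inter> V'"
proof -
  note V = fp_dset[OF fp] fp_dset[OF fp']
  have "\<exists>a\<in>W'. ext E' a = {y\<in>V'. \<exists>x\<in>ext E b. x = y}"
  proof (rule fp_bind[OF fp fp' b])
    show "dfn [V, V'] (\<lambda>e. e 0 = e (Suc 0))"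
      by (intro dfn_conj dfn_eq[where Y = V and Z = V'] dfn_term_var) (use V in auto)
    fix x assume x: "x \<in> ext E b"
    have "{y\<in>V'. x = y} = (if x \<in> V' then {x} else {})" by auto
    then show "\<exists>a\<in>W'. ext E' a = {y\<in>V'. x = y}"
      using fp_empty[OF fp'] fp_single[OF fp', of x] by auto
  qed
  moreover have "{y\<in>V'. \<exists>x\<in>ext E b. x = y} = ext E b \<inter> V'" by auto
  ultimately show ?thesis by simp
qed

lemma fp_subset:
  assumes fp: "is_fpow M V W E" and V': "dset V'" "V' \<subseteq> V"
  shows "is_fpow M V' {b\<in>W. ext E b \<subseteq> V'} (E \<inter> (V' \<times> {b\<in>W. ext E b
      \<subseteq> V'}))"
    (is "is_fpow M V' ?W ?E")
proof -
  note V = fp_dset[OF fp]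
  have "dset {b\<in>W. \<forall>x\<in>V. x \<in> ext E b \<longrightarrow> x \<in> V'}"
    by (intro dset_Collect dfn_ball dfn_imp fp_dfn[OF fp] dfn_mem[where Z = V] dfn_term_var) (use V V' in auto)
  moreover have "{b\<in>W. \<forall>x\<in>V. x \<in> ext E b \<longrightarrow> x \<in> V'} = ?W"
      using fp_ext[OF fp] by auto
  ultimately have W: "dset ?W" by simp
  have ext: "ext ?E b = ext E b" if "b \<in> ?W" for b using that by (auto simp: ext_def)
  have EV: "E \<subseteq> V \<times> W" using fp by (auto simp: is_fpow_def)
  have "dfn [V', ?W] (\<lambda>e. e 0 \<in> ext E (e (Suc 0)))"
    by (intro fp_dfn[OF fp] dfn_term_var) (use V V' W in auto)
  then have "dfn [V', ?W] (\<lambda>e. (e 0, e (Suc 0)) \<in> ?E)"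
    by (rule dfn_congI) (auto simp: env_Cons ext_def)
  then have E: "definable_rel M ?E" unfolding definable_rel_def definable_iff
    by (subst dset_rel[of V' ?W]) (use V' W in auto)
  have mem: "(x, b) \<in> ?E \<longleftrightarrow> x \<in> ext E b" if "b \<in> ?W" for x b using that
      by (auto simp: ext_def)
  show ?thesis unfolding is_fpow_def
  proof (intro conjI)
    show "definable M V'" "definable M ?W" "definable_rel M ?E" using V' W E by (auto simp: definable_iff)
    show "?E \<subseteq> V' \<times> ?W" by auto
    show "\<forall>B\<in>?W. \<forall>C\<in>?W. (B = C) = (\<forall>x\<in>V'. ((x, B) \<in> ?E) = ((x, C)
        \<in> ?E))"
    proof (intro ballI)
      fix B C assume BC: "B \<in> ?W" "C \<in> ?W"
      then have "B = C \<longleftrightarrow> ext E B = ext E C" using fp_inj[OF fp] by blast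
      also have "\<dots> \<longleftrightarrow> (\<forall>x\<in>V'. x \<in> ext E B \<longleftrightarrow>
          x \<in> ext E C)" using BC by auto
      finally show "(B = C) = (\<forall>x\<in>V'. ((x, B) \<in> ?E) = ((x, C) \<in> ?E))"
        unfolding mem[OF BC(1)] mem[OF BC(2)] .
    qed
    obtain b where "b \<in> W" "ext E b = {}" using fp_empty[OF fp] by blast
    then show "\<exists>B\<in>?W. \<forall>x\<in>V'. (x, B) \<notin> ?E"
        by (intro bexI[of _ b]) (auto simp: ext_def)
    show "\<forall>a\<in>V'. \<exists>B\<in>?W. \<forall>x\<in>V'. ((x, B) \<in> ?E) = (x = a)"
    proof
      fix a assume "a \<in> V'"
      then obtain b where "b \<in> W" "ext E b = {a}" using fp_single[OF fp] V' by blast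
      then show "\<exists>B\<in>?W. \<forall>x\<in>V'. ((x, B) \<in> ?E) = (x = a)"
        using \<open>a \<in> V'\<close> mem[of b] by (intro bexI[of _ b]) auto
    qed
    show "\<forall>B\<in>?W. \<forall>C\<in>?W. \<exists>D\<in>?W. \<forall>x\<in>V'. ((x, D) \<in> ?E) =
        ((x, B) \<in> ?E \<or> (x, C) \<in> ?E)"
    proof (intro ballI)
      fix B C assume BC: "B \<in> ?W" "C \<in> ?W"
      then obtain d where "d \<in> W" "ext E d = ext E B \<union> ext E C" using fp_Un[OF fp] by blast
      then show "\<exists>D\<in>?W. \<forall>x\<in>V'. ((x, D) \<in> ?E) = ((x, B) \<in> ?E \<or>
          (x, C) \<in> ?E)"
        using BC mem[of d] mem[of B] mem[of C] by (intro bexI[of _ d]) auto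
    qed
    show "\<forall>U. U \<subseteq> ?W \<and> definable M U \<and>
        (\<forall>B\<in>?W. ext ?E B = {} \<longrightarrow> B \<in> U) \<and>
        (\<forall>B\<in>U. \<forall>x\<in>V'. \<forall>C\<in>?W. ext ?E C = ext ?E B \<union>
            {x} \<longrightarrow> C \<in> U) \<longrightarrow> U = ?W"
    proof (intro allI impI)
      fix U assume U: "U \<subseteq> ?W \<and> definable M U \<and>
          (\<forall>B\<in>?W. ext ?E B = {} \<longrightarrow> B \<in> U) \<and>
        (\<forall>B\<in>U. \<forall>x\<in>V'. \<forall>C\<in>?W. ext ?E C = ext ?E B \<union>
            {x} \<longrightarrow> C \<in> U)"
      have Us: "U \<subseteq> ?W" and Ud: "dset U" and U0: "\<And>B. B \<in> W \<Longrightarrow>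
          ext E B = {} \<Longrightarrow> B \<in> U"
        using U ext by (auto simp: definable_iff)
      have UI: "C \<in> U" if "B \<in> U" "x \<in> V'" "C \<in> W" "ext E C = insert x (ext E B)" for B x C
      proof -
        have "B \<in> ?W" "C \<in> ?W" using that Us by auto
        moreover have "ext ?E C = ext ?E B \<union> {x}" using calculation that ext by simp
        ultimately show ?thesis using U that by blast
      qed
      have "b \<in> U" if b: "b \<in> ?W" for b
      proof -
        \<comment> \<open>\<open>U\<close> is closed only under insertion of elements of
          \<open>V'\<close>, so the induction over the larger power set is applied to the trace on
          \<open>V'\<close>. Inserting an element outside \<open>V'\<close> leaves the trace as it
          is.\<close>
        have "\<exists>c\<in>U. \<forall>x\<in>V'. x \<in> ext E c \<longleftrightarrow> x \<in> ext E b"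
        proof (rule fp_induct[OF fp, of b])
          show "b \<in> W" using b by simp
          show "dfn [W] (\<lambda>e. \<exists>c\<in>U. \<forall>x\<in>V'. x \<in> ext E c
              \<longleftrightarrow> x \<in> ext E (e 0))"
            by (intro dfn_bex dfn_ball dfn_iff fp_dfn[OF fp] dfn_term_var) (use V V' W Ud Us in auto)
          fix b assume b: "b \<in> W" "ext E b = {}"
          then show "\<exists>c\<in>U. \<forall>x\<in>V'. x \<in> ext E c \<longleftrightarrow>
              x \<in> ext E b" using U0 by blast
        next
          fix b x c
          assume b: "b \<in> W" "\<exists>c\<in>U. \<forall>x\<in>V'. x \<in> ext E c \<longleftrightarrow>
              x \<in> ext E b" "x \<in> V" "c \<in> W" "ext E c = insert x (ext E b)"
          then obtain a where a: "a \<in> U" "\<forall>x\<in>V'. x \<in> ext E a \<longleftrightarrow>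
              x \<in> ext E b" by blast
          show "\<exists>a\<in>U. \<forall>x\<in>V'. x \<in> ext E a \<longleftrightarrow> x \<in> ext E c"
          proof (cases "x \<in> V'")
            case True
            obtain s where "s \<in> W" "ext E s = {x}" using fp_single[OF fp b(3)] by blast
            then obtain d where d: "d \<in> W" "ext E d = ext E a \<union> {x}"
              using fp_Un[OF fp, of a s] a Us by auto
            then have "d \<in> U" using UI[of a x d] a True by auto
            then show ?thesis using a d b(5) by (intro bexI[of _ d]) auto
          next
            case False
            then show ?thesis using a b(5) by (intro bexI[of _ a]) auto
          qed
        qed
        then obtain c where c: "c \<in> U" "\<forall>x\<in>V'. x \<in> ext E c \<longleftrightarrow>
            x \<in> ext E b" by blast
        then have "ext E c = ext E b" using b Us by auto
        then have "c = b" using fp_inj[OF fp, of c b] c Us b by auto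
        with c show ?thesis by simp
      qed
      then show "U = ?W" using Us by blast
    qed
  qed
qed

end

section \<open>Products of imaginary sorts\<close>

primrec homf :: "('s, 'r) fm \<Rightarrow> (('s, 'r) eqsort, ('s, 'r) eqrel) fm" where
  "homf (EqF i j) = EqF i j"
| "homf (RelF r is) = RelF (HomeR r) is"
| "homf (NegF \<phi>) = NegF (homf \<phi>)"
| "homf (ConjF \<phi> \<psi>) = ConjF (homf \<phi>) (homf \<psi>)"
| "homf (ExF s \<phi>) = ExF (HomeS s) (homf \<phi>)"

lemma map_Home_inj [simp]: "map Home xs = map Home ys \<longleftrightarrow> xs = ys"
  by (rule inj_map_eq_map) (auto intro: injI)

lemma dom_eq_Home: "dom (eq_struct M) (HomeS s) = Home ` dom M s"
  by (simp add: eq_struct_def)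

lemma rel_eq_Home: "rel (eq_struct M) (HomeR r) = map Home ` rel M r"
  by (simp add: eq_struct_def)

lemma map_Home_mem_rel [simp]: "map Home xs \<in> rel (eq_struct M) (HomeR r) \<longleftrightarrow>
    xs \<in> rel M r"
  by (auto simp: rel_eq_Home)

lemma sat_homf: "sat (eq_struct M) (homf \<phi>) (map Home xs) \<longleftrightarrow> sat M \<phi> xs"
proof (induction \<phi> arbitrary: xs)
  case (EqF i j)
  then show ?case by auto
next
  case (RelF r js)
  show ?case
  proof (cases "\<forall>i\<in>set js. i < length xs")
    case True
    then have "map (\<lambda>i. map Home xs ! i) js = map Home (map (\<lambda>i. xs ! i) js)" by simp
    then have "map (\<lambda>i. map Home xs ! i) js \<in> rel (eq_struct M) (HomeR r) \<longleftrightarrow>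
        map (\<lambda>i. xs ! i) js \<in> rel M r"
      by (metis map_Home_mem_rel)
    with True show ?thesis by simp
  qed auto
next
  case (ExF s \<phi>)
  show ?case by (simp add: dom_eq_Home ExF.IH[symmetric])
qed auto

lemma tuples_map_Home: "tuples (eq_struct M) (map HomeS ss) = map Home ` tuples M ss"
proof (induction ss)
  case (Cons s ss)
  have "xs \<in> tuples (eq_struct M) (map HomeS (s # ss)) \<longleftrightarrow>
      xs \<in> map Home ` tuples M (s # ss)" for xs
  proof
    assume "xs \<in> tuples (eq_struct M) (map HomeS (s # ss))"
    then obtain a zs where "xs = Home a # zs" "a \<in> dom M s" "zs \<in> tuples (eq_struct M) (map HomeS ss)"
      by (auto simp: tuples_def list_all2_Cons2 dom_eq_Home)
    with Cons obtain ys where "ys \<in> tuples M ss" "zs = map Home ys" by auto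
    with \<open>xs = _\<close> \<open>a \<in> _\<close> show "xs \<in> map Home ` tuples M (s # ss)"
      by (intro image_eqI[of _ _ "a # ys"]) (auto simp: tuples_def)
  next
    assume "xs \<in> map Home ` tuples M (s # ss)"
    then obtain a ys where "xs = Home a # map Home ys" "a \<in> dom M s" "ys \<in> tuples M ss"
      by (auto simp: tuples_def list_all2_Cons2)
    with Cons show "xs \<in> tuples (eq_struct M) (map HomeS (s # ss))"
      by (auto simp: tuples_def dom_eq_Home)
  qed
  then show ?case by blast
qed (auto simp: tuples_def)

lemma tuples_append: "tuples M (ss @ ss') = times_set (tuples M ss) (tuples M ss')"
  unfolding tuples_def times_set_def list_all2_append2
  by (auto intro: list_all2_appendI) (metis list_all2_lengthD)

lemma tuples_Nil [simp]: "tuples M [] = {[]}"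
  by (auto simp: tuples_def)

locale eq_expansion = fixes M :: "('s, 'r, 'u) struct"

text \<open>Two notions of definability live side by side: with prefix \<open>H\<close>, the
  parameter-free one of the home structure; without prefix, the one with parameters in its expansion
  by imaginaries.\<close>

sublocale eq_expansion \<subseteq> H: definability M "{}" .
sublocale eq_expansion \<subseteq> full_definability "eq_struct M" .

context eq_expansion
begin

abbreviation (input) hdom :: "'s list \<Rightarrow> ('s, 'r, 'u) eqelem list set" where
  "hdom ss \<equiv> map Home ` tuples M ss"

lemma dset_hdom: "dset (hdom ss)"
  by (subst tuples_map_Home[symmetric]) simp

lemma dset_home:
  assumes "H.dset D"
  shows "dset (map Home ` D)"
proof -
  obtain ss \<phi> where ss: "D \<subseteq> tuples M ss" and \<phi>: "\<And>xs. length xs = length ss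
      \<Longrightarrow> (xs \<in> D) = sat M \<phi> xs"
    using assms unfolding H.dset_def H.dfn_list_def by auto
  have "dfn_list (length ss) (\<lambda>xs. sat (eq_struct M) (homf \<phi>) xs)"
    unfolding dfn_list_def by (rule exI[of _ "homf \<phi>"], rule exI[of _ "[]"]) simp
  moreover have "dfn_list (length ss) (\<lambda>xs. take (length (map HomeS ss)) xs \<in> tuples (eq_struct
      M) (map HomeS ss))"
    using dfn_list_tuples[of "map HomeS ss" "length ss"] by simp
  ultimately have *: "dfn_list (length ss) (\<lambda>xs. take (length (map HomeS ss)) xs \<in> tuples
      (eq_struct M) (map HomeS ss)
      \<and> sat (eq_struct M) (homf \<phi>) xs)" by (rule dfn_list_conj[rotated])
  have "dfn_list (length ss) (\<lambda>xs. xs \<in> map Home ` D)"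
  proof (rule iffD1[OF dfn_list_cong *])
    fix xs :: "('s, 'r, 'u) eqelem list" assume l: "length xs = length ss"
    show "(take (length (map HomeS ss)) xs \<in> tuples (eq_struct M) (map HomeS ss)
      \<and> sat (eq_struct M) (homf \<phi>) xs) = (xs \<in> map Home ` D)"
      using l ss \<phi> by (auto simp: tuples_map_Home sat_homf dest: tuples_length)
  qed
  moreover have "map Home ` D \<subseteq> tuples (eq_struct M) (map HomeS ss)" using ss
      by (auto simp: tuples_map_Home)
  ultimately show ?thesis unfolding dset_def by (metis length_map)
qed

lemma dfn_home:
  assumes "H.dfn [D1, D2] (\<lambda>e. P (e 0) (e (Suc 0)))" "H.dset D1" "H.dset D2"
  shows "dset {map Home x @ map Home y | x y. x \<in> D1 \<and> y \<in> D2 \<and> P x y}"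
proof -
  let ?E = "{(x, y). x \<in> D1 \<and> y \<in> D2 \<and> P x y}"
  have "?E \<subseteq> D1 \<times> D2" by auto
  moreover have "H.dfn [D1, D2] (\<lambda>e. (e 0, e (Suc 0)) \<in> ?E)"
    by (rule H.dfn_congI[OF assms(1)]) (auto simp: env_Cons)
  ultimately have "H.dset {x @ y | x y. (x, y) \<in> ?E}" 
    by (rule iffD2[OF H.dset_rel[OF assms(2,3)]])
  from dset_home[OF this]
  have "dset (map Home ` {x @ y | x y. (x, y) \<in> ?E})" .
  moreover have "map Home ` {x @ y | x y. (x, y) \<in> ?E} =
      ({map Home x @ map Home y | x y. x \<in> D1 \<and> y \<in> D2 \<and>
          P x y} :: ('s, 'r, 'u) eqelem list set)"
    (is "?l = ?r")
  proof (intro equalityI subsetI)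
    fix z assume "z \<in> ?r"
    then obtain x y where "z = map Home x @ map Home y" "x \<in> D1" "y \<in> D2" "P x y" by blast
    then show "z \<in> ?l" by (intro image_eqI[of _ _ "x @ y"]) auto
  next
    fix z assume "z \<in> ?l"
    then obtain x y where "z = map Home x @ map Home y" "x \<in> D1" "y \<in> D2" "P x y" by auto
    then show "z \<in> ?r" by blast
  qed
  ultimately show ?thesis by (simp only:)
qed

text \<open>
  A product of imaginary sorts is presented as a quotient of a product of home sorts by an
  equivalence relation that is definable without parameters in the home structure. This is what
  allows one to define a further imaginary sort, whose elements code hyperfinite subsets of the
  product.
\<close>

definition cover :: "('s, 'r) eqsort list \<Rightarrow> 's list \<Rightarrow> ('u list \<Rightarrow> ('s, 'r,
    'u) eqelem list) \<Rightarrow> bool" where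
  "cover Ss hs f \<longleftrightarrow> f ` tuples M hs = tuples (eq_struct M) Ss \<and>
     H.dfn [tuples M hs, tuples M hs] (\<lambda>e. f (e 0) = f (e (Suc 0))) \<and>
     dset {map Home x @ f x | x. x \<in> tuples M hs}"

lemma cover_Nil: "cover [] [] (\<lambda>_. [])"
proof -
  have "H.dfn [{[]}, {[]}] (\<lambda>e. True)" by (rule H.dfn_const)
  moreover have "dset {[]}" using dset_tuples[of "[]"] by simp
  ultimately show ?thesis by (simp add: cover_def)
qed

lemma cover_Home: "cover [HomeS s] [s] (map Home)"
proof -
  have 1: "map Home ` tuples M [s] = tuples (eq_struct M) [HomeS s]"
    using tuples_map_Home[of M "[s]"] by simp
  have 2: "H.dfn [tuples M [s], tuples M [s]] (\<lambda>e. map Home (e 0) = map Home (e (Suc 0)))"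
    unfolding map_Home_inj by (rule H.dfn_eq_vars) (auto simp: tuples_length)
  have "dset {x @ y | x y. (x, y) \<in> {(x, x) | x. x \<in> hdom [s]}}"
  proof (subst dset_rel)
    have "dfn [hdom [s], hdom [s]] (\<lambda>e. e 0 = e (Suc 0))"
      by (rule dfn_eq_vars) (auto simp: tuples_length)
    then show "dfn [hdom [s], hdom [s]] (\<lambda>e. (e 0, e (Suc 0)) \<in> {(x, x) | x. x \<in> hdom [s]})"
      by (rule dfn_congI) (auto simp: env_Cons)
  qed (use dset_hdom in auto)
  also have "{x @ y | x y. (x, y) \<in> {(x, x) | x. x \<in> hdom [s]}} = {map Home x @ map Home x | x. x
      \<in> tuples M [s]}"
    by blast
  finally show ?thesis using 1 2 by (simp add: cover_def)
qed

text \<open>The graph of the covering map is the interpretation of the symbol \<open>ProjR\<close>,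
  and equality of images is the formula \<open>\<phi>\<close> itself, which has no
  parameters.\<close>

lemma cover_Imag:
  assumes eq: "equiv (tuples M ss) (fm_rel M ss \<phi>)"
  shows "cover [ImagS ss \<phi>] ss (\<lambda>x. [Imag ss \<phi> (fm_rel M ss \<phi> `` {x})])"
proof -
  let ?f = "\<lambda>x. [Imag ss \<phi> (fm_rel M ss \<phi> `` {x})]"
  have dom: "dom (eq_struct M) (ImagS ss \<phi>) = Imag ss \<phi> ` (tuples M ss // fm_rel M ss \<phi>)"
    using eq by (simp add: eq_struct_def)
  have "tuples (eq_struct M) [ImagS ss \<phi>] = (\<lambda>a. [a]) ` dom (eq_struct M) (ImagS ss \<phi>)"
    by (auto simp: tuples_def list_all2_Cons2)
  also have "\<dots> = ?f ` tuples M ss" unfolding dom by (auto simp: quotient_def)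
  finally have 1: "?f ` tuples M ss = tuples (eq_struct M) [ImagS ss \<phi>]" by simp
  have iff: "?f x = ?f y \<longleftrightarrow> sat M \<phi> (x @ y)" if "x \<in> tuples M ss"
      "y \<in> tuples M ss" for x y
    using eq_equiv_class_iff[OF eq that] that by (simp add: fm_rel_def)
  have "H.dfn [tuples M ss, tuples M ss] (\<lambda>e. sat M \<phi> (e 0 @ e (Suc 0)))"
    unfolding H.dfn_def
  proof (intro impI exI[of _ "sat M \<phi>"] conjI allI)
    show "H.dfn_list (H.arsum [tuples M ss, tuples M ss]) (sat M \<phi>)"
      unfolding H.dfn_list_def by (rule exI[of _ \<phi>], rule exI[of _ "[]"]) simp
  qed (simp add: flat_Cons)
  then have 2: "H.dfn [tuples M ss, tuples M ss] (\<lambda>e. ?f (e 0) = ?f (e (Suc 0)))"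
    by (rule H.dfn_congI, subst iff) (auto simp: env_Cons)
  let ?r = "rel (eq_struct M) (ProjR ss \<phi>)"
  have r: "?r = {map Home x @ ?f x | x. x \<in> tuples M ss}"
    using eq by (simp add: eq_struct_def)
  have "?r \<subseteq> times_set (hdom ss) (tuples (eq_struct M) [ImagS ss \<phi>])"
    unfolding r 1[symmetric] by auto
  then have "?r \<subseteq> tuples (eq_struct M) (map HomeS ss @ [ImagS ss \<phi>])"
    by (simp add: tuples_append tuples_map_Home)
  moreover have "dfn_list (length (map HomeS ss @ [ImagS ss \<phi>])) (\<lambda>zs. zs \<in> ?r)"
  proof -
    have "dfn_list (Suc (length ss)) (\<lambda>zs. map (nth zs) [0..<Suc (length ss)] \<in> ?r)"
      by (rule dfn_list_rel) auto
    moreover have "map (nth zs) [0..<Suc (length ss)] = zs"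
      if "length zs = Suc (length ss)" for zs :: "('s, 'r, 'u) eqelem list" using that by (metis map_nth)
    ultimately show ?thesis
      using dfn_list_cong[of "Suc (length ss)" "\<lambda>zs. map (nth zs) [0..<Suc (length ss)] \<in> ?r"
          "\<lambda>zs. zs \<in> ?r"] by simp
  qed
  ultimately have "dset ?r" unfolding dset_def by blast
  then show ?thesis using 1 2 r by (simp add: cover_def)
qed

lemma cover_append:
  assumes c1: "cover Ss1 hs1 f1" and c2: "cover Ss2 hs2 f2"
  shows "cover (Ss1 @ Ss2) (hs1 @ hs2) (\<lambda>x. f1 (take (length hs1) x) @ f2 (drop (length hs1) x))"
proof -
  let ?f = "\<lambda>x. f1 (take (length hs1) x) @ f2 (drop (length hs1) x)"
  let ?h1 = "tuples M hs1" and ?h2 = "tuples M hs2"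
  let ?T1 = "tuples (eq_struct M) Ss1" and ?T2 = "tuples (eq_struct M) Ss2"
  have f: "f1 ` ?h1 = ?T1" "f2 ` ?h2 = ?T2" using c1 c2 by (auto simp: cover_def)
  have h: "tuples M (hs1 @ hs2) = times_set ?h1 ?h2" by (rule tuples_append)
  have fxy: "?f (x @ y) = f1 x @ f2 y" if "x \<in> ?h1" for x y using that by (auto dest: tuples_length)
  have 1: "?f ` tuples M (hs1 @ hs2) = tuples (eq_struct M) (Ss1 @ Ss2)"
  proof (intro equalityI subsetI)
    fix z assume "z \<in> ?f ` tuples M (hs1 @ hs2)"
    then obtain w where w: "w \<in> times_set ?h1 ?h2" "z = ?f w" unfolding h by (rule imageE) simp
    from w(1) obtain x y where xy: "w = x @ y" "x \<in> ?h1" "y \<in> ?h2" unfolding times_set_def by blast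
    have "z = f1 x @ f2 y" unfolding w(2) xy(1) by (rule fxy[OF xy(2)])
    moreover have "f1 x \<in> ?T1" "f2 y \<in> ?T2" using f xy by blast+
    ultimately show "z \<in> tuples (eq_struct M) (Ss1 @ Ss2)" unfolding tuples_append by simp
  next
    fix z assume "z \<in> tuples (eq_struct M) (Ss1 @ Ss2)"
    then obtain u v where z: "z = u @ v" "u \<in> ?T1" "v \<in> ?T2" unfolding tuples_append times_set_def
        by blast
    from z(2) obtain x where x: "x \<in> ?h1" "u = f1 x" unfolding f(1)[symmetric] by (rule imageE) simp
    from z(3) obtain y where y: "y \<in> ?h2" "v = f2 y" unfolding f(2)[symmetric] by (rule imageE) simp
    have "z = ?f (x @ y)" unfolding z(1) x(2) y(2) by (rule fxy[OF x(1), symmetric])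
    moreover have "x @ y \<in> tuples M (hs1 @ hs2)" unfolding h using x(1) y(1) by simp
    ultimately show "z \<in> ?f ` tuples M (hs1 @ hs2)" by (rule image_eqI)
  qed
  have d1: "H.dfn [?h1, ?h1] (\<lambda>e. f1 (e 0) = f1 (e (Suc 0)))" using c1 by (simp add: cover_def)
  have d2: "H.dfn [?h2, ?h2] (\<lambda>e. f2 (e 0) = f2 (e (Suc 0)))" using c2 by (simp add: cover_def)
  let ?h = "times_set ?h1 ?h2"
  have [simp]: "H.dset ?h" by (rule H.dset_times) auto
  have "H.dfn [?h, ?h] (\<lambda>e. \<exists>x1\<in>?h1. \<exists>x2\<in>?h2. \<exists>y1\<in>?h1.
      \<exists>y2\<in>?h2. e 0 = x1 @ x2 \<and> e (Suc 0) = y1 @ y2 \<and>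
      f1 x1 = f1 y1 \<and> f2 x2 = f2 y2)"
    by (intro H.dfn_bex H.dfn_conj H.dfn_eq[where Y = ?h and Z = ?h] H.dfn_term_append H.dfn_term_var
        H.dfn_comp2[OF d1] H.dfn_comp2[OF d2]) auto
  then have 2: "H.dfn [?h, ?h] (\<lambda>e. ?f (e 0) = ?f (e (Suc 0)))"
  proof (rule H.dfn_congI)
    fix e assume "env [?h, ?h] e"
    then obtain x1 x2 y1 y2 where e: "e 0 = x1 @ x2" "e (Suc 0) = y1 @ y2" "x1 \<in> ?h1" "x2 \<in> ?h2"
        "y1 \<in> ?h1" "y2 \<in> ?h2"
      by (auto simp: env_Cons times_set_def)
    have "f1 x1 \<in> ?T1" "f1 y1 \<in> ?T1" using e f by auto
    then have "length (f1 x1) = length (f1 y1)" by (simp add: tuples_length)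
    then have "(?f (e 0) = ?f (e (Suc 0))) = (f1 x1 = f1 y1 \<and> f2 x2 = f2 y2)"
      unfolding e(1,2) fxy[OF e(3)] fxy[OF e(5)] by simp
    also have "\<dots> = (\<exists>x1\<in>?h1. \<exists>x2\<in>?h2. \<exists>y1\<in>?h1. \<exists>y2\<in>?h2.
        e 0 = x1 @ x2 \<and> e (Suc 0) = y1 @ y2 \<and>
      f1 x1 = f1 y1 \<and> f2 x2 = f2 y2)" (is "_ = ?R")
    proof
      assume ?R
      then obtain u1 u2 v1 v2 where u: "u1 \<in> ?h1" "u2 \<in> ?h2" "v1 \<in> ?h1" "v2 \<in> ?h2"
        "e 0 = u1 @ u2" "e (Suc 0) = v1 @ v2" "f1 u1 = f1 v1" "f2 u2 = f2 v2" by blast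
      have "length u1 = length x1" "length v1 = length y1" using u e by (simp_all add: tuples_length)
      with u e show "f1 x1 = f1 y1 \<and> f2 x2 = f2 y2" by simp
    qed (use e in blast)
    finally show "(?f (e 0) = ?f (e (Suc 0))) = (\<exists>x1\<in>?h1. \<exists>x2\<in>?h2.
        \<exists>y1\<in>?h1. \<exists>y2\<in>?h2. e 0 = x1 @ x2 \<and> e (Suc 0) = y1 @ y2 \<and>
      f1 x1 = f1 y1 \<and> f2 x2 = f2 y2)" .
  qed
  let ?G1 = "{map Home x @ f1 x | x. x \<in> ?h1}" and ?G2 = "{map Home x @ f2 x | x. x \<in> ?h2}"
  have G: "dset ?G1" "dset ?G2" using c1 c2 by (auto simp: cover_def)
  let ?Z = "times_set (hdom hs1) (times_set (hdom hs2) (times_set ?T1 ?T2))"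
  have D: "dset ?Z" by (intro dset_times dset_hdom dset_tuples)
  have "dset {p \<in> ?Z. \<exists>x1\<in>hdom hs1. \<exists>x2\<in>hdom hs2. \<exists>t1\<in>?T1.
      \<exists>t2\<in>?T2.
      p = x1 @ x2 @ t1 @ t2 \<and> x1 @ t1 \<in> ?G1 \<and> x2 @ t2 \<in> ?G2}"
    by (intro dset_Collect D dfn_bex dfn_conj dfn_eq[where Y = ?Z and Z = ?Z] dfn_term_append dfn_term_var
       dfn_mem[OF G(1), where Z = "times_set (hdom hs1) ?T1"]
       dfn_mem[OF G(2), where Z = "times_set (hdom hs2) ?T2"] dset_hdom dset_tuples) (use D dset_hdom in auto)
  also have "{p \<in> ?Z. \<exists>x1\<in>hdom hs1. \<exists>x2\<in>hdom hs2. \<exists>t1\<in>?T1.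
      \<exists>t2\<in>?T2.
      p = x1 @ x2 @ t1 @ t2 \<and> x1 @ t1 \<in> ?G1 \<and> x2 @ t2 \<in> ?G2} =
      {map Home x @ ?f x | x. x \<in> ?h}" (is "?l = ?r")
  proof (intro equalityI subsetI)
    fix p assume "p \<in> ?l"
    then obtain x1 x2 t1 t2 where p: "p = map Home x1 @ map Home x2 @ t1 @ t2" "x1 \<in> ?h1" "x2 \<in> ?h2"
      "map Home x1 @ t1 \<in> ?G1" "map Home x2 @ t2 \<in> ?G2" by blast
    obtain y1 where y1: "map Home x1 @ t1 = map Home y1 @ f1 y1" "y1 \<in> ?h1" using p(4) by blast
    obtain y2 where y2: "map Home x2 @ t2 = map Home y2 @ f2 y2" "y2 \<in> ?h2" using p(5) by blast
    have "length x1 = length y1" "length x2 = length y2" using p(2,3) y1(2) y2(2)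
        by (simp_all add: tuples_length)
    then have "t1 = f1 x1" "t2 = f2 x2" using y1(1) y2(1) by auto
    then have "p = map Home (x1 @ x2) @ ?f (x1 @ x2)" using p fxy by simp
    moreover have "x1 @ x2 \<in> ?h" using p by simp
    ultimately show "p \<in> ?r" by blast
  next
    fix p assume "p \<in> ?r"
    then obtain x1 x2 where p: "p = map Home (x1 @ x2) @ ?f (x1 @ x2)" "x1 \<in> ?h1" "x2 \<in> ?h2"
      by (auto simp: times_set_def)
    have p': "p = map Home x1 @ map Home x2 @ f1 x1 @ f2 x2" unfolding p(1) fxy[OF p(2)] by simp
    have T: "f1 x1 \<in> ?T1" "f2 x2 \<in> ?T2" using f p by blast+
    have "p \<in> ?Z" unfolding p' using T p(2,3) by (intro append_mem_times imageI)
    moreover have "map Home x1 @ f1 x1 \<in> ?G1" "map Home x2 @ f2 x2 \<in> ?G2" using p(2,3) by blast+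
    ultimately show "p \<in> ?l" using p' T p(2,3) by blast
  qed
  finally show ?thesis using 1 2 h by (simp add: cover_def)
qed

text \<open>Non-emptiness excludes the sorts whose formula is not an equivalence relation; these are
  empty and have no projection onto them.\<close>

lemma cover_ex: "tuples (eq_struct M) Ss \<noteq> {} \<Longrightarrow> \<exists>hs f. cover Ss hs f"
proof (induction Ss)
  case Nil
  then show ?case using cover_Nil by blast
next
  case (Cons S Ss)
  from Cons.prems have ne: "dom (eq_struct M) S \<noteq> {}" "tuples (eq_struct M) Ss \<noteq> {}"
    by (auto simp: tuples_def list_all2_Cons2)
  have "\<exists>hs f. cover [S] hs f"
  proof (cases S)
    case (HomeS s)
    then show ?thesis using cover_Home by blast
  next
    case (ImagS ss \<phi>)
    with ne have "equiv (tuples M ss) (fm_rel M ss \<phi>)" by (auto simp: eq_struct_def split: if_splits)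
    then show ?thesis using cover_Imag ImagS by blast
  qed
  then show ?case using Cons.IH[OF ne(2)] cover_append[of "[S]" _ _ Ss] by fastforce
qed

text \<open>A parameter-free definable equivalence relation on home tuples is turned into a sort
  with a definable projection \<open>cl\<close>. In this way the codes of hyperfinite sets, modulo
  coding the same set, become a definable set.\<close>

lemma quotient_cover:
  assumes P: "H.dfn [tuples M cs, tuples M cs] (\<lambda>e. P (e 0) (e (Suc 0)))"
    and eq: "equiv (tuples M cs) {(x, y). x \<in> tuples M cs \<and> y \<in> tuples M cs \<and> P x y}"
  shows "\<exists>W cl. dset W \<and> cl ` tuples M cs = W \<and>
    (\<forall>x\<in>tuples M cs. \<forall>y\<in>tuples M cs. cl x = cl y \<longleftrightarrow> P x y) \<and>
        dset {map Home x @ cl x | x. x \<in> tuples M cs}"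
proof -
  obtain Q where Q: "H.dfn_list (H.arsum [tuples M cs, tuples M cs]) Q"
    "\<And>e. env [tuples M cs, tuples M cs] e \<Longrightarrow> P (e 0) (e (Suc 0)) = Q (flat [tuples M cs,
        tuples M cs] e)"
    using P unfolding H.dfn_def by auto
  obtain \<phi> where \<phi>: "\<And>xs. length xs = H.arsum [tuples M cs, tuples M cs] \<Longrightarrow>
      Q xs = sat M \<phi> xs"
    using Q(1) unfolding H.dfn_list_def by auto
  have PS: "P x y \<longleftrightarrow> sat M \<phi> (x @ y)" if "x \<in> tuples M cs" "y \<in> tuples M cs"
      for x y
  proof -
    have e: "env [tuples M cs, tuples M cs] (case_nat x (\<lambda>_. y))" using that by (simp add: env_Cons)
    have "length (flat [tuples M cs, tuples M cs] (case_nat x (\<lambda>_. y))) = H.arsum [tuples M cs,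
        tuples M cs]"
      by (rule H.length_flat[OF _ e]) simp
    then show ?thesis using Q(2)[OF e] \<phi> by (simp add: flat_Cons)
  qed
  then have "{(x, y). x \<in> tuples M cs \<and> y \<in> tuples M cs \<and> P x y} = fm_rel M cs \<phi>"
    by (auto simp: fm_rel_def)
  with eq have eq': "equiv (tuples M cs) (fm_rel M cs \<phi>)" by simp
  define cl where "cl = (\<lambda>x. [Imag cs \<phi> (fm_rel M cs \<phi> `` {x})])"
  have "cl x = cl y \<longleftrightarrow> P x y" if "x \<in> tuples M cs" "y \<in> tuples M cs" for x y
    using eq_equiv_class_iff[OF eq' that] that PS by (simp add: fm_rel_def cl_def)
  moreover have "cover [ImagS cs \<phi>] cs cl" unfolding cl_def by (rule cover_Imag[OF eq'])
  ultimately show ?thesis unfolding cover_def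
    by (intro exI[of _ "tuples (eq_struct M) [ImagS cs \<phi>]"] exI[of _ cl]) simp
qed

end

section \<open>The field sort\<close>

context definability
begin

lemma dfn_term_cong: "dfn_term \<Gamma> Y t' \<Longrightarrow> (\<And>e. env \<Gamma> e \<Longrightarrow>
    t e = t' e) \<Longrightarrow> dfn_term \<Gamma> Y t"
  unfolding dfn_term_def
  by (intro conjI; (elim conjE)?; (rule dfn_congI)?; simp add: env_Cons)

text \<open>The declared range of a term may be replaced by any definable set containing its values,
  whether smaller or larger.\<close>

lemma dfn_term_sub:
  assumes "dfn_term \<Gamma> Y t" "dset Y'" "\<And>e. env \<Gamma> e \<Longrightarrow> t e \<in> Y'"
  shows "dfn_term \<Gamma> Y' t"
  unfolding dfn_term_def
proof (intro conjI allI impI)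
  show "dfn (Y' # \<Gamma>) (\<lambda>e. e 0 = t (\<lambda>i. e (Suc i)))"
    by (intro dfn_eq[where Y = Y' and Z = Y] dfn_term_var dfn_term_weaken[OF assms(1)]) (use assms in auto)
qed (use assms in auto)

lemma dfn_term_graph1:
  "dfn [Z, Y] (\<lambda>e. e 0 = f (e (Suc 0))) \<Longrightarrow> dset Z \<Longrightarrow>
      (\<And>y. y \<in> Y \<Longrightarrow> f y \<in> Z) \<Longrightarrow>
    dfn_term \<Gamma> Y t \<Longrightarrow> dfn_term \<Gamma> Z (\<lambda>e. f (t e))"
  by (rule dfn_term_comp1) (auto simp: dfn_term_def env_Cons)

lemma dfn_term_graph2:
  "dfn [Z, Ya, Yb] (\<lambda>e. e 0 = f (e (Suc 0)) (e (Suc (Suc 0)))) \<Longrightarrow>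
      dset Z \<Longrightarrow>
    (\<And>y z. y \<in> Ya \<Longrightarrow> z \<in> Yb \<Longrightarrow> f y z \<in> Z) \<Longrightarrow>
    dfn_term \<Gamma> Ya t \<Longrightarrow> dfn_term \<Gamma> Yb s \<Longrightarrow>
        dfn_term \<Gamma> Z (\<lambda>e. f (t e) (s e))"
  by (rule dfn_term_comp2) (auto simp: dfn_term_def env_Cons)

lemma dfn_term_graph3:
  "dfn [Z, Ya, Yb, Yc] (\<lambda>e. e 0 = f (e (Suc 0)) (e (Suc (Suc 0))) (e (Suc (Suc (Suc 0)))))
      \<Longrightarrow> dset Z \<Longrightarrow>
    (\<And>y z w. y \<in> Ya \<Longrightarrow> z \<in> Yb \<Longrightarrow> w \<in> Yc \<Longrightarrow>
        f y z w \<in> Z) \<Longrightarrow>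
    dfn_term \<Gamma> Ya t \<Longrightarrow> dfn_term \<Gamma> Yb s \<Longrightarrow>
        dfn_term \<Gamma> Yc r \<Longrightarrow> dfn_term \<Gamma> Z (\<lambda>e. f (t e) (s e) (r e))"
  by (rule dfn_term_comp3) (auto simp: dfn_term_def env_Cons)

end

lemma el_inject [simp]: "el x = el y \<longleftrightarrow> x = y"
  by (simp add: el_def)

lemma el_mem_image [simp]: "el x \<in> el ` S \<longleftrightarrow> x \<in> S"
  by auto

definition unel :: "('k, 'f) elt \<Rightarrow> 'k" where
  "unel y = (THE x. el x = y)"

lemma unel_el [simp]: "unel (el x) = x"
  by (simp add: unel_def)

definition fl :: "'f \<Rightarrow> ('k, 'f) elt" where
  "fl F = [Home (Inr F)]"

definition unfl :: "('k, 'f) elt \<Rightarrow> 'f" where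
  "unfl y = (THE F. fl F = y)"

lemma fl_inject [simp]: "fl F = fl G \<longleftrightarrow> F = G"
  by (simp add: fl_def)

lemma unfl_fl [simp]: "unfl (fl F) = F"
  by (simp add: unfl_def)

locale hf_field =
  fixes mem :: "'k::field \<Rightarrow> 'f \<Rightarrow> bool"
  assumes fin: "fin_field mem" and char_zero: "def_char_zero mem"

sublocale hf_field \<subseteq> full_definability "Keq mem" .

context hf_field
begin

abbreviation FieldU :: "('k, 'f) elt set" where "FieldU \<equiv> range el"
abbreviation FinU :: "('k, 'f) elt set" where "FinU \<equiv> range fl"

section \<open>Definability of the field operations\<close>

lemma tuples_K: "tuples (Keq mem) [HomeS FieldS] = FieldU"
  by (auto simp: tuples_def list_all2_Cons2 Keq_def eq_struct_def field_struct_def el_def)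

lemma tuples_F: "tuples (Keq mem) [HomeS FinS] = FinU"
  by (auto simp: tuples_def list_all2_Cons2 Keq_def eq_struct_def field_struct_def fl_def)

lemma dset_K [simp]: "dset FieldU" using dset_tuples[of "[HomeS FieldS]"] by (simp add: tuples_K)
lemma dset_F [simp]: "dset FinU" using dset_tuples[of "[HomeS FinS]"] by (simp add: tuples_F)

definition dfn_field :: "('k, 'f) elt set list \<Rightarrow> ((nat \<Rightarrow> ('k, 'f) elt) \<Rightarrow>
    'k) \<Rightarrow> bool" where
  "dfn_field \<Gamma> t \<longleftrightarrow> dfn_term \<Gamma> FieldU (\<lambda>e. el (t e))"

lemma dfn_term_el: "dfn_field \<Gamma> t \<Longrightarrow> dfn_term \<Gamma> FieldU (\<lambda>e. el (t e))"
    by (simp add: dfn_field_def)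

lemma dfn_field_var: "i < length \<Gamma> \<Longrightarrow> \<Gamma> ! i \<subseteq> FieldU \<Longrightarrow>
    dfn_field \<Gamma> (\<lambda>e. unel (e i))"
  unfolding dfn_field_def
proof (rule dfn_term_cong[OF dfn_term_var])
  fix e assume "i < length \<Gamma>" "\<Gamma> ! i \<subseteq> FieldU" "env \<Gamma> e"
  then have "e i \<in> FieldU" by (auto simp: env_def)
  then show "el (unel (e i)) = e i" by auto
qed auto

lemma dfn_field_const: "dfn_field \<Gamma> (\<lambda>e. c)"
  unfolding dfn_field_def by (rule dfn_term_const') auto

lemma dfn_field_graph2:
  assumes "dfn [FieldU, FieldU, FieldU] (\<lambda>e. unel (e 0) = h (unel (e (Suc 0))) (unel (e (Suc (Suc
      0)))))"
    and "dfn_field \<Gamma> t" "dfn_field \<Gamma> s"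
  shows "dfn_field \<Gamma> (\<lambda>e. h (t e) (s e))"
proof -
  have "dfn_term \<Gamma> FieldU (\<lambda>e. el (h (unel (el (t e) :: ('k, 'f) elt)) (unel (el (s e) :: ('k,
      'f) elt))))"
  proof (rule dfn_term_graph2[where f = "\<lambda>y z. el (h (unel y) (unel z))"
      and t = "\<lambda>e. el (t e)" and s = "\<lambda>e. el (s e)"])
    show "dfn [FieldU, FieldU, FieldU] (\<lambda>e. e 0 = el (h (unel (e (Suc 0))) (unel (e (Suc (Suc 0))))))"
      by (rule dfn_congI[OF assms(1)]) (auto simp: env_Cons)
  qed (use assms in \<open>auto simp: dfn_field_def\<close>)
  then show ?thesis by (simp add: dfn_field_def)
qed

lemma dfn_eqk: "dfn_field \<Gamma> t \<Longrightarrow> dfn_field \<Gamma> s \<Longrightarrow>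
    dfn \<Gamma> (\<lambda>e. t e = s e)"
  unfolding dfn_field_def using dfn_eq[of \<Gamma> FieldU "\<lambda>e. el (t e)"
      FieldU "\<lambda>e. el (s e)"] by simp

lemma dfn_memk: "dset (el ` S :: ('k, 'f) elt set) \<Longrightarrow> dfn_field \<Gamma> t \<Longrightarrow>
    dfn \<Gamma> (\<lambda>e. t e \<in> S)"
  unfolding dfn_field_def using dfn_mem[of "el ` S" \<Gamma> FieldU "\<lambda>e. el (t e)"]
      by (simp add: image_iff)

lemma dfn_bexk:
  assumes "dset (el ` S :: ('k, 'f) elt set)" "dfn (el ` S # \<Gamma>) (\<lambda>e. P (unel (e 0))
      (\<lambda>i. e (Suc i)))"
  shows "dfn \<Gamma> (\<lambda>e. \<exists>x\<in>S. P x e)"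
  using dfn_bex[of "el ` S" \<Gamma> "\<lambda>y. P (unel y)"] assms by simp

lemma dfn_ballk:
  assumes "dset (el ` S :: ('k, 'f) elt set)" "dfn (el ` S # \<Gamma>) (\<lambda>e. P (unel (e 0))
      (\<lambda>i. e (Suc i)))"
  shows "dfn \<Gamma> (\<lambda>e. \<forall>x\<in>S. P x e)"
  using dfn_ball[of "el ` S" \<Gamma> "\<lambda>y. P (unel y)"] assms by simp

lemma dfn_exk: "dfn (FieldU # \<Gamma>) (\<lambda>e. P (unel (e 0)) (\<lambda>i. e (Suc i)))
    \<Longrightarrow> dfn \<Gamma> (\<lambda>e. \<exists>x. P x e)"
  using dfn_bexk[of UNIV \<Gamma> P] by simp

lemma dfn_allk: "dfn (FieldU # \<Gamma>) (\<lambda>e. P (unel (e 0)) (\<lambda>i. e (Suc i)))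
    \<Longrightarrow> dfn \<Gamma> (\<lambda>e. \<forall>x. P x e)"
  using dfn_ballk[of UNIV \<Gamma> P] by simp

lemma dset_Collectk:
  "dfn [FieldU] (\<lambda>e. P (unel (e 0))) \<Longrightarrow> dset (el ` {x. P x} :: ('k, 'f) elt set)"
proof -
  assume "dfn [FieldU] (\<lambda>e. P (unel (e 0)))"
  then have "dset {y\<in>FieldU. P (unel y)}" by (intro dset_Collect) auto
  also have "{y\<in>FieldU. P (unel y)} = el ` {x. P x}" by auto
  finally show ?thesis .
qed

lemma rel_AddMul:
  "[Home (Inl x), Home (Inl y), Home (Inl z)] \<in> rel (Keq mem) (HomeR AddR) \<longleftrightarrow> z = x + y"
  "[Home (Inl x), Home (Inl y), Home (Inl z)] \<in> rel (Keq mem) (HomeR MulR) \<longleftrightarrow> z = x * y"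
  using map_Home_mem_rel[of "[Inl x, Inl y, Inl z]" "field_struct mem" AddR]
    map_Home_mem_rel[of "[Inl x, Inl y, Inl z]" "field_struct mem" MulR]
  by (simp_all add: Keq_def field_struct_def)

lemma dfn_field_add: "dfn_field \<Gamma> t \<Longrightarrow> dfn_field \<Gamma> s \<Longrightarrow>
    dfn_field \<Gamma> (\<lambda>e. t e + s e)"
proof (rule dfn_field_graph2[where h = "(+)"])
  have "dfn [FieldU, FieldU, FieldU] (\<lambda>e. [e (Suc 0) ! 0, e (Suc (Suc 0)) ! 0, e 0 ! 0] \<in> rel
      (Keq mem) (HomeR AddR))"
    by (intro dfn_rel3 dfn_coord_var) (auto simp: el_def)
  then show "dfn [FieldU, FieldU, FieldU] (\<lambda>e. unel (e 0) = unel (e (Suc 0)) + unel (e (Suc (Suc 0))))"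
    by (rule dfn_congI) (auto simp: env_Cons rel_AddMul el_def unel_el[unfolded el_def])
qed

lemma dfn_field_mult: "dfn_field \<Gamma> t \<Longrightarrow> dfn_field \<Gamma> s \<Longrightarrow>
    dfn_field \<Gamma> (\<lambda>e. t e * s e)"
proof (rule dfn_field_graph2[where h = "(*)"])
  have "dfn [FieldU, FieldU, FieldU] (\<lambda>e. [e (Suc 0) ! 0, e (Suc (Suc 0)) ! 0, e 0 ! 0] \<in> rel
      (Keq mem) (HomeR MulR))"
    by (intro dfn_rel3 dfn_coord_var) (auto simp: el_def)
  then show "dfn [FieldU, FieldU, FieldU] (\<lambda>e. unel (e 0) = unel (e (Suc 0)) * unel (e (Suc (Suc 0))))"
    by (rule dfn_congI) (auto simp: env_Cons rel_AddMul el_def unel_el[unfolded el_def])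
qed

lemmas dfn_intros = dfn_conj dfn_disj dfn_imp dfn_Not dfn_iff dfn_eqk dfn_exk dfn_allk

lemma dfn_field_diff: "dfn_field \<Gamma> t \<Longrightarrow> dfn_field \<Gamma> s \<Longrightarrow>
    dfn_field \<Gamma> (\<lambda>e. t e - s e)"
proof (rule dfn_field_graph2[where h = "(-)"])
  have "dfn [FieldU, FieldU, FieldU] (\<lambda>e. unel (e 0) + unel (e (Suc (Suc 0))) = unel (e (Suc 0)))"
    by (intro dfn_intros dfn_field_add dfn_field_var) auto
  then show "dfn [FieldU, FieldU, FieldU] (\<lambda>e. unel (e 0) = unel (e (Suc 0)) - unel (e (Suc (Suc 0))))"
    by (rule dfn_congI) (auto simp: algebra_simps)
qed

lemma dfn_field_divide: "dfn_field \<Gamma> t \<Longrightarrow> dfn_field \<Gamma> s \<Longrightarrow>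
    dfn_field \<Gamma> (\<lambda>e. t e / s e)"
proof (rule dfn_field_graph2[where h = "(/)"])
  \<comment> \<open>The first disjunct reproduces the convention that division by 0 has value
    0.\<close>
  have "dfn [FieldU, FieldU, FieldU] (\<lambda>e. (unel (e (Suc (Suc 0))) = 0 \<and> unel (e 0) = 0) \<or>
     (unel (e (Suc (Suc 0))) \<noteq> 0 \<and> unel (e 0) * unel (e (Suc (Suc 0))) = unel (e (Suc 0))))"
    by (intro dfn_intros dfn_field_mult dfn_field_var dfn_field_const) auto
  then show "dfn [FieldU, FieldU, FieldU] (\<lambda>e. unel (e 0) = unel (e (Suc 0)) / unel (e (Suc (Suc 0))))"
  proof (rule dfn_congI)
    fix e :: "nat \<Rightarrow> ('k, 'f) elt"
    show "(unel (e 0) = unel (e (Suc 0)) / unel (e (Suc (Suc 0)))) = ((unel (e (Suc (Suc 0))) = 0 \<and>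
        unel (e 0) = 0) \<or>
     (unel (e (Suc (Suc 0))) \<noteq> 0 \<and> unel (e 0) * unel (e (Suc (Suc 0))) = unel (e (Suc 0))))"
      by (cases "unel (e (Suc (Suc 0))) = 0") (auto simp: nonzero_eq_divide_eq)
  qed
qed

lemmas dfn_field_intros = dfn_field_add dfn_field_mult dfn_field_diff dfn_field_divide dfn_field_const
    dfn_field_var

definition dfn_fin :: "('k, 'f) elt set list \<Rightarrow> ((nat \<Rightarrow> ('k, 'f) elt) \<Rightarrow>
    'f) \<Rightarrow> bool" where
  "dfn_fin \<Gamma> t \<longleftrightarrow> dfn_term \<Gamma> FinU (\<lambda>e. fl (t e))"

lemma dfn_fin_const: "dfn_fin \<Gamma> (\<lambda>e. F)"
  unfolding dfn_fin_def by (rule dfn_term_const') auto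

lemma dfn_fin_var: "i < length \<Gamma> \<Longrightarrow> \<Gamma> ! i \<subseteq> FinU \<Longrightarrow>
    dfn_fin \<Gamma> (\<lambda>e. unfl (e i))"
  unfolding dfn_fin_def
proof (rule dfn_term_cong[OF dfn_term_var])
  fix e assume "i < length \<Gamma>" "\<Gamma> ! i \<subseteq> FinU" "env \<Gamma> e"
  then have "e i \<in> FinU" by (auto simp: env_def)
  then show "fl (unfl (e i)) = e i" by auto
qed auto

definition EK :: "(('k, 'f) elt \<times> ('k, 'f) elt) set" where
  "EK = {(el x, [Home (Inr F)]) | x F. mem x F}"

lemma fpK: "is_fpow (Keq mem) FieldU FinU EK"
  using fin unfolding fin_field_def EK_def fl_def .

lemma ext_EK: "ext EK (fl F) = el ` {x. mem x F}"
  by (auto simp: ext_def EK_def fl_def)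

lemma dfn_fmem: "dfn_field \<Gamma> t \<Longrightarrow> dfn_fin \<Gamma> f \<Longrightarrow>
    dfn \<Gamma> (\<lambda>e. mem (t e) (f e))"
  unfolding dfn_field_def dfn_fin_def using fp_dfn[OF fpK, of \<Gamma> "\<lambda>e. el (t e)"
      "\<lambda>e. fl (f e)"]
  by (simp add: ext_EK image_iff)

lemma dfn_exf: "dfn (FinU # \<Gamma>) (\<lambda>e. P (unfl (e 0)) (\<lambda>i. e (Suc i))) \<Longrightarrow>
    dfn \<Gamma> (\<lambda>e. \<exists>F. P F e)"
  using dfn_bex[of FinU \<Gamma> "\<lambda>y. P (unfl y)"] by simp

section \<open>Hyperfinite subsets of the field\<close>

definition hfin_field :: "'k set \<Rightarrow> bool" where
  "hfin_field S \<longleftrightarrow> (\<exists>F. {x. mem x F} = S)"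

lemma hfin_field_iff: "hfin_field S \<longleftrightarrow> (\<exists>b\<in>FinU. ext EK b = el ` S)"
  by (auto simp: hfin_field_def ext_EK inj_image_eq_iff[of el] inj_def)

lemma hfin_field_mem [simp]: "hfin_field {x. mem x F}"
  by (auto simp: hfin_field_def)

lemma mem_eqI: "{x. mem x F} = {x. mem x G} \<Longrightarrow> F = G"
  using fp_inj[OF fpK, of "fl F" "fl G"] by (simp add: ext_EK)

lemma hfin_field_empty [simp]: "hfin_field {}"
  unfolding hfin_field_iff using fp_empty[OF fpK] by simp

lemma hfin_field_single [simp]: "hfin_field {a}"
  unfolding hfin_field_iff using fp_single[OF fpK, of "el a"] by simp

lemma hfin_field_Un: "hfin_field S \<Longrightarrow> hfin_field T \<Longrightarrow> hfin_field (S \<union> T)"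
  unfolding hfin_field_iff using fp_Un[OF fpK] by (metis image_Un)

lemma hfin_field_insert: "hfin_field S \<Longrightarrow> hfin_field (insert a S)"
  using hfin_field_Un[OF hfin_field_single[of a]] by simp

lemma hfin_field_bind:
  assumes "hfin_field S" "dfn [FieldU, FieldU] (\<lambda>e. R (unel (e 0)) (unel (e (Suc 0))))"
      "\<And>x. x \<in> S \<Longrightarrow> hfin_field {y. R x y}"
  shows "hfin_field {y. \<exists>x\<in>S. R x y}"
proof -
  obtain b where b: "b \<in> FinU" "ext EK b = el ` S" using assms(1) by (auto simp: hfin_field_iff)
  have "\<exists>a\<in>FinU. ext EK a = {y\<in>FieldU. \<exists>x\<in>ext EK b. R (unel x) (unel y)}"
  proof (rule fp_bind[OF fpK fpK b(1) assms(2)])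
    fix x assume "x \<in> ext EK b"
    then obtain z where z: "x = el z" "z \<in> S" using b by auto
    have "{y\<in>FieldU. R (unel x) (unel y)} = el ` {y. R z y}" using z by auto
    then show "\<exists>a\<in>FinU. ext EK a = {y\<in>FieldU. R (unel x) (unel y)}" using assms(3)[OF z(2)]
        by (simp add: hfin_field_iff)
  qed
  moreover have "{y\<in>FieldU. \<exists>x\<in>ext EK b. R (unel x) (unel y)} = el ` {y. \<exists>x\<in>S. R
      x y}" using b by auto
  ultimately show ?thesis by (simp add: hfin_field_iff)
qed

lemma hfin_field_sep:
  assumes "hfin_field S" "dfn [FieldU] (\<lambda>e. P (unel (e 0)))"
  shows "hfin_field {x\<in>S. P x}"
proof -
  obtain b where b: "b \<in> FinU" "ext EK b = el ` S" using assms(1) by (auto simp: hfin_field_iff)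
  have "\<exists>a\<in>FinU. ext EK a = {x\<in>ext EK b. P (unel x)}" by (rule fp_sep[OF fpK b(1) assms(2)])
  moreover have "{x\<in>ext EK b. P (unel x)} = el ` {x\<in>S. P x}" using b by auto
  ultimately show ?thesis by (simp add: hfin_field_iff)
qed

lemma hfin_field_image:
  assumes "hfin_field S" "dfn [FieldU, FieldU] (\<lambda>e. unel (e (Suc 0)) = h (unel (e 0)))"
  shows "hfin_field (h ` S)"
proof -
  have "hfin_field {y. \<exists>x\<in>S. y = h x}" by (rule hfin_field_bind[OF assms]) simp
  also have "{y. \<exists>x\<in>S. y = h x} = h ` S" by auto
  finally show ?thesis .
qed

lemma hfin_field_image2:
  assumes S: "hfin_field S" and T: "hfin_field T"
    and h: "dfn [FieldU, FieldU, FieldU] (\<lambda>e. unel (e 0) = h (unel (e (Suc 0))) (unel (e (Suc (Suc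
        0)))))"
  shows "hfin_field {h x y | x y. x \<in> S \<and> y \<in> T}"
proof -
  obtain F where F: "T = {x. mem x F}" using T by (auto simp: hfin_field_def)
  note dkh = dfn_field_graph2[OF h]
  have "hfin_field {z. \<exists>x\<in>S. \<exists>y. mem y F \<and> z = h x y}"
  proof (rule hfin_field_bind[OF S])
    show "dfn [FieldU, FieldU] (\<lambda>e. \<exists>y. mem y F \<and> unel (e (Suc 0)) = h (unel (e 0)) y)"
      by (intro dfn_intros dfn_fmem dfn_fin_const dkh dfn_field_var) auto
    fix x
    have "hfin_field (h x ` T)"
      by (rule hfin_field_image[OF T]) (intro dfn_intros dkh dfn_field_intros; simp)
    also have "h x ` T = {z. \<exists>y. mem y F \<and> z = h x y}" using F by auto
    finally show "hfin_field {z. \<exists>y. mem y F \<and> z = h x y}" .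
  qed
  also have "{z. \<exists>x\<in>S. \<exists>y. mem y F \<and> z = h x y} = {h x y | x y. x \<in> S \<and>
      y \<in> T}" using F by auto
  finally show ?thesis .
qed

text \<open>A hyperfinite set containing every field element would be closed under predecessors and
  contain \<open>- 1\<close>, so it would witness \<open>- 1 \<in> K0 mem\<close>.\<close>

lemma hfin_field_notin: "hfin_field S \<Longrightarrow> \<exists>x. x \<notin> S"
  using char_zero unfolding hfin_field_def def_char_zero_def K0_def by blast

end

section \<open>Existence of definable finite power sets\<close>

sublocale hf_field \<subseteq> Q: eq_expansion "field_struct mem" .

context hf_field
begin

abbreviation HS :: "(ksort, krel, 'k + 'f) struct" where "HS \<equiv> field_struct mem"

fun setof :: "'k + 'f \<Rightarrow> 'k set" where
  "setof (Inl a) = {a}"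
| "setof (Inr F) = {x. mem x F}"

text \<open>
  A code is a tuple \<open>(c, T, A, S\<^sub>0, \<dots>, S\<^sub>m\<^sub>-\<^sub>1)\<close>. Every \<open>x\<close> in \<open>T\<close> yields the sets \<open>{b \<in> A. x + c b \<in> S\<^sub>j}\<close>,
  which determine at most one \<open>m\<close>-tuple of elements of the home sorts, a field element being
  identified with its singleton; the code represents the set of these tuples. Since every code is
  admissible, induction for coded sets is just induction for the set \<open>T\<close>.
\<close>

definition fibset :: "'k \<Rightarrow> 'f \<Rightarrow> 'f \<Rightarrow> 'k \<Rightarrow> 'k set" where
  "fibset c A S x = {b. mem b A \<and> mem (x + c * b) S}"

definition csorts :: "nat \<Rightarrow> ksort list" where
  "csorts m = [FieldS, FinS, FinS] @ replicate m FinS"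

definition code :: "'k \<Rightarrow> 'f \<Rightarrow> 'f \<Rightarrow> 'f list \<Rightarrow> ('k + 'f) list"
    where
  "code c T A Sl = [Inl c, Inr T, Inr A] @ map Inr Sl"

text \<open>The relation between a tuple \<open>y\<close> and a code, with \<open>c\<close>,
  \<open>T\<close>, \<open>A\<close>, \<open>S\<^sub>j\<close> at the positions 0, 1, 2 and
  \<open>3 + j\<close>. It is spelled out with atoms and quantifiers over sorts so that it is
  visibly parameter-free; \<open>psi_code\<close> gives its meaning.\<close>

definition psi :: "ksort list \<Rightarrow> ('k + 'f) list \<Rightarrow> ('k + 'f) list \<Rightarrow> bool"
    where
  "psi hs y cd \<longleftrightarrow> (\<exists>x\<in>dom HS FieldS. [x, cd ! 1] \<in> rel HS MemR \<and>
     (\<forall>j<length hs. \<forall>b\<in>dom HS FieldS.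
       (if hs ! j = FinS then [b, y ! j] \<in> rel HS MemR else b = y ! j) \<longleftrightarrow>
       [b, cd ! 2] \<in> rel HS MemR \<and> (\<exists>u\<in>dom HS FieldS. \<exists>v\<in>dom HS FieldS.
         [cd ! 0, b, u] \<in> rel HS MulR \<and> [x, u, v] \<in> rel HS AddR \<and>
             [v, cd ! (3 + j)] \<in> rel HS MemR)))"

section \<open>Codes and the tuples they represent\<close>

lemma dom_HS: "dom HS FieldS = range Inl" "dom HS FinS = range Inr"
  by (simp_all add: field_struct_def)

lemma rel_HS [simp]:
  "[Inl x, Inl y, w] \<in> rel HS AddR \<longleftrightarrow> w = Inl (x + y)"
  "[Inl x, Inl y, w] \<in> rel HS MulR \<longleftrightarrow> w = Inl (x * y)"
  "[Inl x, Inr F] \<in> rel HS MemR \<longleftrightarrow> mem x F"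
  by (auto simp: field_struct_def)

lemma tuples_HS: "y \<in> tuples HS hs \<longleftrightarrow> length y = length hs \<and>
    (\<forall>j<length hs. y ! j \<in> (if hs ! j = FinS then range Inr else range Inl))"
proof -
  have "dom HS s = (if s = FinS then range Inr else range Inl)" for s
    by (cases s) (auto simp: field_struct_def)
  then show ?thesis by (auto simp: tuples_def list_all2_conv_all_nth)
qed

lemma tuples_FinS: "xs \<in> tuples HS (replicate m FinS) \<longleftrightarrow>
    (\<exists>Sl. length Sl = m \<and> xs = map Inr Sl)"
proof
  assume *: "xs \<in> tuples HS (replicate m FinS)"
  then have "xs = map Inr (map projr xs)"
    by (auto simp: tuples_HS intro!: nth_equalityI)
  moreover have "length (map projr xs) = m" using * by (simp add: tuples_HS)
  ultimately show "\<exists>Sl. length Sl = m \<and> xs = map Inr Sl" by blast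
qed (auto simp: tuples_HS)

lemma tuples_csorts: "cd \<in> tuples HS (csorts m) \<longleftrightarrow>
    (\<exists>c T A Sl. length Sl = m \<and> cd = code c T A Sl)"
proof
  assume "cd \<in> tuples HS (csorts m)"
  then have "list_all2 (\<lambda>x s. x \<in> dom HS s) cd (FieldS # FinS # FinS # replicate m FinS)"
    by (simp add: csorts_def tuples_def)
  then obtain c T A zs where cd: "cd = Inl c # Inr T # Inr A # zs"
    "list_all2 (\<lambda>x s. x \<in> dom HS s) zs (replicate m FinS)"
    by (auto simp: list_all2_Cons2 dom_HS)
  then have "zs \<in> tuples HS (replicate m FinS)" by (simp add: tuples_def)
  then obtain Sl where "length Sl = m" "zs = map Inr Sl" by (auto simp: tuples_FinS)
  with cd(1) show "\<exists>c T A Sl. length Sl = m \<and> cd = code c T A Sl" unfolding code_def by auto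
next
  assume "\<exists>c T A Sl. length Sl = m \<and> cd = code c T A Sl"
  then obtain c T A Sl where cd: "length Sl = m" "cd = code c T A Sl" by blast
  then have "map Inr Sl \<in> tuples HS (replicate m FinS)" by (auto simp: tuples_FinS)
  then show "cd \<in> tuples HS (csorts m)" using cd by (simp add: csorts_def code_def tuples_def dom_HS)
qed

definition matches :: "('k + 'f) list \<Rightarrow> 'k \<Rightarrow> 'f \<Rightarrow> 'f list \<Rightarrow>
    'k \<Rightarrow> bool" where
  "matches y c A Sl x \<longleftrightarrow> (\<forall>j<length y. setof (y ! j) = fibset c A (Sl ! j) x)"

lemma psi_code:
  assumes y: "y \<in> tuples HS hs" and l: "length Sl = length hs"
  shows "psi hs y (code c T A Sl) \<longleftrightarrow> (\<exists>x. mem x T \<and> matches y c A Sl x)"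
proof -
  have ly: "length y = length hs" using y by (simp add: tuples_length)
  have 1: "(if hs ! j = FinS then [Inl b, y ! j] \<in> rel HS MemR else Inl b = y ! j) \<longleftrightarrow>
      b \<in> setof (y ! j)"
    if "j < length hs" for j b
    using y that unfolding tuples_HS by (cases "hs ! j = FinS") (auto dest!: spec[of _ j])
  have 2: "code c T A Sl ! (3 + j) = Inr (Sl ! j)" if "j < length hs" for j
    using that l by (simp add: code_def)
  have 3: "code c T A Sl ! 0 = Inl c" "code c T A Sl ! Suc 0 = Inr T" "code c T A Sl ! 2 = Inr A"
    by (simp_all add: code_def)
  have "psi hs y (code c T A Sl) \<longleftrightarrow> (\<exists>x. mem x T \<and>
      (\<forall>j<length hs. \<forall>b. b \<in> setof (y ! j) \<longleftrightarrow>
      mem b A \<and> mem (x + c * b) (Sl ! j)))"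
    unfolding psi_def dom_HS using 1 2 by (simp add: 3 cong: conj_cong)
  also have "\<dots> \<longleftrightarrow> (\<exists>x. mem x T \<and> matches y c A Sl x)"
    by (simp add: matches_def fibset_def ly set_eq_iff)
  finally show ?thesis .
qed

lemma dfn_psi: "Q.H.dfn [tuples HS hs, tuples HS (csorts (length hs))] (\<lambda>e. psi hs (e 0) (e (Suc 0)))"
proof -
  have *: "Q.H.dfn \<Gamma> (\<lambda>e. if b then P e else R e)" if "b \<Longrightarrow> Q.H.dfn \<Gamma> P"
      "\<not> b \<Longrightarrow> Q.H.dfn \<Gamma> R" for \<Gamma> b P R
    using that by (cases b) simp_all
  show ?thesis
    unfolding psi_def
    by (intro Q.H.dfn_bex_dom Q.H.dfn_ball_dom Q.H.dfn_conj Q.H.dfn_iff Q.H.dfn_All_less Q.H.dfn_rel2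
        Q.H.dfn_rel3
        Q.H.dfn_eqc Q.H.dfn_coord_var *)
      (auto simp: tuples_length csorts_def)
qed

text \<open>An element \<open>a\<close> and a hyperfinite set equal to \<open>{a}\<close> have the
  same image under \<open>setof\<close>; the sort tells them apart.\<close>

lemma setof_inj: "setof a = setof b \<Longrightarrow> (a \<in> range Inr \<longleftrightarrow>
    b \<in> range Inr) \<Longrightarrow> a = b"
  using mem_eqI by (cases a; cases b) auto

lemma matches_unique:
  assumes "y \<in> tuples HS hs" "y' \<in> tuples HS hs" "matches y c A Sl x" "matches y' c A Sl x"
  shows "y = y'"
proof (rule nth_equalityI)
  show "length y = length y'" using assms by (simp add: tuples_length)
  fix j assume "j < length y"
  then show "y ! j = y' ! j" using assms
    by (intro setof_inj) (auto simp: matches_def tuples_HS split: if_splits)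
qed

lemma hfin_field_setof: "hfin_field (setof a)" by (cases a) auto

text \<open>The number of coordinates of a tuple is a standard natural number, so ordinary induction
  is available.\<close>

lemma hfin_field_UN_setof: "hfin_field (\<Union>j<m. setof (y ! j))" for m :: nat
  by (induction m) (auto simp: lessThan_Suc intro: hfin_field_Un hfin_field_setof)

lemma dfn_h: "dfn [FieldU, FieldU, FieldU] (\<lambda>e. unel (e 0) = unel (e (Suc 0)) + c * unel (e (Suc (Suc
    0))))"
  "dfn [FieldU, FieldU, FieldU] (\<lambda>e. unel (e 0) = unel (e (Suc 0)) - unel (e (Suc (Suc 0))))"
  "dfn [FieldU, FieldU, FieldU] (\<lambda>e. unel (e 0) = unel (e (Suc 0)) / unel (e (Suc (Suc 0))))"
  by (intro dfn_intros dfn_field_intros; simp)+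

text \<open>
  If \<open>c'\<close> is not a quotient of differences of elements of \<open>T'\<close> and \<open>A'\<close>, then \<open>(x, b) \<mapsto> x + c' b\<close> is
  injective on \<open>T' \<times> A'\<close>, so that arbitrary fibres over \<open>T'\<close> can be prescribed.
\<close>

lemma extend_code:
  assumes l: "length Sl = length y"
  shows "\<exists>x0 c' T' A' Sl'. length Sl' = length y \<and> {x. mem x T'} = insert x0 {x. mem x T} \<and>
      \<not> mem x0 T \<and>
    (\<forall>x j. mem x T \<longrightarrow> j < length y \<longrightarrow>
        fibset c' A' (Sl' ! j) x = fibset c A (Sl ! j) x) \<and>
    (\<forall>j<length y. fibset c' A' (Sl' ! j) x0 = setof (y ! j))"
proof -
  obtain x0 where x0: "\<not> mem x0 T" using hfin_field_notin[OF hfin_field_mem[of T]] by auto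
  obtain T' where T': "{x. mem x T'} = insert x0 {x. mem x T}"
    using hfin_field_insert[OF hfin_field_mem] unfolding hfin_field_def by blast
  have "hfin_field ({x. mem x A} \<union> (\<Union>j<length y. setof (y ! j)))"
      by (intro hfin_field_Un hfin_field_mem hfin_field_UN_setof)
  then obtain A' where A': "{x. mem x A'} = {x. mem x A} \<union> (\<Union>j<length y. setof (y ! j))"
    unfolding hfin_field_def by blast
  let ?D1 = "{x - y | x y. x \<in> {x. mem x T'} \<and> y \<in> {x. mem x T'}}"
  let ?D2 = "{x - y | x y. x \<in> {x. mem x A'} \<and> y \<in> {x. mem x A'}}"
  \<comment> \<open>Differences and quotients over hyperfinite sets form hyperfinite sets again, and
    a hyperfinite set omits some field element; this provides \<open>c'\<close>.\<close>
  have "hfin_field {u / v | u v. u \<in> ?D1 \<and> v \<in> ?D2}"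
    by (intro hfin_field_image2[of _ _ "(/)"] hfin_field_image2[of _ _ "(-)"] dfn_h hfin_field_mem)
  then obtain c' where c': "c' \<notin> {u / v | u v. u \<in> ?D1 \<and> v \<in> ?D2}" using hfin_field_notin
      by blast
  have inj: "x = x1 \<and> b = b1"
    if "x + c' * b = x1 + c' * b1" "mem x T'" "mem x1 T'" "mem b A'" "mem b1 A'" for x x1 b b1
  proof -
    have e: "c' * (b - b1) = x1 - x" using that(1) by (simp add: algebra_simps)
    have "b = b1"
    proof (rule ccontr)
      assume "b \<noteq> b1"
      then have "c' = (x1 - x) / (b - b1)" using e by (simp add: nonzero_eq_divide_eq)
      moreover have "x1 - x \<in> ?D1" "b - b1 \<in> ?D2" using that by blast+
      ultimately show False using c' by blast
    qed
    with e show ?thesis by simp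
  qed
  \<comment> \<open>The fibres over \<open>T\<close> are transported from the old factor
    \<open>c\<close> to the new factor \<open>c'\<close>; over the additional point
    \<open>x0\<close> the fibre is the \<open>j\<close>-th coordinate of \<open>y\<close>.\<close>
  let ?S = "\<lambda>j. {z. \<exists>x b. mem x T \<and> mem b A \<and> z = x + c' * b \<and>
      mem (x + c * b) (Sl ! j)} \<union> (\<lambda>b. x0 + c' * b) ` setof (y ! j)"
  have "hfin_field (?S j)" for j
  proof (rule hfin_field_Un)
    have "hfin_field {z \<in> {x + c' * b | x b. x \<in> {x. mem x T} \<and> b \<in> {x. mem x A}}.
       \<exists>x b. mem x T \<and> mem b A \<and> z = x + c' * b \<and> mem (x + c * b) (Sl ! j)}"
      by (intro hfin_field_sep hfin_field_image2 dfn_h hfin_field_mem dfn_intros dfn_fmem dfn_field_intros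
          dfn_fin_const) auto
    then show "hfin_field {z. \<exists>x b. mem x T \<and> mem b A \<and> z = x + c' * b \<and>
        mem (x + c * b) (Sl ! j)}"
      by (rule back_subst[of hfin_field]) blast
    show "hfin_field ((\<lambda>b. x0 + c' * b) ` setof (y ! j))"
      by (intro hfin_field_image hfin_field_setof dfn_intros dfn_field_intros) auto
  qed
  then have "\<forall>j. \<exists>S. {z. mem z S} = ?S j" unfolding hfin_field_def by blast
  then obtain Sf where Sf: "\<And>j. {z. mem z (Sf j)} = ?S j" by metis
  have "fibset c' A' (Sf j) x = fibset c A (Sl ! j) x" if x: "mem x T" and j: "j < length y" for x j
  proof -
    have memS: "mem z (Sf j) \<longleftrightarrow> z \<in> ?S j" for z using Sf[of j] by blast
    have "mem b A' \<and> mem (x + c' * b) (Sf j) \<longleftrightarrow> mem b A \<and>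
        mem (x + c * b) (Sl ! j)" for b
    proof
      assume b: "mem b A' \<and> mem (x + c' * b) (Sf j)"
      have T'x: "mem x T'" "mem x0 T'" using x T' by blast+
      from b have "x + c' * b \<in> ?S j" by (simp only: memS)
      then show "mem b A \<and> mem (x + c * b) (Sl ! j)"
      proof
        assume "x + c' * b \<in> {z. \<exists>x b. mem x T \<and> mem b A \<and> z = x + c' * b \<and>
            mem (x + c * b) (Sl ! j)}"
        then obtain x1 b1 where 1: "mem x1 T" "mem b1 A" "x + c' * b = x1 + c' * b1"
            "mem (x1 + c * b1) (Sl ! j)" by blast
        have "x = x1 \<and> b = b1" by (rule inj[OF 1(3)]) (use 1 T' A' x b in blast)+
        with 1 show ?thesis by simp
      next
        assume "x + c' * b \<in> (\<lambda>b. x0 + c' * b) ` setof (y ! j)"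
        then obtain b1 where 1: "b1 \<in> setof (y ! j)" "x + c' * b = x0 + c' * b1" by blast
        have "mem b1 A'" using 1(1) A' j by blast
        then have "x = x0" using inj[OF 1(2) T'x] b by blast
        with x x0 show ?thesis by simp
      qed
    next
      assume b: "mem b A \<and> mem (x + c * b) (Sl ! j)"
      then have "mem b A'" using A' by blast
      moreover have "x + c' * b \<in> ?S j" using b x by blast
      ultimately show "mem b A' \<and> mem (x + c' * b) (Sf j)" by (simp only: memS)
    qed
    then show ?thesis by (simp add: fibset_def)
  qed
  moreover have "fibset c' A' (Sf j) x0 = setof (y ! j)" if j: "j < length y" for j
  proof -
    have memS: "mem z (Sf j) \<longleftrightarrow> z \<in> ?S j" for z using Sf[of j] by blast
    have "mem b A' \<and> mem (x0 + c' * b) (Sf j) \<longleftrightarrow> b \<in> setof (y ! j)" for b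
    proof
      assume b: "mem b A' \<and> mem (x0 + c' * b) (Sf j)"
      have T'x: "mem x0 T'" using T' by blast
      from b have "x0 + c' * b \<in> ?S j" by (simp only: memS)
      then show "b \<in> setof (y ! j)"
      proof
        assume "x0 + c' * b \<in> {z. \<exists>x b. mem x T \<and> mem b A \<and> z = x + c' * b \<and>
            mem (x + c * b) (Sl ! j)}"
        then obtain x1 b1 where 1: "mem x1 T" "mem b1 A" "x0 + c' * b = x1 + c' * b1" by blast
        have "x0 = x1 \<and> b = b1" by (rule inj[OF 1(3)]) (use 1 T' A' T'x b in blast)+
        with 1 x0 show ?thesis by simp
      next
        assume "x0 + c' * b \<in> (\<lambda>b. x0 + c' * b) ` setof (y ! j)"
        then obtain b1 where 1: "b1 \<in> setof (y ! j)" "x0 + c' * b = x0 + c' * b1" by blast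
        have "mem b1 A'" using 1(1) A' j by blast
        then have "b = b1" using inj[OF 1(2) T'x T'x] b by blast
        with 1 show ?thesis by simp
      qed
    next
      assume b: "b \<in> setof (y ! j)"
      then have "mem b A'" using A' j by blast
      moreover have "x0 + c' * b \<in> ?S j" using b by blast
      ultimately show "mem b A' \<and> mem (x0 + c' * b) (Sf j)" by (simp only: memS)
    qed
    then show ?thesis by (simp add: fibset_def)
  qed
  ultimately show ?thesis using x0 T'
    by (intro exI[of _ x0] exI[of _ c'] exI[of _ T'] exI[of _ A'] exI[of _ "map Sf [0..<length y]"]) auto
qed

text \<open>The power set is the sort of codes, two codes being identified when the tuples they
  represent have the same images under the cover \<open>f\<close>. Insertion of one element is
  \<open>extend_code\<close>; unions are then obtained from insertion by induction, without
  combining two codes directly.\<close>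

lemma fpow_tuples:
  assumes ne: "tuples (Keq mem) Ss \<noteq> {}"
  shows "\<exists>W E. is_fpow (Keq mem) (tuples (Keq mem) Ss) W E"
proof -
  let ?T0 = "tuples (Keq mem) Ss"
  obtain hs f where "Q.cover Ss hs f" using Q.cover_ex ne unfolding Keq_def by blast
  then have f: "f ` tuples HS hs = ?T0"
    and fd: "Q.H.dfn [tuples HS hs, tuples HS hs] (\<lambda>e. f (e 0) = f (e (Suc 0)))"
    and Gf: "dset {map Home x @ f x | x. x \<in> tuples HS hs}"
    unfolding Q.cover_def Keq_def by blast+
  define m where "m = length hs"
  let ?h = "tuples HS hs" and ?c = "tuples HS (csorts m)"
  let ?Gf = "{map Home x @ f x | x. x \<in> ?h}"
  have psi: "Q.H.dfn [?h, ?c] (\<lambda>e. psi hs (e 0) (e (Suc 0)))" using dfn_psi by (simp add: m_def)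
  define cset where "cset cd = f ` {y \<in> ?h. psi hs y cd}" for cd
  have csetT: "cset cd \<subseteq> ?T0" for cd using f unfolding cset_def by blast
  \<comment> \<open>Equality of the represented sets, expressed through home representatives: the
    equivalence relation of a new sort must be a parameter-free formula of the home
    structure.\<close>
  define P where "P cd cd' \<longleftrightarrow> (\<forall>y\<in>?h. (\<exists>y'\<in>?h. f y = f y' \<and>
      psi hs y' cd) \<longleftrightarrow> (\<exists>y'\<in>?h. f y = f y' \<and> psi hs y' cd'))" for cd cd'
  have P: "P cd cd' \<longleftrightarrow> cset cd = cset cd'" for cd cd'
  proof
    assume p: "P cd cd'"
    show "cset cd = cset cd'"
    proof (intro equalityI subsetI)
      fix v assume "v \<in> cset cd"
      then obtain y where y: "v = f y" "y \<in> ?h" "psi hs y cd" unfolding cset_def by blast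
      then obtain y' where "y' \<in> ?h" "f y = f y'" "psi hs y' cd'" using p unfolding P_def by blast
      then show "v \<in> cset cd'" using y unfolding cset_def by blast
    next
      fix v assume "v \<in> cset cd'"
      then obtain y where y: "v = f y" "y \<in> ?h" "psi hs y cd'" unfolding cset_def by blast
      then obtain y' where "y' \<in> ?h" "f y = f y'" "psi hs y' cd" using p unfolding P_def by blast
      then show "v \<in> cset cd" using y unfolding cset_def by blast
    qed
  next
    have *: "(\<exists>y'\<in>?h. f y = f y' \<and> psi hs y' cd) \<longleftrightarrow> f y \<in> cset cd"
        for y cd
      unfolding cset_def by blast
    assume "cset cd = cset cd'"
    then show "P cd cd'" unfolding P_def * by simp
  qed
  have "Q.H.dfn [?c, ?c] (\<lambda>e. P (e 0) (e (Suc 0)))"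
    unfolding P_def
    by (intro Q.H.dfn_ball Q.H.dfn_bex Q.H.dfn_iff Q.H.dfn_conj Q.H.dfn_comp2[OF fd] Q.H.dfn_comp2[OF psi]
      Q.H.dfn_term_var Q.H.dset_tuples) auto
  moreover have "equiv ?c {(x, y). x \<in> ?c \<and> y \<in> ?c \<and> P x y}"
    unfolding P by (auto intro!: equivI refl_onI symI transI)
  ultimately obtain W cl where W: "dset W" "cl ` ?c = W" and cl: "\<And>x y. x \<in> ?c \<Longrightarrow>
      y \<in> ?c \<Longrightarrow> cl x = cl y \<longleftrightarrow> P x y"
    and Gc: "dset {map Home x @ cl x | x. x \<in> ?c}"
    using Q.quotient_cover[of "csorts m" P] unfolding Keq_def by blast
  let ?Gc = "{map Home x @ cl x | x. x \<in> ?c}"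
  define E where "E = {(f y, cl cd) | y cd. y \<in> ?h \<and> cd \<in> ?c \<and> psi hs y cd}"
  have extE: "ext E (cl cd) = cset cd" if cd: "cd \<in> ?c" for cd
  proof (intro equalityI subsetI)
    fix v assume "v \<in> ext E (cl cd)"
    then obtain y cd' where y: "v = f y" "cl cd = cl cd'" "y \<in> ?h" "cd' \<in> ?c" "psi hs y cd'"
      unfolding ext_def E_def by blast
    then have "v \<in> cset cd'" unfolding cset_def by blast
    then show "v \<in> cset cd" using cl[OF cd y(4)] y(2) P by simp
  next
    fix v assume "v \<in> cset cd"
    then show "v \<in> ext E (cl cd)" using cd unfolding ext_def E_def cset_def by blast
  qed
  have EW: "\<exists>cd\<in>?c. B = cl cd \<and> ext E B = cset cd" if "B \<in> W" for B
    using that W(2) extE by (metis imageE)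
  have ET: "E \<subseteq> ?T0 \<times> W" unfolding E_def using f W(2) by blast
  let ?Hh = "map Home ` ?h" and ?Hc = "map Home ` ?c"
  have dH: "dset ?Hh" "dset ?Hc" using Q.dset_hdom unfolding Keq_def by blast+
  have Dp: "dset {map Home x @ map Home y | x y. x \<in> ?h \<and> y \<in> ?c \<and> psi hs x y}"
    using Q.dfn_home[OF psi] unfolding Keq_def by simp
  let ?Dp = "{map Home x @ map Home y | x y. x \<in> ?h \<and> y \<in> ?c \<and>
      psi hs x y} :: ('k, 'f) elt set"
  have "dfn [?T0, W] (\<lambda>e. \<exists>y\<in>?Hh. \<exists>cd\<in>?Hc. y @ e 0 \<in> ?Gf \<and>
      cd @ e (Suc 0) \<in> ?Gc \<and> y @ cd \<in> ?Dp)"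
    by (intro dfn_bex dfn_conj dH dfn_mem[OF Gf, where Z = "times_set ?Hh ?T0"]
      dfn_mem[OF Gc, where Z = "times_set ?Hc W"] dfn_mem[OF Dp, where Z = "times_set ?Hh ?Hc"]
          dfn_term_append dfn_term_var)
      (use W dH in auto)
  then have dpE: "dfn [?T0, W] (\<lambda>e. (e 0, e (Suc 0)) \<in> E)"
  proof (rule dfn_congI)
    fix e :: "nat \<Rightarrow> ('k, 'f) elt"
    show "((e 0, e (Suc 0)) \<in> E) = (\<exists>y\<in>?Hh. \<exists>cd\<in>?Hc. y @ e 0 \<in> ?Gf \<and>
        cd @ e (Suc 0) \<in> ?Gc \<and> y @ cd \<in> ?Dp)"
    proof
      assume "(e 0, e (Suc 0)) \<in> E"
      then obtain y cd where "e 0 = f y" "e (Suc 0) = cl cd" "y \<in> ?h" "cd \<in> ?c" "psi hs y cd"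
          unfolding E_def by blast
      then show "\<exists>y\<in>?Hh. \<exists>cd\<in>?Hc. y @ e 0 \<in> ?Gf \<and>
          cd @ e (Suc 0) \<in> ?Gc \<and> y @ cd \<in> ?Dp"
        by (intro bexI[of _ "map Home y"] bexI[of _ "map Home cd"]) blast+
    next
      assume "\<exists>y\<in>?Hh. \<exists>cd\<in>?Hc. y @ e 0 \<in> ?Gf \<and>
          cd @ e (Suc 0) \<in> ?Gc \<and> y @ cd \<in> ?Dp"
      then obtain y cd where yc: "y \<in> ?h" "cd \<in> ?c" "map Home y @ e 0 \<in> ?Gf"
          "map Home cd @ e (Suc 0) \<in> ?Gc"
        "map Home y @ map Home cd \<in> ?Dp" by blast
      obtain y1 where y1: "map Home y @ e 0 = map Home y1 @ f y1" "y1 \<in> ?h" using yc(3) by blast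
      obtain c1 where c1: "map Home cd @ e (Suc 0) = map Home c1 @ cl c1" "c1 \<in> ?c" using yc(4) by blast
      obtain y2 c2 where y2: "(map Home y :: ('k, 'f) elt) @ map Home cd = map Home y2 @ map Home c2"
          "y2 \<in> ?h" "c2 \<in> ?c" "psi hs y2 c2"
        using yc(5) by blast
      have ly: "length y = length y1" "length y = length y2" "length cd = length c1" "length cd = length c2"
        using yc(1,2) y1(2) c1(2) y2(2,3) by (simp_all add: tuples_length)
      have "(map Home y :: ('k, 'f) elt) = map Home y2 \<and> (map Home cd :: ('k, 'f) elt) = map Home c2"
          using y2(1) ly by simp
      then have "y = y2" "cd = c2" using map_Home_inj by blast+
      moreover have "(map Home y :: ('k, 'f) elt) = map Home y1 \<and> e 0 = f y1" using y1(1) ly by simp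
      moreover have "(map Home cd :: ('k, 'f) elt) = map Home c1 \<and> e (Suc 0) = cl c1" using c1(1) ly
          by simp
      ultimately show "(e 0, e (Suc 0)) \<in> E" using y2 yc unfolding E_def map_Home_inj by blast
    qed
  qed
  have rE: "definable_rel (Keq mem) E"
    unfolding definable_rel_def definable_iff by (rule iffD2[OF dset_rel dpE]) (use W ET in auto)
  have dpext: "dfn \<Gamma> (\<lambda>e. t e \<in> ext E (b e))" if "dfn_term \<Gamma> ?T0 t"
      "dfn_term \<Gamma> W b" for \<Gamma> t b
    unfolding ext_def mem_Collect_eq
    by (rule dfn_comp2[where P = "\<lambda>x b. (x, b) \<in> E", OF dpE that])
  have codeE: "code c T A Sl \<in> ?c" if "length Sl = m" for c T A Sl using that by (auto simp: tuples_csorts)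
  have mem_cset: "v \<in> cset (code c T A Sl) \<longleftrightarrow> (\<exists>y\<in>?h. v = f y \<and>
      (\<exists>x. mem x T \<and> matches y c A Sl x))"
    if "length Sl = m" for v c T A Sl
    unfolding cset_def using psi_code[of _ hs Sl c T A] that by (auto simp: m_def)
  have inj: "B = C \<longleftrightarrow> ext E B = ext E C" if BC: "B \<in> W" "C \<in> W" for B C
  proof -
    obtain cd where cd: "cd \<in> ?c" "B = cl cd" "ext E B = cset cd" using EW[OF BC(1)] by blast
    obtain cd' where cd': "cd' \<in> ?c" "C = cl cd'" "ext E C = cset cd'" using EW[OF BC(2)] by blast
    show ?thesis using cl[OF cd(1) cd'(1)] P cd cd' by simp
  qed
  have emp: "ext E (cl (code c T A Sl)) = {}" if "length Sl = m" "{x. mem x T} = {}" for c T A Sl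
    using extE[OF codeE[OF that(1)]] mem_cset[OF that(1)] that(2) by blast
  have ins: "\<exists>D\<in>W. ext E D = insert v (ext E B)" if B: "B \<in> W" and v: "v \<in> ?T0" for B v
  proof -
    obtain cd where cd: "cd \<in> ?c" "B = cl cd" "ext E B = cset cd" using EW[OF B] by blast
    obtain c T A Sl where code: "length Sl = m" "cd = code c T A Sl" using cd(1) unfolding tuples_csorts
        by blast
    obtain y where y: "y \<in> ?h" "v = f y" using v unfolding f[symmetric] by (rule imageE) simp
    have ly: "length Sl = length y" using code y by (simp add: tuples_length m_def)
    from extend_code[OF ly] obtain x0 c' T' A' Sl' where
      e: "length Sl' = length y" "{x. mem x T'} = insert x0 {x. mem x T}" "\<not> mem x0 T"
        "\<And>x j. mem x T \<Longrightarrow> j < length y \<Longrightarrow>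
            fibset c' A' (Sl' ! j) x = fibset c A (Sl ! j) x"
        "\<And>j. j < length y \<Longrightarrow> fibset c' A' (Sl' ! j) x0 = setof (y ! j)" by metis
    have l': "length Sl' = m" using e(1) ly code by simp
    have lz: "length z = length y" if "z \<in> ?h" for z using that y by (simp add: tuples_length)
    have m1: "matches z c' A' Sl' x \<longleftrightarrow> matches z c A Sl x" if "z \<in> ?h" "mem x T" for z x
      using e(4) that lz unfolding matches_def by simp
    have m2: "matches z c' A' Sl' x0 \<longleftrightarrow> z = y" if "z \<in> ?h" for z
    proof -
      have "matches y c' A' Sl' x0" using e(5) unfolding matches_def by simp
      then show ?thesis using matches_unique[OF that y(1)] by blast
    qed
    have "u \<in> cset (code c' T' A' Sl') \<longleftrightarrow> u = v \<or> u \<in> cset (code c T A Sl)" for u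
    proof -
      have mT: "mem x T' \<longleftrightarrow> x = x0 \<or> mem x T" for x using e(2) by blast
      have "u \<in> cset (code c' T' A' Sl') \<longleftrightarrow> (\<exists>z\<in>?h. u = f z \<and>
          (matches z c' A' Sl' x0 \<or> (\<exists>x. mem x T \<and> matches z c' A' Sl' x)))"
        unfolding mem_cset[OF l'] mT by blast
      also have "\<dots> \<longleftrightarrow> (\<exists>z\<in>?h. u = f z \<and> (z = y \<or>
          (\<exists>x. mem x T \<and> matches z c A Sl x)))"
        using m1 m2 by (metis (no_types, lifting))
      also have "\<dots> \<longleftrightarrow> u = v \<or> u \<in> cset (code c T A Sl)"
        unfolding mem_cset[OF code(1)] using y by blast
      finally show ?thesis .
    qed
    then have "ext E (cl (code c' T' A' Sl')) = insert v (ext E B)"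
      unfolding extE[OF codeE[OF l']] cd(3) code(2) by blast
    moreover have "cl (code c' T' A' Sl') \<in> W" using W(2) codeE[OF l'] by blast
    ultimately show ?thesis by blast
  qed
  have empW: "\<exists>B\<in>W. ext E B = {}"
  proof -
    obtain T where T: "{x. mem x T} = {}" using hfin_field_empty unfolding hfin_field_def by blast
    have "length (replicate m T) = m" by simp
    from emp[OF this T] W(2) codeE[OF this] show ?thesis by blast
  qed
  have ind: "U = W" if U: "U \<subseteq> W" "dset U" "\<And>B. B \<in> W \<Longrightarrow>
      ext E B = {} \<Longrightarrow> B \<in> U"
    "\<And>B x C. B \<in> U \<Longrightarrow> x \<in> ?T0 \<Longrightarrow> C \<in> W \<Longrightarrow>
        ext E C = insert x (ext E B) \<Longrightarrow> C \<in> U" for U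
  proof -
    have main: "cl (code c (unfl b) A Sl) \<in> U" if l: "length Sl = m" and b: "b \<in> FinU" for c b A Sl
    proof (rule fp_induct[OF fpK b, where P = "\<lambda>b. cl (code c (unfl b) A Sl) \<in> U"])
      define z :: "('k, 'f) elt" where "z = map Home ([Inr A] @ map Inr Sl)"
      let ?Z = "tuples (Keq mem) (map HomeS ([FinS] @ replicate m FinS))"
      have "length (A # Sl) = Suc m" using l by simp
      then have "map Inr (A # Sl) \<in> tuples HS (replicate (Suc m) FinS)" unfolding tuples_FinS by blast
      then have "[Inr A] @ map Inr Sl \<in> tuples HS ([FinS] @ replicate m FinS)"
        by simp
      then have z: "z \<in> ?Z" unfolding z_def Keq_def tuples_map_Home by blast
      \<comment> \<open>Inside this proof the name denotes a decomposition of the code that isolates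
        the hyperfinite set \<open>F\<close>; the other components \<open>c\<close> and
        \<open>z\<close> become parameters, and the predicate is a definable one of \<open>F\<close>
        alone.\<close>
      have char_zero: "map Home (code c F A Sl) = el c @ (fl F @ z)" for F
          by (simp add: code_def z_def el_def fl_def)
      have "dfn [FinU] (\<lambda>e. \<exists>w\<in>U. el c @ (e 0 @ (z @ w)) \<in> ?Gc)"
        by (intro dfn_bex U(2) dfn_mem[OF Gc, where Z = "times_set FieldU (times_set FinU (times_set ?Z U))"]
            dfn_term_append
          dfn_term_var dfn_term_const') (use U(2) z in auto)
      then show "dfn [FinU] (\<lambda>e. cl (code c (unfl (e 0)) A Sl) \<in> U)"
      proof (rule dfn_congI)
        fix e assume "env [FinU] e"
        then obtain F where F: "e 0 = fl F" by (auto simp: env_Cons)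
        show "(cl (code c (unfl (e 0)) A Sl) \<in> U) = (\<exists>w\<in>U. el c @ (e 0 @ (z @ w)) \<in> ?Gc)"
        proof
          assume "cl (code c (unfl (e 0)) A Sl) \<in> U"
          moreover have "map Home (code c F A Sl) @ cl (code c F A Sl) \<in> ?Gc" using codeE[OF l] by blast
          ultimately show "\<exists>w\<in>U. el c @ (e 0 @ (z @ w)) \<in> ?Gc" using F char_zero
              by (intro bexI[of _ "cl (code c F A Sl)"]) simp_all
        next
          assume "\<exists>w\<in>U. el c @ (e 0 @ (z @ w)) \<in> ?Gc"
          then obtain w x where w: "w \<in> U" "el c @ (fl F @ (z @ w)) = map Home x @ cl x" "x \<in> ?c"
              unfolding F by blast
          then have "map Home (code c F A Sl) @ w = map Home x @ cl x" using char_zero by simp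
          moreover have "length (code c F A Sl) = length x"
              using tuples_length[OF codeE[OF l]] tuples_length[OF w(3)] by simp
          ultimately have "map Home (code c F A Sl) = (map Home x :: ('k, 'f) elt)" "w = cl x" by simp_all
          then have "code c F A Sl = x" "w = cl x" using map_Home_inj by blast+
          then show "cl (code c (unfl (e 0)) A Sl) \<in> U" using w(1) F by simp
        qed
      qed
    next
      fix b assume b: "b \<in> FinU" "ext EK b = {}"
      then obtain F where F: "b = fl F" "{x. mem x F} = {}" by (auto simp: ext_EK)
      have "cl (code c F A Sl) \<in> W" using W(2) codeE[OF l] by blast
      then show "cl (code c (unfl b) A Sl) \<in> U" using U(3) emp[OF l F(2)] F(1) by simp
    next
      fix b x b' assume *: "b \<in> FinU" "cl (code c (unfl b) A Sl) \<in> U" "x \<in> FieldU"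
          "b' \<in> FinU" "ext EK b' = insert x (ext EK b)"
      obtain F F' k where F: "b = fl F" "b' = fl F'" "x = el k" using * by blast
      have mF: "mem u F' \<longleftrightarrow> u = k \<or> mem u F" for u
      proof -
        have "mem u F' \<longleftrightarrow> el u \<in> ext EK b'" using F by (simp add: ext_EK)
        also have "\<dots> \<longleftrightarrow> u = k \<or> mem u F" unfolding *(5) using F
            by (simp add: ext_EK)
        finally show ?thesis .
      qed
      let ?C = "code c F A Sl" and ?C' = "code c F' A Sl"
      have CW: "?C \<in> ?c" "?C' \<in> ?c" "cl ?C' \<in> W" using codeE[OF l] W(2) by blast+
      have split: "v \<in> cset ?C' \<longleftrightarrow> v \<in> cset ?C \<or>
          (\<exists>y\<in>?h. v = f y \<and> matches y c A Sl k)" for v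
        unfolding mem_cset[OF l] mF by blast
      have "cl ?C' \<in> U"
      \<comment> \<open>By \<open>matches_unique\<close> the new index \<open>k\<close> contributes
        at most one tuple. If its fibres match no tuple of the right sorts, the represented set and
        hence the class of the code do not change.\<close>
      proof (cases "\<exists>y\<in>?h. matches y c A Sl k")
        case True
        then obtain y where y: "y \<in> ?h" "matches y c A Sl k" by blast
        have "v \<in> cset ?C' \<longleftrightarrow> v \<in> insert (f y) (cset ?C)" for v
          unfolding split using y matches_unique[OF y(1) _ y(2)] by blast
        then have "ext E (cl ?C') = insert (f y) (ext E (cl ?C))" unfolding extE[OF CW(1)] extE[OF CW(2)]
            by blast
        moreover have "f y \<in> ?T0" using f y(1) by blast
        ultimately show ?thesis using U(4)[OF *(2)] F(1) CW(3) by simp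
      next
        case False
        then have "v \<in> cset ?C' \<longleftrightarrow> v \<in> cset ?C" for v unfolding split by blast
        then have "cset ?C' = cset ?C" by blast
        then have "cl ?C' = cl ?C" using cl[OF CW(2,1)] P by simp
        then show ?thesis using *(2) F(1) by simp
      qed
      then show "cl (code c (unfl b') A Sl) \<in> U" using F by simp
    qed
    have "B \<in> U" if BW: "B \<in> W" for B
    proof -
      obtain cd where cd: "cd \<in> ?c" "B = cl cd" using EW[OF BW] by blast
      obtain c T A Sl where code: "length Sl = m" "cd = code c T A Sl" using cd(1) unfolding tuples_csorts
          by blast
      show ?thesis using main[OF code(1), of "fl T" c A] cd code by simp
    qed
    then show ?thesis using U(1) by blast
  qed
  \<comment> \<open>\<open>B\<close> stays fixed as a parameter, and the induction principle just
    established is applied to \<open>C\<close>.\<close>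
  have un: "\<exists>D\<in>W. ext E D = ext E B \<union> ext E C" if B: "B \<in> W" and C: "C \<in> W" for B C
  proof -
    let ?U = "{C\<in>W. \<exists>D\<in>W. \<forall>x\<in>?T0. x \<in> ext E D \<longleftrightarrow>
        x \<in> ext E B \<or> x \<in> ext E C}"
    have sub: "ext E B \<subseteq> ?T0" for B using ET unfolding ext_def by blast
    have "?U = W"
    proof (rule ind)
      show "dset ?U" by (intro dset_Collect dfn_bex dfn_ball dfn_iff dfn_disj dpext dfn_term_var
          dfn_term_const') (use W B in auto)
      show "C \<in> ?U" if "C \<in> W" "ext E C = {}" for C using that B by blast
      show "C' \<in> ?U" if C: "C \<in> ?U" "x \<in> ?T0" "C' \<in> W" "ext E C' = insert x (ext E C)"
          for C x C'
      proof -
        obtain D where D: "D \<in> W" "\<forall>x\<in>?T0. x \<in> ext E D \<longleftrightarrow>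
            x \<in> ext E B \<or> x \<in> ext E C" using C(1) by blast
        obtain D' where D': "D' \<in> W" "ext E D' = insert x (ext E D)" using ins[OF D(1) C(2)] by blast
        have "\<forall>u\<in>?T0. u \<in> ext E D' \<longleftrightarrow> u \<in> ext E B \<or>
            u \<in> ext E C'" unfolding D'(2) C(4) using D(2) by blast
        then show ?thesis using D'(1) C(3) by blast
      qed
    qed blast
    with C obtain D where D: "D \<in> W" "\<forall>x\<in>?T0. x \<in> ext E D \<longleftrightarrow>
        x \<in> ext E B \<or> x \<in> ext E C" by blast
    have "ext E D = ext E B \<union> ext E C" using D(2) sub[of D] sub[of B] sub[of C] by blast
    with D(1) show ?thesis by blast
  qed
  have "is_fpow (Keq mem) ?T0 W E"
    unfolding is_fpow_def
  proof (intro conjI)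
    have sub: "ext E B \<subseteq> ?T0" for B using ET unfolding ext_def by blast
    have mE: "(x, B) \<in> E \<longleftrightarrow> x \<in> ext E B" for x B by (simp add: ext_def)
    show "definable (Keq mem) ?T0" "definable (Keq mem) W" unfolding definable_iff using W by simp_all
    show "E \<subseteq> ?T0 \<times> W" "definable_rel (Keq mem) E" using ET rE by simp_all
    show "\<forall>B\<in>W. \<forall>C\<in>W. (B = C) = (\<forall>x\<in>?T0. ((x, B) \<in> E) = ((x, C) \<in>
        E))"
    proof (intro ballI)
      fix B C assume BC: "B \<in> W" "C \<in> W"
      show "(B = C) = (\<forall>x\<in>?T0. ((x, B) \<in> E) = ((x, C) \<in> E))"
        unfolding inj[OF BC] mE using sub[of B] sub[of C] by blast
    qed
    show "\<exists>B\<in>W. \<forall>x\<in>?T0. (x, B) \<notin> E" unfolding mE using empW by fastforce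
    show "\<forall>a\<in>?T0. \<exists>B\<in>W. \<forall>x\<in>?T0. ((x, B) \<in> E) = (x = a)"
    proof
      fix a assume a: "a \<in> ?T0"
      obtain B where B: "B \<in> W" "ext E B = {}" using empW by blast
      obtain D where "D \<in> W" "ext E D = insert a (ext E B)" using ins[OF B(1) a] by blast
      then show "\<exists>B\<in>W. \<forall>x\<in>?T0. ((x, B) \<in> E) = (x = a)" unfolding mE using B(2)
          by (intro bexI[of _ D]) simp_all
    qed
    show "\<forall>B\<in>W. \<forall>C\<in>W. \<exists>D\<in>W. \<forall>x\<in>?T0. ((x, D) \<in> E) = ((x,
        B) \<in> E \<or> (x, C) \<in> E)"
    proof (intro ballI)
      fix B C assume BC: "B \<in> W" "C \<in> W"
      obtain D where "D \<in> W" "ext E D = ext E B \<union> ext E C" using un[OF BC] by blast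
      then show "\<exists>D\<in>W. \<forall>x\<in>?T0. ((x, D) \<in> E) = ((x, B) \<in> E \<or> (x, C) \<in> E)"
        unfolding mE by (intro bexI[of _ D]) simp_all
    qed
    show "\<forall>U. U \<subseteq> W \<and> definable (Keq mem) U \<and>
        (\<forall>B\<in>W. ext E B = {} \<longrightarrow> B \<in> U) \<and>
        (\<forall>B\<in>U. \<forall>x\<in>?T0. \<forall>C\<in>W. ext E C = ext E B \<union>
            {x} \<longrightarrow> C \<in> U) \<longrightarrow> U = W"
    proof (intro allI impI, elim conjE)
      fix U assume U: "U \<subseteq> W" "definable (Keq mem) U" "\<forall>B\<in>W. ext E B = {}
          \<longrightarrow> B \<in> U"
        "\<forall>B\<in>U. \<forall>x\<in>?T0. \<forall>C\<in>W. ext E C = ext E B \<union>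
            {x} \<longrightarrow> C \<in> U"
      show "U = W"
      proof (rule ind[OF U(1)])
        show "dset U" using U(2) by (simp add: definable_iff)
        show "B \<in> U" if "B \<in> W" "ext E B = {}" for B using that U(3) by simp
        show "C \<in> U" if "B \<in> U" "x \<in> ?T0" "C \<in> W" "ext E C = insert x (ext E B)" for B x C
          using U(4) that by simp
      qed
    qed
  qed
  then show ?thesis by blast
qed

text \<open>A non-empty \<open>V\<close> inherits its power set from the surrounding product of
  sorts. For empty \<open>V\<close> that product may be empty and have no cover, so a one-point
  power set, coding the empty set by the empty tuple, is given by hand.\<close>

lemma fpow_ex:
  assumes V: "dset V"
  shows "\<exists>W E. is_fpow (Keq mem) V W E"
proof (cases "V = {}")
  case True
  have e: "dset {[]}" using dset_tuples[of "[]"] by simp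
  have "is_fpow (Keq mem) V {[]} {}"
    unfolding is_fpow_def definable_rel_def definable_iff ext_def using True e by auto
  then show ?thesis by blast
next
  case False
  obtain Ss where "V \<subseteq> tuples (Keq mem) Ss" using V by (auto simp: dset_def)
  moreover obtain W E where "is_fpow (Keq mem) (tuples (Keq mem) Ss) W E" using fpow_tuples False calculation
      by blast
  ultimately show ?thesis using fp_subset V by blast
qed

end

section \<open>Hyperfinite sets, natural numbers and the lemma of Dickson\<close>

context hf_field
begin

section \<open>The chosen power sets and their hyperfinite sets\<close>

abbreviation FP :: "('k, 'f) elt set \<Rightarrow> ('k, 'f) elt set" where "FP \<equiv> fpow (Keq mem)"
abbreviation elems :: "('k, 'f) elt set \<Rightarrow> ('k, 'f) elt \<Rightarrow> ('k, 'f) elt set"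
    where "elems \<equiv> fext (Keq mem)"
abbreviation NatU :: "('k, 'f) elt set" where "NatU \<equiv> el ` NN mem"

text \<open>As every definable set has a power set, the arbitrary choice behind \<open>fpow\<close>
  does satisfy the axioms.\<close>

lemma fpow_FP: "dset V \<Longrightarrow> is_fpow (Keq mem) V (FP V) (snd (fpow_pair (Keq mem) V))"
proof -
  assume "dset V"
  then obtain W E where "is_fpow (Keq mem) V W E" using fpow_ex by blast
  then have "case (W, E) of (W, E) \<Rightarrow> is_fpow (Keq mem) V W E" by simp
  then have "case fpow_pair (Keq mem) V of (W, E) \<Rightarrow> is_fpow (Keq mem) V W E"
    unfolding fpow_pair_def by (rule someI)
  then show ?thesis by (simp add: fpow_def case_prod_beta)
qed

lemma elems_eq_ext: "elems V b = ext (snd (fpow_pair (Keq mem) V)) b"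
  by (simp add: fext_def)

lemma dset_FP [simp]: "dset V \<Longrightarrow> dset (FP V)"
  using fp_dset[OF fpow_FP] by blast

lemma elems_sub: "dset V \<Longrightarrow> elems V b \<subseteq> V"
  unfolding elems_eq_ext using fp_ext[OF fpow_FP] .

lemma elems_inj: "dset V \<Longrightarrow> b \<in> FP V \<Longrightarrow> c \<in> FP V \<Longrightarrow>
    elems V b = elems V c \<Longrightarrow> b = c"
  unfolding elems_eq_ext using fp_inj[OF fpow_FP] by blast

lemma dfn_elems: "dfn_term \<Gamma> V t \<Longrightarrow> dfn_term \<Gamma> (FP V) b \<Longrightarrow>
    dfn \<Gamma> (\<lambda>e. t e \<in> elems V (b e))"
  unfolding elems_eq_ext by (rule fp_dfn[OF fpow_FP]) (simp_all add: dfn_term_dset)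

lemma dfn_ball_elems:
  assumes V: "dset V" and b: "dfn_term \<Gamma> (FP V) b" and P: "dfn (V # \<Gamma>) (\<lambda>e. P (e 0)
      (\<lambda>i. e (Suc i)))"
  shows "dfn \<Gamma> (\<lambda>e. \<forall>x\<in>elems V (b e). P x e)"
proof -
  have "dfn \<Gamma> (\<lambda>e. \<forall>x\<in>V. x \<in> elems V (b e) \<longrightarrow> P x e)"
    by (intro dfn_ball V dfn_imp P dfn_elems dfn_term_var dfn_term_weaken[OF b]) (use V in auto)
  then show ?thesis by (rule dfn_congI) (use elems_sub[OF V] in blast)
qed

lemma dfn_bex_elems:
  assumes V: "dset V" and b: "dfn_term \<Gamma> (FP V) b" and P: "dfn (V # \<Gamma>) (\<lambda>e. P (e 0)
      (\<lambda>i. e (Suc i)))"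
  shows "dfn \<Gamma> (\<lambda>e. \<exists>x\<in>elems V (b e). P x e)"
proof -
  have "dfn \<Gamma> (\<lambda>e. \<exists>x\<in>V. x \<in> elems V (b e) \<and> P x e)"
    by (intro dfn_bex V dfn_conj P dfn_elems dfn_term_var dfn_term_weaken[OF b]) (use V in auto)
  then show ?thesis by (rule dfn_congI) (use elems_sub[OF V] in blast)
qed

text \<open>Hyperfiniteness relative to an ambient definable set and its chosen power set; by
  \<open>hfin_mono\<close> another ambient set containing \<open>S\<close> gives the same
  notion.\<close>

definition hfin :: "('k, 'f) elt set \<Rightarrow> ('k, 'f) elt set \<Rightarrow> bool" where
  "hfin V S \<longleftrightarrow> (\<exists>b\<in>FP V. elems V b = S)"

lemma hfin_elems [simp]: "b \<in> FP V \<Longrightarrow> hfin V (elems V b)"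
  by (auto simp: hfin_def)

lemma hfin_sub: "dset V \<Longrightarrow> hfin V S \<Longrightarrow> S \<subseteq> V"
  unfolding hfin_def using elems_sub by blast

lemma hfin_empty [simp]: "dset V \<Longrightarrow> hfin V {}"
  unfolding hfin_def elems_eq_ext using fp_empty[OF fpow_FP] by simp

lemma hfin_Un: "dset V \<Longrightarrow> hfin V S \<Longrightarrow> hfin V T \<Longrightarrow>
    hfin V (S \<union> T)"
  unfolding hfin_def elems_eq_ext using fp_Un[OF fpow_FP] by blast

lemma hfin_single: "dset V \<Longrightarrow> x \<in> V \<Longrightarrow> hfin V {x}"
  unfolding hfin_def elems_eq_ext using fp_single[OF fpow_FP] by blast

lemma hfin_insert: "dset V \<Longrightarrow> hfin V S \<Longrightarrow> x \<in> V \<Longrightarrow>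
    hfin V (insert x S)"
  using hfin_Un[OF _ hfin_single, of V x S] by simp

lemma hfin_bind:
  assumes "dset V" "dset V'" "hfin V S" "dfn [V, V'] (\<lambda>e. R (e 0) (e (Suc 0)))"
    "\<And>x. x \<in> S \<Longrightarrow> hfin V' {y\<in>V'. R x y}"
  shows "hfin V' {y\<in>V'. \<exists>x\<in>S. R x y}"
proof -
  obtain b where b: "b \<in> FP V" "ext (snd (fpow_pair (Keq mem) V)) b = S"
    using assms(3) unfolding hfin_def elems_eq_ext by blast
  have "\<exists>a\<in>FP V'. ext (snd (fpow_pair (Keq mem) V')) a =
      {y\<in>V'. \<exists>x\<in>ext (snd (fpow_pair (Keq mem) V)) b. R x y}"
    by (rule fp_bind[OF fpow_FP[OF assms(1)] fpow_FP[OF assms(2)] b(1) assms(4)])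
      (use assms(5) b in \<open>auto simp: hfin_def elems_eq_ext\<close>)
  then show ?thesis unfolding hfin_def elems_eq_ext b(2) .
qed

lemma hfin_sep:
  assumes "dset V" "hfin V S" "dfn [V] (\<lambda>e. P (e 0))"
  shows "hfin V {x\<in>S. P x}"
proof -
  obtain b where b: "b \<in> FP V" "ext (snd (fpow_pair (Keq mem) V)) b = S"
    using assms(2) unfolding hfin_def elems_eq_ext by blast
  show ?thesis using fp_sep[OF fpow_FP[OF assms(1)] b(1) assms(3)] unfolding hfin_def elems_eq_ext b(2) .
qed

lemma hfin_image:
  assumes V: "dset V" "dset V'" and S: "hfin V S" and f: "dfn_term [V] V' (\<lambda>e. f (e 0))"
  shows "hfin V' (f ` S)"
proof -
  have fV: "f x \<in> V'" if "x \<in> V" for x using dfn_term_in[OF f, of "\<lambda>_. x"] that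
      by (simp add: env_Cons)
  have "hfin V' {y\<in>V'. \<exists>x\<in>S. y = f x}"
  proof (rule hfin_bind[OF V S])
    show "dfn [V, V'] (\<lambda>e. e (Suc 0) = f (e 0))"
      by (intro dfn_eq[where Y = V' and Z = V'] dfn_term_comp1[OF f] dfn_term_var) (use V in auto)
    fix x assume "x \<in> S"
    then have "f x \<in> V'" using hfin_sub[OF V(1) S] fV by blast
    moreover from this have "{y \<in> V'. y = f x} = {f x}" by blast
    ultimately show "hfin V' {y \<in> V'. y = f x}" using hfin_single[OF V(2)] by simp
  qed
  moreover have "{y\<in>V'. \<exists>x\<in>S. y = f x} = f ` S" using hfin_sub[OF V(1) S] fV by blast
  ultimately show ?thesis by simp
qed

lemma hfin_transfer:
  assumes "dset V" "dset V'" "hfin V S"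
  shows "hfin V' (S \<inter> V')"
proof -
  obtain b where b: "b \<in> FP V" "ext (snd (fpow_pair (Keq mem) V)) b = S"
    using assms(3) unfolding hfin_def elems_eq_ext by blast
  show ?thesis using fp_transfer[OF fpow_FP[OF assms(1)] fpow_FP[OF assms(2)] b(1)]
      unfolding hfin_def elems_eq_ext b(2) .
qed

lemma hfin_mono: "dset V \<Longrightarrow> dset V' \<Longrightarrow> hfin V S \<Longrightarrow>
    S \<subseteq> V' \<Longrightarrow> hfin V' S"
  using hfin_transfer[of V V' S] by (simp add: Int_absorb2)

lemma hfin_induct:
  assumes "dset V" "hfin V S" "dfn [FP V] (\<lambda>e. P (elems V (e 0)))" "P {}"
    "\<And>S x. hfin V S \<Longrightarrow> P S \<Longrightarrow> x \<in> V \<Longrightarrow> P (insert x S)"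
  shows "P S"
proof -
  obtain b where b: "b \<in> FP V" "elems V b = S" using assms(2) unfolding hfin_def by blast
  have "P (elems V b)"
    by (rule fp_induct[OF fpow_FP[OF assms(1)] b(1), where P = "\<lambda>b. P (elems V b)"])
      (use assms(3-) in \<open>auto simp: elems_eq_ext[symmetric]\<close>)
  then show ?thesis by (simp add: b)
qed

lemma hfin_dset: "dset V \<Longrightarrow> hfin V S \<Longrightarrow> dset S"
proof -
  assume V: "dset V" and "hfin V S"
  then obtain b where b: "b \<in> FP V" "elems V b = S" unfolding hfin_def by blast
  have "dset {x\<in>V. x \<in> elems V b}" by (intro dset_Collect V dfn_elems dfn_term_var dfn_term_const')
      (use V b in auto)
  moreover have "{x\<in>V. x \<in> elems V b} = S" using b elems_sub[OF V] by blast
  ultimately show ?thesis by simp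
qed

text \<open>The notion \<open>hyperfinite\<close> asks for a power set of \<open>S\<close> itself;
  changing the ambient set from \<open>V\<close> to \<open>S\<close> provides it.\<close>

lemma hfin_hyperfinite: "dset V \<Longrightarrow> hfin V S \<Longrightarrow> hyperfinite (Keq mem) S"
proof -
  assume V: "dset V" and S: "hfin V S"
  have "hfin S S" using hfin_mono[OF V hfin_dset[OF V S] S] by simp
  then show ?thesis unfolding hyperfinite_def hfin_def elems_eq_ext using fpow_FP[OF hfin_dset[OF V S]] by blast
qed

section \<open>Induction and order in the non-standard natural numbers\<close>

lemma dsetNN [simp]: "dset NatU"
proof -
  have "dset (el ` {x. \<exists>F. mem x F \<and> (\<forall>z. mem z F \<longrightarrow>
      z \<noteq> 0 \<longrightarrow> mem (z - 1) F)} :: ('k, 'f) elt set)"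
    by (intro dset_Collectk dfn_exf dfn_intros dfn_fmem dfn_field_intros dfn_fin_var) auto
  then show ?thesis by (simp add: K0_def)
qed

lemma NN_iff: "x \<in> NN mem \<longleftrightarrow> (\<exists>S. hfin_field S \<and> x \<in> S \<and>
    (\<forall>z\<in>S. z \<noteq> 0 \<longrightarrow> z - 1 \<in> S))"
proof
  assume "x \<in> NN mem"
  then obtain F where F: "mem x F" "\<forall>z. mem z F \<longrightarrow> z \<noteq> 0 \<longrightarrow>
      mem (z - 1) F" unfolding K0_def by blast
  then show "\<exists>S. hfin_field S \<and> x \<in> S \<and>
      (\<forall>z\<in>S. z \<noteq> 0 \<longrightarrow> z - 1 \<in> S)"
    by (intro exI[of _ "{x. mem x F}"]) simp
next
  assume "\<exists>S. hfin_field S \<and> x \<in> S \<and> (\<forall>z\<in>S. z \<noteq> 0 \<longrightarrow>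
      z - 1 \<in> S)"
  then obtain F where F: "mem x F" "\<forall>z\<in>{x. mem x F}. z \<noteq> 0 \<longrightarrow>
      z - 1 \<in> {x. mem x F}"
    unfolding hfin_field_def by blast
  then show "x \<in> NN mem" unfolding K0_def mem_Collect_eq by (intro exI[of _ F]) simp
qed

lemma NN_0 [simp]: "0 \<in> NN mem"
  unfolding NN_iff by (rule exI[of _ "{0}"]) simp

lemma NN_Suc: "x \<in> NN mem \<Longrightarrow> x + 1 \<in> NN mem"
proof -
  assume "x \<in> NN mem"
  then obtain S where S: "hfin_field S" "x \<in> S" "\<forall>z\<in>S. z \<noteq> 0 \<longrightarrow>
      z - 1 \<in> S" unfolding NN_iff by blast
  then show ?thesis unfolding NN_iff by (intro exI[of _ "insert (x + 1) S"]) (auto intro: hfin_field_insert)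
qed

lemma NN_1 [simp]: "1 \<in> NN mem" using NN_Suc[OF NN_0] by simp

lemma NN_pred: "x \<in> NN mem \<Longrightarrow> x \<noteq> 0 \<Longrightarrow> x - 1 \<in> NN mem"
  unfolding NN_iff by blast

lemma NN_m1: "- 1 \<notin> NN mem"
  using char_zero by (simp add: def_char_zero_def)

text \<open>
  The counterexamples below a counterexample \<open>x\<close> form a hyperfinite set closed under predecessors;
  its translate by \<open>- x - 1\<close> would witness \<open>- 1 \<in> NN mem\<close>.
\<close>

lemma NN_induct [consumes 1, case_names dfn 0 Suc]:
  assumes x: "x \<in> NN mem" and P: "dfn [NatU] (\<lambda>e. P (unel (e 0)))"
    and 0: "P 0" and S: "\<And>y. y \<in> NN mem \<Longrightarrow> P y \<Longrightarrow> P (y + 1)"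
  shows "P x"
proof (rule ccontr)
  assume nP: "\<not> P x"
  obtain S where S': "hfin_field S" "x \<in> S" "\<And>z. z \<in> S \<Longrightarrow>
      z \<noteq> 0 \<Longrightarrow> z - 1 \<in> S" using x unfolding NN_iff by blast
  have "dset {y\<in>NatU. P (unel y)}" by (intro dset_Collect P) simp
  moreover have "{y\<in>NatU. P (unel y)} = el ` {y\<in>NN mem. P y}" by auto
  ultimately have D: "dset (el ` {y\<in>NN mem. P y} :: ('k, 'f) elt set)" by simp
  let ?S = "{y\<in>S. y \<in> NN mem \<and> y \<notin> {y\<in>NN mem. P y}}"
  have hS: "hfin_field ?S" by (intro hfin_field_sep S' dfn_conj dfn_Not dfn_memk D dsetNN dfn_field_var) auto
  have step: "z - 1 \<in> ?S" if z: "z \<in> ?S" for z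
  proof -
    have "z \<noteq> 0" using z 0 by auto
    then have "z - 1 \<in> S" "z - 1 \<in> NN mem" using z S'(3) NN_pred by auto
    moreover have "\<not> P (z - 1)" using S[OF calculation(2)] z by auto
    ultimately show ?thesis by simp
  qed
  have "hfin_field ((\<lambda>z. z - x - 1) ` ?S)" by (intro hfin_field_image hS dfn_intros dfn_field_intros)
      auto
  moreover have "- 1 \<in> (\<lambda>z. z - x - 1) ` ?S" using S'(2) x nP by (intro image_eqI[of _ _ x]) auto
  moreover have "\<forall>z\<in>(\<lambda>z. z - x - 1) ` ?S. z \<noteq> 0 \<longrightarrow>
      z - 1 \<in> (\<lambda>z. z - x - 1) ` ?S"
  proof (intro ballI impI)
    fix w assume "w \<in> (\<lambda>z. z - x - 1) ` ?S"
    then obtain z where z: "z \<in> ?S" "w = z - x - 1" by blast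
    show "w - 1 \<in> (\<lambda>z. z - x - 1) ` ?S" by (rule image_eqI[OF _ step[OF z(1)]]) (simp add: z(2))
  qed
  ultimately have "- 1 \<in> NN mem" unfolding NN_iff by blast
  then show False using NN_m1 by simp
qed

definition nle :: "'k \<Rightarrow> 'k \<Rightarrow> bool" where
  "nle x y \<longleftrightarrow> y - x \<in> NN mem"

lemma dfn_nle: "dfn_field \<Gamma> t \<Longrightarrow> dfn_field \<Gamma> s \<Longrightarrow>
    dfn \<Gamma> (\<lambda>e. nle (t e) (s e))"
  unfolding nle_def by (intro dfn_memk dsetNN dfn_field_diff)

lemmas dfn_nat_intros = dfn_intros dfn_nle dfn_ballk[OF dsetNN] dfn_bexk[OF dsetNN]

lemma NN_add:
  assumes "x \<in> NN mem" "y \<in> NN mem"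
  shows "x + y \<in> NN mem"
  using assms(2)
proof (induction y rule: NN_induct)
  case dfn
  show ?case by (intro dfn_intros dfn_memk dsetNN dfn_field_intros) auto
next
  case (Suc y)
  then have "x + y + 1 \<in> NN mem" by (intro NN_Suc) auto
  then show ?case by (simp add: add.assoc)
qed (use assms(1) in simp)

text \<open>For \<open>x \<noteq> 0\<close> the elements \<open>x - 1\<close> and \<open>- x\<close>
  of \<open>NN mem\<close> would have the sum \<open>- 1\<close>.\<close>

lemma NN_neg: "x \<in> NN mem \<Longrightarrow> - x \<in> NN mem \<Longrightarrow> x = 0"
proof (rule ccontr)
  assume *: "x \<in> NN mem" "- x \<in> NN mem" "x \<noteq> 0"
  then have "x - 1 + - x \<in> NN mem" by (intro NN_add NN_pred)
  then show False using NN_m1 by simp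
qed

lemma nle_refl [simp]: "nle x x" by (simp add: nle_def)

lemma nle_antisym: "nle x y \<Longrightarrow> nle y x \<Longrightarrow> x = y"
  unfolding nle_def using NN_neg[of "y - x"] by simp

lemma nle_trans: "nle x y \<Longrightarrow> nle y z \<Longrightarrow> nle x z"
  unfolding nle_def using NN_add[of "y - x" "z - y"] by simp

lemma nle_0 [simp]: "x \<in> NN mem \<Longrightarrow> nle 0 x" by (simp add: nle_def)

lemma nle_Suc: "nle x (x + 1)" by (simp add: nle_def)

lemma nle_add: "nle (x + z) (y + z) \<longleftrightarrow> nle x y" by (simp add: nle_def)

lemma nle_Suc_iff: "nle x (y + 1) \<longleftrightarrow> nle x y \<or> x = y + 1"
proof
  assume *: "nle x (y + 1)"
  show "nle x y \<or> x = y + 1"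
  proof (cases "y + 1 - x = 0")
    case False
    then have "y + 1 - x - 1 \<in> NN mem" using * unfolding nle_def by (rule NN_pred[rotated])
    then show ?thesis by (simp add: nle_def algebra_simps)
  qed (simp add: algebra_simps)
qed (auto intro: nle_trans nle_Suc)

lemma Suc_nle_iff: "nle (x + 1) y \<longleftrightarrow> nle x y \<and> x \<noteq> y"
proof
  assume *: "nle (x + 1) y"
  have "x \<noteq> y"
  proof
    assume "x = y"
    then show False using * NN_m1 by (simp add: nle_def)
  qed
  then show "nle x y \<and> x \<noteq> y" using * nle_trans[OF nle_Suc] by blast
next
  assume "nle x y \<and> x \<noteq> y"
  then have "y - x - 1 \<in> NN mem" unfolding nle_def by (intro NN_pred) auto
  then show "nle (x + 1) y" by (simp add: nle_def algebra_simps)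
qed

lemma nle_linear:
  assumes "x \<in> NN mem" "y \<in> NN mem"
  shows "nle x y \<or> nle y x"
  using assms(2)
proof (induction y rule: NN_induct)
  case dfn
  show ?case by (intro dfn_nat_intros dfn_field_intros) auto
next
  case (Suc y)
  then show ?case using Suc_nle_iff[of y x] nle_Suc_iff[of x y] by blast
qed (use assms(1) in simp)

lemma not_nle: "x \<in> NN mem \<Longrightarrow> y \<in> NN mem \<Longrightarrow>
    \<not> nle x y \<longleftrightarrow> nle y x \<and> x \<noteq> y"
  using nle_linear nle_antisym by blast

text \<open>Induction on a bound \<open>s\<close> for some member of \<open>S\<close>. Since
  \<open>S\<close> is a fixed definable set, the claim that a member below the bound forces a least
  member is a definable predicate of the bound.\<close>

lemma NN_least:
  assumes S: "dset (el ` S :: ('k, 'f) elt set)" "S \<subseteq> NN mem" "S \<noteq> {}"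
  shows "\<exists>x\<in>S. \<forall>y\<in>S. nle x y"
proof -
  obtain s where s: "s \<in> S" using S by blast
  have "(\<exists>y\<in>S. nle y s) \<longrightarrow> (\<exists>x\<in>S. \<forall>y\<in>S. nle x y)"
    using subsetD[OF S(2) s]
  proof (induction s rule: NN_induct)
    case dfn
    show ?case by (intro dfn_intros dfn_nle dfn_bexk[OF S(1)] dfn_const dfn_field_intros) auto
  next
    case 0
    show ?case using S(2) nle_0 nle_antisym by (metis subsetD)
  next
    case (Suc n)
    show ?case
    proof (cases "\<exists>y\<in>S. nle y n")
      case False
      then have ge: "nle (n + 1) y" if "y \<in> S" for y
        using that Suc.hyps S(2) not_nle[of y n] Suc_nle_iff[of n y] by blast
      show ?thesis
      proof
        assume "\<exists>y\<in>S. nle y (n + 1)"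
        then obtain y where y: "y \<in> S" "nle y (n + 1)" by blast
        then have "y = n + 1" using ge nle_antisym by blast
        then show "\<exists>x\<in>S. \<forall>y\<in>S. nle x y" using y ge by blast
      qed
    qed (use Suc in blast)
  qed
  then show ?thesis using s nle_refl by blast
qed

section \<open>Initial segments and bounds\<close>

lemma dset_seg [simp]: "dset (el ` seg mem n :: ('k, 'f) elt set)"
proof -
  have "dset (el ` {i. i \<in> NN mem \<and> n - i \<in> NN mem \<and> i \<noteq> n} :: ('k, 'f) elt set)"
    by (intro dset_Collectk dfn_intros dfn_memk dsetNN dfn_field_intros) auto
  then show ?thesis by (simp add: seg_def)
qed

lemma seg_iff: "i \<in> seg mem n \<longleftrightarrow> i \<in> NN mem \<and> nle i n \<and> i \<noteq> n"
  by (simp add: seg_def nle_def)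

lemma seg_NN: "i \<in> seg mem n \<Longrightarrow> i \<in> NN mem" by (simp add: seg_iff)

lemma seg_0 [simp]: "seg mem 0 = {}"
  using nle_antisym nle_0 by (auto simp: seg_iff)

lemma seg_Suc: "n \<in> NN mem \<Longrightarrow> seg mem (n + 1) = insert n (seg mem n)"
  using nle_Suc_iff[of _ n] Suc_nle_iff[of n n] by (auto simp: seg_iff)

lemma dfn_seg: "dfn_field \<Gamma> t \<Longrightarrow> dfn_field \<Gamma> s \<Longrightarrow>
    dfn \<Gamma> (\<lambda>e. t e \<in> seg mem (s e))"
  unfolding seg_iff by (intro dfn_nat_intros dfn_memk dsetNN)

lemma dfn_ball_seg:
  assumes "dfn_field \<Gamma> s" "dfn (NatU # \<Gamma>) (\<lambda>e. P (unel (e 0)) (\<lambda>i. e (Suc i)))"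
  shows "dfn \<Gamma> (\<lambda>e. \<forall>i\<in>seg mem (s e). P i e)"
proof -
  have "dfn \<Gamma> (\<lambda>e. \<forall>i\<in>NN mem. i \<in> seg mem (s e) \<longrightarrow> P i e)"
    by (intro dfn_nat_intros assms(2) dfn_seg dfn_field_intros) (use assms(1) in \<open>auto simp:
        dfn_field_def intro!: dfn_term_weaken\<close>)
  then show ?thesis by (rule dfn_congI) (use seg_NN in blast)
qed

lemma dfn_bex_seg:
  assumes "dfn_field \<Gamma> s" "dfn (NatU # \<Gamma>) (\<lambda>e. P (unel (e 0)) (\<lambda>i. e (Suc i)))"
  shows "dfn \<Gamma> (\<lambda>e. \<exists>i\<in>seg mem (s e). P i e)"
  using dfn_Not[OF dfn_ball_seg[OF assms(1), of "\<lambda>i e. \<not> P i e"]] dfn_Not[OF assms(2)] by simp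

lemma hfin_seg: "n \<in> NN mem \<Longrightarrow> hfin NatU (el ` seg mem n)"
proof (induction n rule: NN_induct)
  case dfn
  have "dfn [NatU] (\<lambda>e. \<exists>b\<in>FP NatU. \<forall>i\<in>NN mem. el i \<in> elems NatU b
      \<longleftrightarrow> i \<in> seg mem (unel (e 0)))"
    by (intro dfn_bex dfn_nat_intros dfn_elems dfn_seg dfn_field_intros dfn_term_var dfn_term_sub[OF
        dfn_term_el]) (auto simp: env_Cons)
  then show ?case
  proof (rule dfn_congI)
    fix e
    have "elems NatU b = el ` seg mem n \<longleftrightarrow> (\<forall>i\<in>NN mem. el i \<in> elems NatU b
        \<longleftrightarrow> i \<in> seg mem n)" for b n
      using elems_sub[OF dsetNN, of b] seg_NN by (auto simp: set_eq_iff subset_iff)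
    then show "hfin NatU (el ` seg mem (unel (e 0))) = (\<exists>b\<in>FP NatU. \<forall>i\<in>NN mem. el i
        \<in> elems NatU b \<longleftrightarrow> i \<in> seg mem (unel (e 0)))"
      unfolding hfin_def by simp
  qed
next
  case (Suc n)
  then show ?case by (simp add: seg_Suc hfin_insert)
qed auto

lemma hfin_bound:
  assumes U: "dset U" and B: "hfin U B" and d: "dfn_field [U] (\<lambda>e. d (e 0))"
      and dN: "\<And>u. u \<in> U \<Longrightarrow> d u \<in> NN mem"
  shows "\<exists>J\<in>NN mem. \<forall>b\<in>B. nle (d b) J"
proof (rule hfin_induct[OF U B])
  have d': "dfn_field \<Gamma> (\<lambda>e. d (t e))" if "dfn_term \<Gamma> U t" for \<Gamma> t
    using d that dfn_term_comp1[of U FieldU "\<lambda>u. el (d u)"] by (simp add: dfn_field_def)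
  show "dfn [FP U] (\<lambda>e. \<exists>J\<in>NN mem. \<forall>b\<in>elems U (e 0). nle (d b) J)"
    by (intro dfn_nat_intros dfn_ball_elems U d' dfn_term_var dfn_field_intros) (use U in auto)
next
  fix S x assume S: "\<exists>J\<in>NN mem. \<forall>b\<in>S. nle (d b) J" "x \<in> U"
  then obtain J where J: "J \<in> NN mem" "\<forall>b\<in>S. nle (d b) J" by blast
  \<comment> \<open>The sum serves as a common upper bound of the old bound and the new value, in
    place of a maximum.\<close>
  have "nle (d x) (J + d x)" "nle J (J + d x)" using J(1) dN[OF S(2)] by (simp_all add: nle_def)
  then have "\<forall>b\<in>insert x S. nle (d b) (J + d x)" using J(2) nle_trans by blast
  moreover have "J + d x \<in> NN mem" using NN_add J(1) dN[OF S(2)] by simp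
  ultimately show "\<exists>J\<in>NN mem. \<forall>b\<in>insert x S. nle (d b) J" by blast
qed (auto intro: NN_0)

text \<open>
  The usual induction on the number of variables quantifies over all definable sets. It is
  replaced by an induction on \<open>k\<close> for the subsets of \<open>U\<close> in which the exponents of the variables \<open>x\<^sub>i\<close>,
  \<open>i \<ge> k\<close>, are bounded by a hyperfinite set \<open>s\<close> of pairs \<open>(i, a)\<close>; this is an induction for a single
  definable predicate.
\<close>

lemma dickson:
  fixes d :: "('k, 'f) elt \<Rightarrow> 'k \<Rightarrow> 'k"
  assumes U: "dset U" and d: "\<And>\<Gamma> t s. dfn_term \<Gamma> U t \<Longrightarrow>
      dfn_field \<Gamma> s \<Longrightarrow> dfn_field \<Gamma> (\<lambda>e. d (t e) (s e))"
    and dN: "\<And>u i. u \<in> U \<Longrightarrow> d u i \<in> NN mem" and n: "n \<in> NN mem"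
  shows "\<exists>B. hfin U B \<and> (\<forall>u\<in>U. \<exists>b\<in>B. \<forall>i\<in>seg mem n. nle (d b
      i) (d u i))"
proof -
  let ?S = "times_set NatU NatU"
  have S: "dset ?S" by (intro dset_times) simp_all
  \<comment> \<open>Pairs whose first component is below \<open>k\<close> impose nothing, so one and
    the same \<open>s\<close> can be used for \<open>k\<close> and for \<open>k + 1\<close>.\<close>
  define C where "C k s u \<longleftrightarrow> (\<forall>i\<in>NN mem. \<forall>a\<in>NN mem. el i @ el a
      \<in> s \<longrightarrow> nle k i \<longrightarrow> nle (d u i) a)"
    for k :: 'k and s :: "('k, 'f) elt set" and u
  \<comment> \<open>The bounding set is quantified inside the predicate, because the induction step
    applies the hypothesis to sets \<open>s\<close> modified at the index \<open>k\<close>.\<close>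
  define P where "P k \<longleftrightarrow> (\<forall>s\<in>FP ?S. \<exists>B\<in>FP U. (\<forall>b\<in>elems
      U B. C k (elems ?S s) b) \<and>
     (\<forall>u\<in>U. C k (elems ?S s) u \<longrightarrow> (\<exists>b\<in>elems U B. \<forall>i\<in>seg
         mem k. nle (d b i) (d u i))))" for k
  have dpC: "dfn \<Gamma> (\<lambda>e. C (k e) (elems ?S (s e)) (u e))" if "dfn_field \<Gamma> k"
      "dfn_term \<Gamma> (FP ?S) s" "dfn_term \<Gamma> U u" for \<Gamma> k s u
  proof -
    have "dfn [FieldU, FP ?S, U] (\<lambda>e. C (unel (e 0)) (elems ?S (e (Suc 0))) (e (Suc (Suc 0))))"
      unfolding C_def
      by (intro dfn_nat_intros dfn_elems d dfn_term_append dfn_term_var dfn_field_intros dfn_term_sub[OF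
          dfn_term_el]) (use S U in \<open>auto simp: env_Cons\<close>)
    from dfn_comp3[where P = "\<lambda>k s u. C (unel k) (elems ?S s) u", OF this, of \<Gamma> "\<lambda>e.
        el (k e)" s u] that
    show ?thesis by (simp add: dfn_field_def)
  qed
  have "P n" using n
  proof (induction n rule: NN_induct)
    case dfn
    show ?case
      unfolding P_def
      by (intro dfn_ball dfn_bex dfn_nat_intros dfn_ball_elems dfn_bex_elems dfn_ball_seg dpC d dfn_term_var
          dfn_field_intros) (use S U in auto)
  next
    case 0
    show ?case unfolding P_def
    proof
      fix s
      \<comment> \<open>There is no coordinate to compare yet, so a single element obeying the
        bounds suffices, if there is one.\<close>
      obtain B where B: "hfin U B" "\<forall>b\<in>B. C 0 (elems ?S s) b" "(\<exists>u\<in>U. C 0 (elems ?S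
          s) u) \<longrightarrow> B \<noteq> {}"
      proof (cases "\<exists>u\<in>U. C 0 (elems ?S s) u")
        case True
        then obtain u where "u \<in> U" "C 0 (elems ?S s) u" by blast
        then show ?thesis using that[of "{u}"] hfin_single[OF U] by simp
      qed (use that[of "{}"] hfin_empty[OF U] in simp)
      then obtain b where "b \<in> FP U" "elems U b = B" unfolding hfin_def by blast
      then show "\<exists>B\<in>FP U. (\<forall>b\<in>elems U B. C 0 (elems ?S s) b) \<and>
       (\<forall>u\<in>U. C 0 (elems ?S s) u \<longrightarrow> (\<exists>b\<in>elems U B. \<forall>i\<in>seg
           mem 0. nle (d b i) (d u i)))"
        using B by (intro bexI[of _ b]) auto
    qed
  next
    case (Suc k)
    have IH: "\<exists>B. hfin U B \<and> (\<forall>b\<in>B. C k s b) \<and>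
        (\<forall>u\<in>U. C k s u \<longrightarrow> (\<exists>b\<in>B. \<forall>i\<in>seg mem k. nle (d b i)
        (d u i)))"
      if "hfin ?S s" for s
      using Suc.IH that unfolding P_def hfin_def by blast
    show ?case unfolding P_def
    proof
      fix s0 assume "s0 \<in> FP ?S"
      define s where "s = elems ?S s0"
      have s: "hfin ?S s" unfolding s_def using \<open>s0 \<in> _\<close> by simp
      \<comment> \<open>All bounds on the exponent at \<open>k\<close> are removed: over
        \<open>?s\<close> the condition at level \<open>k\<close> is then the condition of
        \<open>s\<close> at level \<open>k + 1\<close>, and inserting a pair for \<open>k\<close>
        adds just that bound.\<close>
      let ?s = "{p\<in>s. \<forall>a\<in>NN mem. p \<noteq> el k @ el a}"
      have kk: "el k \<in> NatU" using Suc.hyps by blast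
      have s': "hfin ?S ?s"
        by (intro hfin_sep S s dfn_nat_intros dfn_eq[where Y = ?S and Z = ?S] dfn_term_append dfn_term_var
            dfn_term_const' dfn_term_sub[OF dfn_term_el] dfn_field_intros)
          (use S kk in \<open>auto simp: env_Cons\<close>)
      have el2: "el i @ el a = el k @ el b \<longleftrightarrow> i = k \<and> a = b" for i a b
        by (simp add: el_def)
      have C1: "C k ?s u \<longleftrightarrow> C (k + 1) s u" for u
        unfolding C_def Suc_nle_iff by (auto simp: el2)
      have C2: "C k (insert (el k @ el j) ?s) u \<longleftrightarrow> C (k + 1) s u \<and> nle (d u k) j"
          if "j \<in> NN mem" for u j
      proof -
        have "C k (insert (el k @ el j) t) u \<longleftrightarrow> C k t u \<and> nle (d u k) j" for t
          using Suc.hyps that unfolding C_def by (auto simp: el2)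
        then show ?thesis using C1 by simp
      qed
      \<comment> \<open>\<open>B0\<close> is correct for all exponents except possibly the one at
        \<open>k\<close>, which it ignores.\<close>
      obtain B0 where B0: "hfin U B0" "\<forall>b\<in>B0. C (k + 1) s b"
        "\<forall>u\<in>U. C (k + 1) s u \<longrightarrow> (\<exists>b\<in>B0. \<forall>i\<in>seg mem k. nle
            (d b i) (d u i))"
        using IH[OF s'] unfolding C1 by blast
      have "dfn_field [U] (\<lambda>e. d (e 0) k)" by (intro d dfn_term_var dfn_field_intros) (use U in auto)
      \<comment> \<open>If the exponent of \<open>u\<close> at \<open>k\<close> is at least
        \<open>J0\<close>, then it also dominates those of all members of \<open>B0\<close>, so
        \<open>B0\<close> suffices for such \<open>u\<close>. The remaining \<open>u\<close> have an
        exponent below \<open>J0\<close>.\<close>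
      then obtain J0 where J0: "J0 \<in> NN mem" "\<forall>b\<in>B0. nle (d b k) J0"
        using hfin_bound[OF U B0(1), of "\<lambda>u. d u k"] dN by blast
      \<comment> \<open>\<open>B\<close> covers the elements whose exponent at \<open>k\<close> is
        strictly below \<open>J\<close>. An inner induction on \<open>J\<close> collects them slice
        by slice, up to \<open>J0\<close>.\<close>
      define G where "G J B \<longleftrightarrow> (\<forall>b\<in>B. C (k + 1) s b) \<and>
          (\<forall>u\<in>U. C (k + 1) s u \<longrightarrow> nle (d u k) J \<longrightarrow>
          d u k \<noteq> J \<longrightarrow>
          (\<exists>b\<in>B. \<forall>i\<in>seg mem (k + 1). nle (d b i) (d u i)))" for J B
      have "\<exists>B\<in>FP U. G J0 (elems U B)" using J0(1)
      proof (induction J0 rule: NN_induct)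
        case dfn
        show ?case unfolding G_def s_def
          by (intro dfn_bex dfn_ball dfn_nat_intros dfn_ball_elems dfn_bex_elems dfn_ball_seg dpC d
              dfn_term_var dfn_term_const' dfn_field_intros)
            (use S U \<open>s0 \<in> _\<close> in auto)
      next
        case 0
        have "G 0 {}" unfolding G_def using dN nle_antisym nle_0 by blast
        then show ?case using hfin_empty[OF U] unfolding hfin_def by metis
      next
        case (Suc J)
        then obtain B1 where B1: "B1 \<in> FP U" "G J (elems U B1)" by blast
        have "el k @ el J \<in> ?S" using kk Suc.hyps by auto
        then have "hfin ?S (insert (el k @ el J) ?s)" by (intro hfin_insert S s')
        \<comment> \<open>Bounding the exponent at \<open>k\<close> by \<open>J\<close> is enough,
          without fixing it to be \<open>J\<close>: every member of \<open>B2\<close> then has an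
          exponent at most \<open>J\<close>, which is that of the new elements
          \<open>u\<close>.\<close>
        from IH[OF this] obtain B2 where B2: "hfin U B2" "\<forall>b\<in>B2. C (k + 1) s b \<and> nle (d b k) J"
          "\<forall>u\<in>U. C (k + 1) s u \<and> nle (d u k) J \<longrightarrow>
              (\<exists>b\<in>B2. \<forall>i\<in>seg mem k. nle (d b i) (d u i))"
          unfolding C2[OF Suc.hyps] by blast
        have "G (J + 1) (elems U B1 \<union> B2)" unfolding G_def
        proof (intro conjI ballI impI)
          fix b assume "b \<in> elems U B1 \<union> B2" then show "C (k + 1) s b" using B1 B2 unfolding G_def
              by blast
        next
          fix u assume u: "u \<in> U" "C (k + 1) s u" "nle (d u k) (J + 1)" "d u k \<noteq> J + 1"
          then have uJ: "nle (d u k) J" by (simp add: nle_Suc_iff)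
          show "\<exists>b\<in>elems U B1 \<union> B2. \<forall>i\<in>seg mem (k + 1). nle (d b i) (d u i)"
          proof (cases "d u k = J")
            case False
            then show ?thesis using B1(2) u uJ unfolding G_def by blast
          next
            case True
            obtain b where b: "b \<in> B2" "\<forall>i\<in>seg mem k. nle (d b i) (d u i)" using B2(3) u uJ
                by blast
            then have "\<forall>i\<in>seg mem (k + 1). nle (d b i) (d u i)"
              using True B2(2) \<open>k \<in> NN mem\<close> by (auto simp: seg_Suc)
            then show ?thesis using b by blast
          qed
        qed
        moreover have "hfin U (elems U B1 \<union> B2)" by (intro hfin_Un U B2 hfin_elems B1)
        ultimately show ?case unfolding hfin_def by metis
      qed
      then obtain B1 where B1: "B1 \<in> FP U" "G J0 (elems U B1)" by blast
      have "hfin U (elems U B1 \<union> B0)" by (intro hfin_Un U B0 hfin_elems B1)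
      then obtain B where B: "B \<in> FP U" "elems U B = elems U B1 \<union> B0" unfolding hfin_def by blast
      show "\<exists>B\<in>FP U. (\<forall>b\<in>elems U B. C (k + 1) (elems ?S s0) b) \<and>
          (\<forall>u\<in>U. C (k + 1) (elems ?S s0) u \<longrightarrow>
              (\<exists>b\<in>elems U B. \<forall>i\<in>seg mem (k + 1). nle (d b i) (d u i)))"
        unfolding s_def[symmetric]
      proof (rule bexI[OF _ B(1)], intro conjI ballI impI)
        fix b assume "b \<in> elems U B" then show "C (k + 1) s b" using B(2) B1(2) B0(2) unfolding G_def
            by blast
      next
        fix u assume u: "u \<in> U" "C (k + 1) s u"
        show "\<exists>b\<in>elems U B. \<forall>i\<in>seg mem (k + 1). nle (d b i) (d u i)"
        proof (cases "nle J0 (d u k)")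
          case True
          obtain b where b: "b \<in> B0" "\<forall>i\<in>seg mem k. nle (d b i) (d u i)" using B0(3) u by blast
          have "nle (d b k) (d u k)" using J0(2) b(1) True nle_trans by blast
          with b have "\<forall>i\<in>seg mem (k + 1). nle (d b i) (d u i)"
            using \<open>k \<in> NN mem\<close> by (auto simp: seg_Suc)
          then show ?thesis using b(1) B(2) by blast
        next
          case False
          then have "nle (d u k) J0" "d u k \<noteq> J0" using not_nle[OF J0(1) dN[OF u(1)]] by blast+
          then show ?thesis using B1(2) B(2) u unfolding G_def by blast
        qed
      qed
    qed
  qed
  \<comment> \<open>At \<open>k = n\<close> the empty set of bounds leaves all of
    \<open>U\<close>.\<close>
  moreover obtain s where "s \<in> FP ?S" "elems ?S s = {}" using hfin_empty[OF S] unfolding hfin_def by blast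
  ultimately obtain B where "B \<in> FP U" "\<forall>u\<in>U. C n {} u \<longrightarrow>
      (\<exists>b\<in>elems U B. \<forall>i\<in>seg mem n. nle (d b i) (d u i))"
    unfolding P_def by metis
  moreover have "C n {} u" for u by (simp add: C_def)
  ultimately show ?thesis by (intro exI[of _ "elems U B"]) simp
qed

end

section \<open>Exponents and polynomials\<close>

text \<open>Unpacks the algebraic notion of a subfield into closure under the operations of the type
  class; division by 0 stays in \<open>R\<close> because its value is 0.\<close>

lemma subfield_type_closed:
  fixes R :: "'k::field set"
  assumes "subfield R (ring_of_type_algebra :: 'k ring)"
  shows "0 \<in> R" "1 \<in> R" "\<And>a b. a \<in> R \<Longrightarrow> b \<in> R \<Longrightarrow>
      a + b \<in> R" "\<And>a b. a \<in> R \<Longrightarrow> b \<in> R \<Longrightarrow> a * b \<in> R"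
    "\<And>a. a \<in> R \<Longrightarrow> - a \<in> R" "\<And>a b. a \<in> R \<Longrightarrow>
        b \<in> R \<Longrightarrow> a / b \<in> R"
proof -
  let ?K = "ring_of_type_algebra :: 'k ring"
  interpret K: ring ?K by (rule ring_from_type_algebra)
  note sr = subringE[OF subfieldE(1)[OF assms]]
  have simps: "carrier ?K = UNIV" "\<zero>\<^bsub>?K\<^esub> = 0" "\<one>\<^bsub>?K\<^esub> = 1"
      "x \<oplus>\<^bsub>?K\<^esub> y = x + y" "x \<otimes>\<^bsub>?K\<^esub> y = x * y" for x y
    by (simp_all add: ring_of_type_algebra_def)
  have m: "\<ominus>\<^bsub>?K\<^esub> a = - a" for a by (rule K.minus_equality) (simp_all add: simps)
  show 0: "0 \<in> R" "1 \<in> R" using sr(2,3) by (simp_all add: simps)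
  show "a + b \<in> R" "a * b \<in> R" if "a \<in> R" "b \<in> R" for a b using sr(6,7)[OF that]
      by (simp_all add: simps)
  show "- a \<in> R" if "a \<in> R" for a using sr(5)[OF that] by (simp add: m)
  show "a / b \<in> R" if "a \<in> R" "b \<in> R" for a b
  proof (cases "b = 0")
    case False
    show ?thesis
      using K.subfield_m_inv_simprule[OF assms, of b "a / b"] False that by (simp add: simps)
  qed (use 0 in simp)
qed

context hf_field
begin

text \<open>In contrast to \<open>dfn_elems\<close>, the values of \<open>t\<close> need not lie in
  \<open>V\<close>; outside \<open>V\<close> the membership is simply false.\<close>

lemma dfn_xt': "dset V \<Longrightarrow> dfn_term \<Gamma> Z t \<Longrightarrow>
    dfn_term \<Gamma> (FP V) b \<Longrightarrow> dfn \<Gamma> (\<lambda>e. t e \<in> elems V (b e))"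
proof -
  assume V: "dset V" and t: "dfn_term \<Gamma> Z t" and b: "dfn_term \<Gamma> (FP V) b"
  have "dfn \<Gamma> (\<lambda>e. \<exists>x\<in>V. x = t e \<and> x \<in> elems V (b e))"
    by (intro dfn_bex V dfn_conj dfn_eq[where Y = V and Z = Z] dfn_elems dfn_term_var dfn_term_weaken[OF t]
        dfn_term_weaken[OF b])
      (use V in auto)
  then show ?thesis by (rule dfn_congI) (use elems_sub[OF V] in blast)
qed

lemma dfn_field_graphI: "dfn (FieldU # \<Gamma>) (\<lambda>e. unel (e 0) = t (\<lambda>i. e (Suc i)))
    \<Longrightarrow> dfn_field \<Gamma> t"
  unfolding dfn_field_def dfn_term_def
proof (intro conjI allI impI)
  assume *: "dfn (FieldU # \<Gamma>) (\<lambda>e. unel (e 0) = t (\<lambda>i. e (Suc i)))"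
  show "dfn (FieldU # \<Gamma>) (\<lambda>e. e 0 = el (t (\<lambda>i. e (Suc i))))"
    by (rule dfn_congI[OF *]) (auto simp: env_Cons)
qed auto

section \<open>Hyperfinite sequences\<close>

lemma el_append: "el i @ x = el j @ y \<longleftrightarrow> i = j \<and> x = y"
  by (simp add: el_def)

text \<open>The unique existence in \<open>hf_fun\<close> ranges over all lists; restricted to
  \<open>V\<close> it becomes a condition that can be seen to be definable.\<close>

lemma hf_fun_iff:
  assumes V: "dset V"
  shows "f \<in> hf_fun mem m V \<longleftrightarrow> f \<in> FP (times_set (el ` seg mem m) V) \<and>
    (\<forall>i\<in>seg mem m. \<exists>x\<in>V. \<forall>y\<in>V. el i @ y \<in> elems (times_set (el ` seg
        mem m) V) f \<longleftrightarrow> y = x)"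
proof -
  have "dset (times_set (el ` seg mem m) V)" by (intro dset_times V) simp
  from elems_sub[OF this] have sub: "x \<in> V" if "el i @ x \<in> elems (times_set (el ` seg mem m) V) f"
      for i x
    using that by (force simp: times_set_def el_append)
  have "(\<exists>!x. el i @ x \<in> elems (times_set (el ` seg mem m) V) f) \<longleftrightarrow>
    (\<exists>x\<in>V. \<forall>y\<in>V. el i @ y \<in> elems (times_set (el ` seg mem m) V) f
        \<longleftrightarrow> y = x)" for i
    unfolding Ex1_def using sub by blast
  then show ?thesis unfolding hf_fun_def by simp
qed

lemma dset_hf_fun: "dset V \<Longrightarrow> dset (hf_fun mem m V)"
proof -
  assume V: "dset V"
  let ?S = "times_set (el ` seg mem m) V"
  have S: "dset ?S" by (intro dset_times V) simp
  have "dset {f\<in>FP ?S. \<forall>i\<in>seg mem m. \<exists>x\<in>V. \<forall>y\<in>V. el i @ y \<in> elems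
      ?S f \<longleftrightarrow> y = x}"
    by (intro dset_Collect dset_FP S dfn_ballk[OF dset_seg] dfn_bex dfn_ball V dfn_iff
        dfn_xt'[where Z = "times_set FieldU V"] dfn_eq[where Y = V and Z = V] dfn_term_append dfn_term_el
            dfn_field_intros dfn_term_var) (use V S in auto)
  moreover have "hf_fun mem m V = {f\<in>FP ?S. \<forall>i\<in>seg mem m. \<exists>x\<in>V. \<forall>y\<in>V.
      el i @ y \<in> elems ?S f \<longleftrightarrow> y = x}"
    using hf_fun_iff[OF V] by blast
  ultimately show ?thesis by simp
qed

lemma hf_app:
  assumes V: "dset V" and f: "f \<in> hf_fun mem m V" and i: "i \<in> seg mem m"
  shows "hf_app mem m V f i \<in> V" "el i @ y \<in> elems (times_set (el ` seg mem m) V) f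
      \<longleftrightarrow> y = hf_app mem m V f i"
proof -
  let ?S = "times_set (el ` seg mem m) V"
  have xval: "\<exists>!x. el i @ x \<in> elems ?S f" using f i unfolding hf_fun_def by blast
  then have a: "el i @ hf_app mem m V f i \<in> elems ?S f" unfolding hf_app_def by (rule theI')
  then show "el i @ y \<in> elems ?S f \<longleftrightarrow> y = hf_app mem m V f i" using xval by blast
  have "dset ?S" by (intro dset_times V) simp
  from elems_sub[OF this] a have "el i @ hf_app mem m V f i \<in> ?S" by blast
  then show "hf_app mem m V f i \<in> V" by (auto simp: times_set_def el_append)
qed

lemma hf_fun_ext:
  assumes V: "dset V" and f: "f \<in> hf_fun mem m V" and g: "g \<in> hf_fun mem m V"
    and eq: "\<And>i. i \<in> seg mem m \<Longrightarrow> hf_app mem m V f i = hf_app mem m V g i"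
  shows "f = g"
proof -
  let ?S = "times_set (el ` seg mem m) V"
  have S: "dset ?S" by (intro dset_times V) simp
  have "p \<in> elems ?S f \<longleftrightarrow> p \<in> elems ?S g" for p
  proof (cases "p \<in> ?S")
    case True
    then obtain i y where "p = el i @ y" "i \<in> seg mem m" by (auto simp: times_set_def)
    then show ?thesis using hf_app(2)[OF V f] hf_app(2)[OF V g] eq by simp
  qed (use elems_sub[OF S] in blast)
  then have "elems ?S f = elems ?S g" by blast
  moreover have "f \<in> FP ?S" "g \<in> FP ?S" using f g by (simp_all add: hf_fun_def)
  ultimately show ?thesis using elems_inj[OF S] by simp
qed

text \<open>The sequence is the image of a segment under \<open>i \<mapsto> (i, F i)\<close>.
  \<open>F\<close> is given as a definable function on all of \<open>NN mem\<close> with values in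
  some \<open>Z\<close>; on the segment its values must lie in \<open>V\<close>.\<close>

lemma hf_fun_ex:
  assumes V: "dset V" and m: "m \<in> NN mem" and F: "dfn_term [NatU] Z (\<lambda>e. F (unel (e 0)))"
    and FV: "\<And>i. i \<in> seg mem m \<Longrightarrow> F i \<in> V"
  shows "\<exists>f\<in>hf_fun mem m V. \<forall>i\<in>seg mem m. hf_app mem m V f i = F i"
proof -
  let ?S = "times_set (el ` seg mem m) V"
  have S: "dset ?S" by (intro dset_times V) simp
  have hs: "hfin (el ` seg mem m) (el ` seg mem m)"
    by (rule hfin_mono[OF dsetNN _ hfin_seg[OF m]]) auto
  have "dfn_term [el ` seg mem m] Z (\<lambda>e. F (unel (e 0)))"
    by (rule dfn_term_comp1[where f = "\<lambda>y. F (unel y)", OF F]) (auto intro!: dfn_term_var simp: seg_NN)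
  then have "dfn_term [el ` seg mem m] (times_set FieldU Z) (\<lambda>e. el (unel (e 0)) @ F (unel (e 0)))"
    by (intro dfn_term_append dfn_term_el dfn_field_intros) auto
  then have FS: "dfn_term [el ` seg mem m] ?S (\<lambda>e. el (unel (e 0)) @ F (unel (e 0)))"
    by (rule dfn_term_sub) (use S FV in \<open>auto simp: env_Cons intro!: append_mem_times\<close>)
  let ?G = "\<lambda>y :: ('k, 'f) elt. el (unel y) @ F (unel y)"
  let ?sg = "el ` seg mem m :: ('k, 'f) elt set"
  from hfin_image[where f = ?G, OF dset_seg S hs FS]
  obtain f where f: "f \<in> FP ?S" "elems ?S f = ?G ` ?sg"
    unfolding hfin_def by blast
  have mem: "el i @ y \<in> elems ?S f \<longleftrightarrow> y = F i" if "i \<in> seg mem m" for i y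
    unfolding f(2) using that by (auto simp: el_append image_iff)
  have fm: "f \<in> hf_fun mem m V"
    unfolding hf_fun_iff[OF V] using f(1) FV mem by (intro conjI ballI bexI) auto
  have "hf_app mem m V f i = F i" if "i \<in> seg mem m" for i
    using hf_app(2)[OF V fm that, of "F i"] mem[OF that, of "F i"] by simp
  with fm show ?thesis by blast
qed

end

locale hf_poly = hf_field mem for mem :: "'k::field \<Rightarrow> 'f \<Rightarrow> bool" +
  fixes R :: "'k set" and n :: 'k
  assumes Rsub: "subfield R (ring_of_type_algebra :: 'k ring)"
    and Rd [simp]: "definability.dset (Keq mem) (\<Union>s. dom (Keq mem) s) (el ` R)"
    and nN [simp]: "n \<in> NN mem"
begin

abbreviation Exps :: "('k, 'f) elt set" where "Exps \<equiv> expo mem n"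
abbreviation Graphs :: "('k, 'f) elt set" where "Graphs \<equiv> poly_graphs mem R n"
abbreviation Polys :: "('k, 'f) elt set" where "Polys \<equiv> polys mem R n"
abbreviation pcoeff :: "('k, 'f) elt \<Rightarrow> ('k, 'f) elt \<Rightarrow> 'k"
    where "pcoeff \<equiv> poly_coeff mem R n"
abbreviation xadd :: "('k, 'f) elt \<Rightarrow> ('k, 'f) elt \<Rightarrow> ('k, 'f) elt"
    where "xadd \<equiv> expo_add mem n"

lemmas R_closed = subfield_type_closed[OF Rsub]

text \<open>Setting the exponents beyond the variables to 0 makes exponents total functions, so that
  addition can be stated for all indices.\<close>

definition xval :: "('k, 'f) elt \<Rightarrow> 'k \<Rightarrow> 'k" where
  "xval I i = (if i \<in> seg mem n then expo_at mem n I i else 0)"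

section \<open>Exponents and their addition\<close>

lemma dset_Exps [simp]: "dset Exps"
  unfolding expo_def by (intro dset_hf_fun) simp

lemma el_xval: "I \<in> Exps \<Longrightarrow> i \<in> seg mem n \<Longrightarrow>
    el (xval I i) = hf_app mem n NatU I i"
proof -
  assume *: "I \<in> Exps" "i \<in> seg mem n"
  then have "hf_app mem n NatU I i \<in> NatU" unfolding expo_def by (intro hf_app) simp_all
  then obtain a where a: "hf_app mem n NatU I i = el a" by blast
  then have "expo_at mem n I i = a" unfolding expo_at_def by simp
  then show ?thesis using a * by (simp add: xval_def)
qed

lemma xval_NN [simp]: "I \<in> Exps \<Longrightarrow> xval I i \<in> NN mem"
proof (cases "i \<in> seg mem n")
  case True
  assume *: "I \<in> Exps"
  have "hf_app mem n NatU I i \<in> NatU" using * True unfolding expo_def by (intro hf_app) simp_all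
  then show ?thesis using el_xval[OF * True] by (metis el_mem_image)
qed (simp add: xval_def)

lemma xval_iff: "I \<in> Exps \<Longrightarrow> i \<in> seg mem n \<Longrightarrow>
  el i @ el a \<in> elems (times_set (el ` seg mem n) NatU) I \<longleftrightarrow> a = xval I i"
  using hf_app(2)[OF dsetNN, of I n i "el a"] el_xval[of I i] unfolding expo_def
  by (metis el_inject)

lemma dfn_field_xval: "dfn_term \<Gamma> Exps t \<Longrightarrow> dfn_field \<Gamma> s \<Longrightarrow>
    dfn_field \<Gamma> (\<lambda>e. xval (t e) (s e))"
proof -
  let ?S = "times_set (el ` seg mem n) NatU"
  have S: "dset ?S" by (intro dset_times) simp_all
  assume t: "dfn_term \<Gamma> Exps t" and s: "dfn_field \<Gamma> s"
  have "dfn [FieldU, Exps, FieldU] (\<lambda>e. (unel (e 2) \<in> seg mem n \<and>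
      el (unel (e 2)) @ el (unel (e 0)) \<in> elems ?S (e (Suc 0))) \<or>
      (unel (e 2) \<notin> seg mem n \<and> unel (e 0) = 0))"
    by (intro dfn_nat_intros dfn_seg dfn_xt'[where Z = "times_set FieldU FieldU"] dfn_term_append dfn_term_el
        dfn_field_intros dfn_term_var)
      (use S in \<open>auto simp: expo_def hf_fun_def\<close>)
  then have "dfn [FieldU, Exps, FieldU] (\<lambda>e. unel (e 0) = xval (e (Suc 0)) (unel (e (Suc (Suc 0)))))"
  proof (rule dfn_congI)
    fix e assume "env [FieldU, Exps, FieldU] e"
    then have "e (Suc 0) \<in> Exps" by (simp add: env_Cons)
    then show "(unel (e 0) = xval (e (Suc 0)) (unel (e (Suc (Suc 0))))) =
      ((unel (e 2) \<in> seg mem n \<and> el (unel (e 2)) @ el (unel (e 0)) \<in> elems ?S (e (Suc 0))) \<or>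
      (unel (e 2) \<notin> seg mem n \<and> unel (e 0) = 0))"
      by (cases "unel (e 2) \<in> seg mem n") (auto simp: xval_iff numeral_2_eq_2 xval_def[of _ "unel _"])
  qed
  then have "dfn_field [Exps, FieldU] (\<lambda>e. xval (e 0) (unel (e (Suc 0))))" by (intro dfn_field_graphI)
  then have "dfn_term [Exps, FieldU] FieldU (\<lambda>e. el (xval (e 0) (unel (e (Suc 0)))))"
      by (simp add: dfn_field_def)
  from dfn_term_comp2[where f = "\<lambda>I i. el (xval I (unel i))", OF this t, of "\<lambda>e. el (s e)"] s
  show ?thesis by (simp add: dfn_field_def)
qed

lemma xval_ext:
  assumes "I \<in> Exps" "J \<in> Exps" "\<And>i. i \<in> seg mem n \<Longrightarrow> xval I i = xval J i"
  shows "I = J"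
proof (rule hf_fun_ext[OF dsetNN, of I n J])
  show "hf_app mem n NatU I i = hf_app mem n NatU J i" if "i \<in> seg mem n" for i
    using el_xval[OF assms(1) that] el_xval[OF assms(2) that] assms(3)[OF that] by simp
qed (use assms in \<open>simp_all add: expo_def\<close>)

lemma xval_exists:
  assumes c: "dfn_field [FieldU] (\<lambda>e. c (unel (e 0)))" and cN: "\<And>i. i \<in> seg mem n
      \<Longrightarrow> c i \<in> NN mem"
  shows "\<exists>I\<in>Exps. \<forall>i\<in>seg mem n. xval I i = c i"
proof -
  have "dfn_term [NatU] FieldU (\<lambda>e. el (c (unel (e 0))))"
    using c unfolding dfn_field_def by (rule dfn_term_comp1[where f = "\<lambda>y. el (c (unel y))"]) (auto
        intro!: dfn_term_var)
  from hf_fun_ex[OF dsetNN nN this] cN obtain I where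
    I: "I \<in> Exps" "\<forall>i\<in>seg mem n. hf_app mem n NatU I i = el (c i)" unfolding expo_def by auto
  then have "\<forall>i\<in>seg mem n. xval I i = c i" using el_xval[OF I(1)] by (metis el_inject)
  with I show ?thesis by blast
qed

lemma xadd: assumes "I \<in> Exps" "J \<in> Exps"
  shows xadd_Exps [simp]: "xadd I J \<in> Exps" and xval_xadd [simp]: "xval (xadd I J) i = xval I i + xval J i"
proof -
  have d: "dfn_field [FieldU] (\<lambda>e. xval I (unel (e 0)) + xval J (unel (e 0)))"
    by (intro dfn_field_intros dfn_field_xval dfn_term_const') (use assms in auto)
  have "\<exists>L\<in>Exps. \<forall>i\<in>seg mem n. xval L i = xval I i + xval J i"
    by (rule xval_exists[where c = "\<lambda>i. xval I i + xval J i", OF d]) (use assms in \<open>auto intro: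
        NN_add\<close>)
  then obtain L where L: "L \<in> Exps" "\<forall>i\<in>seg mem n. xval L i = xval I i + xval J i" by blast
  have "xadd I J = L" unfolding expo_add_def
  proof (rule the_equality)
    show "L \<in> Exps \<and> (\<forall>k\<in>seg mem n. expo_at mem n L k = expo_at mem n I k + expo_at mem
        n J k)"
      using L by (simp add: xval_def)
    fix L' assume L': "L' \<in> Exps \<and> (\<forall>k\<in>seg mem n. expo_at mem n L' k = expo_at mem n I k
        + expo_at mem n J k)"
    show "L' = L" by (rule xval_ext) (use L L' in \<open>auto simp: xval_def\<close>)
  qed
  then show "xadd I J \<in> Exps" "xval (xadd I J) i = xval I i + xval J i" using L by (auto simp: xval_def)
qed

lemma xadd_cancel: "L \<in> Exps \<Longrightarrow> I \<in> Exps \<Longrightarrow>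
    J \<in> Exps \<Longrightarrow> xadd L I = xadd L J \<longleftrightarrow> I = J"
  using xval_ext[of I J] xval_xadd[of L I] xval_xadd[of L J] by (metis add_left_cancel)

text \<open>Divisibility of monomials is componentwise comparison: the differences of the exponents
  lie in \<open>NN mem\<close> and form the exponent of the quotient.\<close>

lemma xadd_divide:
  assumes "I \<in> Exps" "J \<in> Exps" "\<And>i. i \<in> seg mem n \<Longrightarrow> nle (xval J i) (xval I i)"
  shows "\<exists>L\<in>Exps. I = xadd L J"
proof -
  have d: "dfn_field [FieldU] (\<lambda>e. xval I (unel (e 0)) - xval J (unel (e 0)))"
    by (intro dfn_field_intros dfn_field_xval dfn_term_const') (use assms in auto)
  have "\<exists>L\<in>Exps. \<forall>i\<in>seg mem n. xval L i = xval I i - xval J i"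
    by (rule xval_exists[where c = "\<lambda>i. xval I i - xval J i", OF d]) (use assms in \<open>auto simp:
        nle_def\<close>)
  then obtain L where L: "L \<in> Exps" "\<forall>i\<in>seg mem n. xval L i = xval I i - xval J i" by blast
  have "I = xadd L J" by (rule xval_ext) (use L assms in auto)
  with L show ?thesis by blast
qed

lemma dfn_term_xadd: "dfn_term \<Gamma> Exps t \<Longrightarrow> dfn_term \<Gamma> Exps s \<Longrightarrow>
    dfn_term \<Gamma> Exps (\<lambda>e. xadd (t e) (s e))"
proof (rule dfn_term_graph2[where f = xadd and Ya = Exps and Yb = Exps])
  have "dfn [Exps, Exps, Exps] (\<lambda>e. \<forall>i\<in>NN mem. xval (e 0) i = xval (e (Suc 0)) i + xval
      (e (Suc (Suc 0))) i)"
    by (intro dfn_nat_intros dfn_field_intros dfn_field_xval dfn_term_var) auto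
  then show "dfn [Exps, Exps, Exps] (\<lambda>e. e 0 = xadd (e (Suc 0)) (e (Suc (Suc 0))))"
  proof (rule dfn_congI)
    fix e assume "env [Exps, Exps, Exps] e"
    then have e: "e 0 \<in> Exps" "e (Suc 0) \<in> Exps" "e (Suc (Suc 0)) \<in> Exps"
        by (simp_all add: env_Cons)
    show "(e 0 = xadd (e (Suc 0)) (e (Suc (Suc 0)))) = (\<forall>i\<in>NN mem. xval (e 0) i = xval (e (Suc
        0)) i + xval (e (Suc (Suc 0))) i)"
    proof
      assume "e 0 = xadd (e (Suc 0)) (e (Suc (Suc 0)))"
      then show "\<forall>i\<in>NN mem. xval (e 0) i = xval (e (Suc 0)) i + xval (e (Suc (Suc 0))) i"
        using xval_xadd[OF e(2,3)] by simp
    next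
      assume a: "\<forall>i\<in>NN mem. xval (e 0) i = xval (e (Suc 0)) i + xval (e (Suc (Suc 0))) i"
      show "e 0 = xadd (e (Suc 0)) (e (Suc (Suc 0)))"
      proof (rule xval_ext[OF e(1) xadd_Exps[OF e(2,3)]])
        fix i assume "i \<in> seg mem n"
        then show "xval (e 0) i = xval (xadd (e (Suc 0)) (e (Suc (Suc 0)))) i"
          using a seg_NN unfolding xval_xadd[OF e(2,3)] by blast
      qed
    qed
  qed
qed auto

section \<open>Polynomials and their coefficients\<close>

lemma dset_Graphs [simp]: "dset Graphs"
proof -
  have "dset (el ` {x. x \<in> R \<and> x \<noteq> 0} :: ('k, 'f) elt set)"
    by (intro dset_Collectk dfn_intros dfn_memk Rd dfn_field_intros) auto
  then show ?thesis unfolding poly_graphs_def by (intro dset_times) (auto simp: set_diff_eq)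
qed

lemma mem_Graphs: "I \<in> Exps \<Longrightarrow> I @ el a \<in> Graphs \<longleftrightarrow>
    a \<in> R \<and> a \<noteq> 0"
  unfolding poly_graphs_def times_set_def using append_inj_dset[OF dset_Exps] by auto

lemma dset_Polys [simp]: "dset Polys"
proof -
  have "dset {p\<in>FP Graphs. \<forall>I\<in>Exps. \<forall>a b. I @ el a \<in> elems Graphs p
      \<longrightarrow> I @ el b \<in> elems Graphs p \<longrightarrow> a = b}"
    by (intro dset_Collect dset_FP dfn_ball dfn_nat_intros dfn_xt'[where Z = "times_set Exps FieldU"]
        dfn_term_append dfn_term_el dfn_field_intros dfn_term_var) auto
  then show ?thesis unfolding polys_def .
qed

lemma pcoeff_iff:
  assumes p: "p \<in> Polys" and I: "I \<in> Exps"
  shows "I @ el a \<in> elems Graphs p \<longleftrightarrow> a = pcoeff p I \<and> a \<noteq> 0"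
      and "pcoeff p I \<in> R"
proof -
  have sub: "b \<in> R \<and> b \<noteq> 0" if "I @ el b \<in> elems Graphs p" for b
    using that elems_sub[OF dset_Graphs] mem_Graphs[OF I] by blast
  have uniq: "b = b'" if "I @ el b \<in> elems Graphs p" "I @ el b' \<in> elems Graphs p" for b b'
    using p I that unfolding polys_def by blast
  have "(\<forall>a. I @ el a \<in> elems Graphs p \<longleftrightarrow> a = pcoeff p I \<and>
      a \<noteq> 0) \<and> pcoeff p I \<in> R"
  proof (cases "I \<in> poly_dom mem R n p")
    case True
    then obtain b where b: "I @ el b \<in> elems Graphs p" unfolding poly_dom_def by blast
    have "(THE a. I @ el a \<in> elems Graphs p) = b" by (rule the_equality[where P = "\<lambda>a. I @ el a
        \<in> elems Graphs p", OF b uniq[OF _ b]])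
    then have c: "pcoeff p I = b" unfolding poly_coeff_def using True by simp
    show ?thesis
    proof (intro conjI allI iffI)
      fix a assume a: "I @ el a \<in> elems Graphs p"
      show "a = pcoeff p I" "a \<noteq> 0" using uniq[OF a b] sub[OF b] c by simp_all
    next
      fix a assume "a = pcoeff p I \<and> a \<noteq> 0" then show "I @ el a \<in> elems Graphs p" using b c
          by simp
    next
      show "pcoeff p I \<in> R" using sub[OF b] c by simp
    qed
  next
    case False
    then have 0: "pcoeff p I = 0" unfolding poly_coeff_def by simp
    have "I @ el a \<notin> elems Graphs p" for a using False I unfolding poly_dom_def by blast
    with 0 show ?thesis using R_closed(1) by simp
  qed
  then show "I @ el a \<in> elems Graphs p \<longleftrightarrow> a = pcoeff p I \<and> a \<noteq> 0"
      "pcoeff p I \<in> R" by simp_all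
qed

lemma poly_dom_eq: "p \<in> Polys \<Longrightarrow> poly_dom mem R n p = {I\<in>Exps. pcoeff p I \<noteq> 0}"
  unfolding poly_dom_def by (simp add: pcoeff_iff(1) cong: conj_cong)

lemma dfn_field_pcoeff: "dfn_term \<Gamma> Polys p \<Longrightarrow>
    dfn_term \<Gamma> Exps I \<Longrightarrow> dfn_field \<Gamma> (\<lambda>e. pcoeff (p e) (I e))"
proof -
  assume p: "dfn_term \<Gamma> Polys p" and I: "dfn_term \<Gamma> Exps I"
  have "dfn [FieldU, Polys, Exps] (\<lambda>e. (e (Suc (Suc 0)) @ el (unel (e 0)) \<in> elems Graphs (e (Suc
      0))) \<or>
      (unel (e 0) = 0 \<and> (\<forall>a. e (Suc (Suc 0)) @ el a \<notin> elems Graphs (e (Suc 0)))))"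
    by (intro dfn_nat_intros dfn_xt'[where Z = "times_set Exps FieldU"] dfn_term_append dfn_term_el
        dfn_field_intros dfn_term_var) (auto simp: polys_def)
  then have "dfn [FieldU, Polys, Exps] (\<lambda>e. unel (e 0) = pcoeff (e (Suc 0)) (e (Suc (Suc 0))))"
    by (rule dfn_congI) (auto simp: env_Cons pcoeff_iff)
  then have "dfn_field [Polys, Exps] (\<lambda>e. pcoeff (e 0) (e (Suc 0)))" by (intro dfn_field_graphI)
  then have "dfn_term [Polys, Exps] FieldU (\<lambda>e. el (pcoeff (e 0) (e (Suc 0))))"
      by (simp add: dfn_field_def)
  from dfn_term_comp2[where f = "\<lambda>p I. el (pcoeff p I)", OF this p I] show ?thesis
      by (simp add: dfn_field_def)
qed

lemma poly_ext:
  assumes p: "p \<in> Polys" and q: "q \<in> Polys" and eq: "\<And>I. I \<in> Exps \<Longrightarrow>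
      pcoeff p I = pcoeff q I"
  shows "p = q"
proof -
  have "z \<in> elems Graphs p \<longleftrightarrow> z \<in> elems Graphs q" for z
  proof (cases "z \<in> Graphs")
    case True
    then obtain I a where "z = I @ el a" "I \<in> Exps" by (auto simp: poly_graphs_def times_set_def)
    then show ?thesis using pcoeff_iff(1)[OF p] pcoeff_iff(1)[OF q] eq by simp
  qed (use elems_sub[OF dset_Graphs] in blast)
  then have "elems Graphs p = elems Graphs q" by blast
  moreover have "p \<in> FP Graphs" "q \<in> FP Graphs" using p q by (simp_all add: polys_def)
  ultimately show ?thesis using elems_inj[OF dset_Graphs] by simp
qed

lemma poly_eq_iff: "p \<in> Polys \<Longrightarrow> q \<in> Polys \<Longrightarrow>
    p = q \<longleftrightarrow> (\<forall>I\<in>Exps. pcoeff p I = pcoeff q I)"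
  using poly_ext by blast

text \<open>A definable coefficient function may have a support that is not hyperfinite, so a
  hyperfinite set \<open>D\<close> containing the support is part of the hypotheses; the graph is a
  hyperfinite union over \<open>D\<close>.\<close>

lemma poly_ex:
  assumes c: "dfn_field [Exps] (\<lambda>e. c (e 0))" and cR: "\<And>I. I \<in> Exps \<Longrightarrow>
      c I \<in> R"
    and D: "hfin Exps D" "\<And>I. I \<in> Exps \<Longrightarrow> c I \<noteq> 0 \<Longrightarrow> I \<in> D"
  shows "\<exists>p\<in>Polys. \<forall>I\<in>Exps. pcoeff p I = c I"
proof -
  have c': "dfn_field \<Gamma> (\<lambda>e. c (t e))" if "dfn_term \<Gamma> Exps t" for \<Gamma> t
    using c that dfn_term_comp1[where f = "\<lambda>I. el (c I)"] unfolding dfn_field_def by blast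
  have DE: "D \<subseteq> Exps" by (rule hfin_sub[OF dset_Exps D(1)])
  have "hfin Graphs {y\<in>Graphs. \<exists>I\<in>D. y = I @ el (c I) \<and> c I \<noteq> 0}"
  proof (rule hfin_bind[OF dset_Exps dset_Graphs D(1)])
    show "dfn [Exps, Graphs] (\<lambda>e. e (Suc 0) = e 0 @ el (c (e 0)) \<and> c (e 0) \<noteq> 0)"
      by (intro dfn_nat_intros dfn_eq[where Y = Graphs and Z = "times_set Exps FieldU"] dfn_term_append
          dfn_term_el c' dfn_field_intros dfn_term_var) auto
    fix I assume "I \<in> D"
    then have I: "I \<in> Exps" using DE by blast
    show "hfin Graphs {y \<in> Graphs. y = I @ el (c I) \<and> c I \<noteq> 0}"
    proof (cases "c I = 0")
      case False
      then have m: "I @ el (c I) \<in> Graphs" using mem_Graphs[OF I] cR[OF I] by simp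
      then have "{y \<in> Graphs. y = I @ el (c I) \<and> c I \<noteq> 0} = {I @ el (c I)}" using False by blast
      then show ?thesis using hfin_single[OF dset_Graphs m] by simp
    qed simp
  qed
  then obtain p where p: "p \<in> FP Graphs" "elems Graphs p = {y\<in>Graphs. \<exists>I\<in>D. y = I @ el (c
      I) \<and> c I \<noteq> 0}" unfolding hfin_def by blast
  have m: "I @ el a \<in> elems Graphs p \<longleftrightarrow> a = c I \<and> a \<noteq> 0"
      if I: "I \<in> Exps" for I a
  proof
    assume "I @ el a \<in> elems Graphs p"
    then obtain J where J: "J \<in> D" "I @ el a = J @ el (c J)" "c J \<noteq> 0" unfolding p(2) by blast
    then have "I = J \<and> el a = (el (c J) :: ('k, 'f) elt)" using append_inj_dset[OF dset_Exps I] DE by blast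
    then show "a = c I \<and> a \<noteq> 0" using J by simp
  next
    assume "a = c I \<and> a \<noteq> 0"
    then show "I @ el a \<in> elems Graphs p" unfolding p(2) using mem_Graphs[OF I] cR[OF I] D(2)[OF I] by auto
  qed
  then have P: "p \<in> Polys" unfolding polys_def using p(1) by auto
  have "pcoeff p I = c I" if I: "I \<in> Exps" for I
    using pcoeff_iff(1)[OF P I, of "pcoeff p I"] pcoeff_iff(1)[OF P I, of "c I"] m[OF I] by metis
  with P show ?thesis by blast
qed

lemma poly_ofI:
  assumes "\<exists>p\<in>Polys. \<forall>I\<in>Exps. pcoeff p I = c I"
  shows "poly_of mem R n c \<in> Polys" "\<And>I. I \<in> Exps \<Longrightarrow>
      pcoeff (poly_of mem R n c) I = c I"
proof -
  have "\<exists>!p. p \<in> Polys \<and> (\<forall>I\<in>Exps. pcoeff p I = c I)" using assms poly_ext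
      by (metis (no_types, lifting))
  from theI'[OF this] have "poly_of mem R n c \<in> Polys \<and> (\<forall>I\<in>Exps. pcoeff (poly_of mem R
      n c) I = c I)"
    unfolding poly_of_def .
  then show "poly_of mem R n c \<in> Polys" "\<And>I. I \<in> Exps \<Longrightarrow>
      pcoeff (poly_of mem R n c) I = c I" by blast+
qed

lemma hfin_dom: "p \<in> Polys \<Longrightarrow> hfin Exps {I\<in>Exps. pcoeff p I \<noteq> 0}"
proof -
  assume p: "p \<in> Polys"
  have "hfin Exps {I\<in>Exps. \<exists>y\<in>elems Graphs p. \<exists>a. y = I @ el a}"
  proof (rule hfin_bind[OF dset_Graphs dset_Exps])
    show "hfin Graphs (elems Graphs p)" using p unfolding polys_def by simp
    show "dfn [Graphs, Exps] (\<lambda>e. \<exists>a. e 0 = e (Suc 0) @ el a)"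
      by (intro dfn_nat_intros dfn_eq[where Y = Graphs and Z = "times_set Exps FieldU"] dfn_term_append
          dfn_term_el dfn_field_intros dfn_term_var) auto
    fix y assume "y \<in> elems Graphs p"
    then have "y \<in> Graphs" using elems_sub[OF dset_Graphs] by blast
    then obtain I a where y: "y = I @ el a" "I \<in> Exps" by (auto simp: poly_graphs_def times_set_def)
    have "{J\<in>Exps. \<exists>a. y = J @ el a} = {I}" using y append_inj_dset[OF dset_Exps] by auto
    then show "hfin Exps {J\<in>Exps. \<exists>a. y = J @ el a}" using hfin_single[OF dset_Exps y(2)] by simp
  qed
  moreover have "(\<exists>y\<in>elems Graphs p. \<exists>a. y = I @ el a) \<longleftrightarrow>
      pcoeff p I \<noteq> 0" if I: "I \<in> Exps" for I
  proof
    assume "\<exists>y\<in>elems Graphs p. \<exists>a. y = I @ el a"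
    then obtain a where "I @ el a \<in> elems Graphs p" by blast
    then have "a = pcoeff p I \<and> a \<noteq> 0" using pcoeff_iff(1)[OF p I] by blast
    then show "pcoeff p I \<noteq> 0" by blast
  next
    assume "pcoeff p I \<noteq> 0"
    then have "I @ el (pcoeff p I) \<in> elems Graphs p" unfolding pcoeff_iff(1)[OF p I] by simp
    then show "\<exists>y\<in>elems Graphs p. \<exists>a. y = I @ el a" by blast
  qed
  then have "{I\<in>Exps. \<exists>y\<in>elems Graphs p. \<exists>a. y = I @ el a} = {I\<in>Exps. pcoeff p I
      \<noteq> 0}" by (simp cong: conj_cong)
  ultimately show ?thesis by simp
qed

lemma poly_zero: "poly_zero mem R n \<in> Polys" "I \<in> Exps \<Longrightarrow>
    pcoeff (poly_zero mem R n) I = 0"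
proof -
  have "\<exists>p\<in>Polys. \<forall>I\<in>Exps. pcoeff p I = 0"
    by (rule poly_ex[where c = "\<lambda>_. 0" and D = "{}"]) (use R_closed(1) dfn_field_const in auto)
  from poly_ofI[OF this] show "poly_zero mem R n \<in> Polys" "I \<in> Exps \<Longrightarrow>
      pcoeff (poly_zero mem R n) I = 0"
    unfolding poly_zero_def by auto
qed

lemma poly_add:
  assumes "p \<in> Polys" "q \<in> Polys"
  shows "poly_add mem R n p q \<in> Polys" "I \<in> Exps \<Longrightarrow>
      pcoeff (poly_add mem R n p q) I = pcoeff p I + pcoeff q I"
proof -
  have "\<exists>r\<in>Polys. \<forall>I\<in>Exps. pcoeff r I = pcoeff p I + pcoeff q I"
  proof (rule poly_ex[where c = "\<lambda>I. pcoeff p I + pcoeff q I"])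
    show "dfn_field [Exps] (\<lambda>e. pcoeff p (e 0) + pcoeff q (e 0))"
      by (intro dfn_field_intros dfn_field_pcoeff dfn_term_const' dfn_term_var) (use assms in auto)
    show "hfin Exps ({I\<in>Exps. pcoeff p I \<noteq> 0} \<union> {I\<in>Exps. pcoeff q I \<noteq> 0})"
        by (intro hfin_Un dset_Exps hfin_dom assms)
  qed (use pcoeff_iff(2) assms R_closed(3) in auto)
  from poly_ofI[OF this] show "poly_add mem R n p q \<in> Polys" "I \<in> Exps \<Longrightarrow>
      pcoeff (poly_add mem R n p q) I = pcoeff p I + pcoeff q I"
    unfolding poly_add_def by auto
qed

lemma poly_scale:
  assumes "c \<in> R" "q \<in> Polys"
  shows "poly_scale mem R n c q \<in> Polys" "I \<in> Exps \<Longrightarrow>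
      pcoeff (poly_scale mem R n c q) I = c * pcoeff q I"
proof -
  have "\<exists>r\<in>Polys. \<forall>I\<in>Exps. pcoeff r I = c * pcoeff q I"
  proof (rule poly_ex[where c = "\<lambda>I. c * pcoeff q I"])
    show "dfn_field [Exps] (\<lambda>e. c * pcoeff q (e 0))"
      by (intro dfn_field_intros dfn_field_pcoeff dfn_term_const' dfn_term_var) (use assms in auto)
    show "hfin Exps {I\<in>Exps. pcoeff q I \<noteq> 0}" by (intro hfin_dom assms)
  qed (use pcoeff_iff(2) assms R_closed(4) in auto)
  from poly_ofI[OF this] show "poly_scale mem R n c q \<in> Polys" "I \<in> Exps \<Longrightarrow>
      pcoeff (poly_scale mem R n c q) I = c * pcoeff q I"
    unfolding poly_scale_def by auto
qed

section \<open>Monomials and monomial multiples\<close>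

definition mono_poly :: "'k \<Rightarrow> ('k, 'f) elt \<Rightarrow> ('k, 'f) elt" where
  "mono_poly c L = poly_of mem R n (\<lambda>I. if I = L then c else 0)"

lemma mono_poly:
  assumes "c \<in> R" "L \<in> Exps"
  shows "mono_poly c L \<in> Polys" "I \<in> Exps \<Longrightarrow> pcoeff (mono_poly c L) I = (if I = L then
      c else 0)"
proof -
  have "\<exists>r\<in>Polys. \<forall>I\<in>Exps. pcoeff r I = (if I = L then c else 0)"
  proof (rule poly_ex[where c = "\<lambda>I. if I = L then c else 0"])
    have "dfn [FieldU, Exps] (\<lambda>e. (e (Suc 0) = L \<and> unel (e 0) = c) \<or>
        (e (Suc 0) \<noteq> L \<and> unel (e 0) = 0))"
      by (intro dfn_nat_intros dfn_eq[where Y = Exps and Z = Exps] dfn_term_const' dfn_field_intros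
          dfn_term_var) (use assms in auto)
    then show "dfn_field [Exps] (\<lambda>e. if e 0 = L then c else 0)"
      by (intro dfn_field_graphI) (erule dfn_congI, auto)
    show "hfin Exps {L}" by (intro hfin_single assms dset_Exps)
  qed (use assms R_closed(1) in \<open>auto split: if_splits\<close>)
  from poly_ofI[OF this] show "mono_poly c L \<in> Polys" "I \<in> Exps \<Longrightarrow>
      pcoeff (mono_poly c L) I = (if I = L then c else 0)"
    unfolding mono_poly_def by auto
qed

lemma poly_shift:
  assumes L: "L \<in> Exps" and q: "q \<in> Polys"
  shows "poly_shift mem R n L q \<in> Polys" "J \<in> Exps \<Longrightarrow>
      pcoeff (poly_shift mem R n L q) (xadd L J) = pcoeff q J"
    "I \<in> Exps \<Longrightarrow> (\<And>J. J \<in> Exps \<Longrightarrow>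
        I \<noteq> xadd L J) \<Longrightarrow> pcoeff (poly_shift mem R n L q) I = 0"
proof -
  \<comment> \<open>By \<open>xadd_cancel\<close> there is at most one such \<open>J\<close>, so the
    description is meaningful whenever \<open>L\<close> divides \<open>I\<close>. The support is
    contained in the translate of the support of \<open>q\<close> by \<open>L\<close>.\<close>
  define c where "c I = (if \<exists>J\<in>Exps. I = xadd L J then pcoeff q (THE J. J \<in> Exps \<and>
      I = xadd L J) else 0)" for I
  have c1: "c (xadd L J) = pcoeff q J" if "J \<in> Exps" for J
  proof -
    have "(THE J'. J' \<in> Exps \<and> xadd L J = xadd L J') = J"
      using that xadd_cancel[OF L] by (intro the_equality) auto
    then show ?thesis using that unfolding c_def by auto
  qed
  have c0: "c I = 0" if "\<And>J. J \<in> Exps \<Longrightarrow> I \<noteq> xadd L J" for I using that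
      unfolding c_def by auto
  have "\<exists>r\<in>Polys. \<forall>I\<in>Exps. pcoeff r I = c I"
  proof (rule poly_ex)
    have "dfn [FieldU, Exps] (\<lambda>e. (\<exists>J\<in>Exps. e (Suc 0) = xadd L J \<and>
        unel (e 0) = pcoeff q J) \<or>
       ((\<forall>J\<in>Exps. e (Suc 0) \<noteq> xadd L J) \<and> unel (e 0) = 0))"
      by (intro dfn_bex dfn_ball dfn_nat_intros dfn_eq[where Y = Exps and Z = Exps] dfn_term_xadd
          dfn_field_pcoeff dfn_term_const' dfn_field_intros dfn_term_var) (use assms in auto)
    then have "dfn [FieldU, Exps] (\<lambda>e. unel (e 0) = c (e (Suc 0)))"
    proof (rule dfn_congI)
      fix e :: "nat \<Rightarrow> ('k, 'f) elt"
      show "(unel (e 0) = c (e (Suc 0))) = ((\<exists>J\<in>Exps. e (Suc 0) = xadd L J \<and>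
          unel (e 0) = pcoeff q J) \<or>
       ((\<forall>J\<in>Exps. e (Suc 0) \<noteq> xadd L J) \<and> unel (e 0) = 0))"
        by (cases "\<exists>J\<in>Exps. e (Suc 0) = xadd L J") (auto simp: c0 c1 xadd_cancel[OF L])
    qed
    then show "dfn_field [Exps] (\<lambda>e. c (e 0))" by (intro dfn_field_graphI)
    have "dfn_term [Exps] Exps (\<lambda>e. xadd L (e 0))"
        by (intro dfn_term_xadd dfn_term_const' dfn_term_var) (use L in auto)
    then show "hfin Exps (xadd L ` {I\<in>Exps. pcoeff q I \<noteq> 0})"
        by (intro hfin_image[OF dset_Exps dset_Exps] hfin_dom q)
  next
    fix I assume I: "I \<in> Exps"
    show "c I \<in> R"
    proof (cases "\<exists>J\<in>Exps. I = xadd L J")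
      case True then show ?thesis using c1 pcoeff_iff(2)[OF q] by auto
    next
      case False then show ?thesis using c0 R_closed(1) by auto
    qed
    show "I \<in> xadd L ` {I\<in>Exps. pcoeff q I \<noteq> 0}" if "c I \<noteq> 0"
    proof (cases "\<exists>J\<in>Exps. I = xadd L J")
      case True then show ?thesis using c1 that by auto
    next
      case False then show ?thesis using c0 that by auto
    qed
  qed
  then obtain r where r: "r \<in> Polys" "\<And>I. I \<in> Exps \<Longrightarrow> pcoeff r I = c I" by blast
  have "poly_shift mem R n L q = r" unfolding poly_shift_def
  proof (rule the_equality)
    show "r \<in> Polys \<and> (\<forall>J\<in>Exps. pcoeff r (xadd L J) = pcoeff q J) \<and>
        (\<forall>I\<in>Exps - xadd L ` Exps. pcoeff r I = 0)"
      using r c1 c0 L by auto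
    fix s assume s: "s \<in> Polys \<and> (\<forall>J\<in>Exps. pcoeff s (xadd L J) = pcoeff q J) \<and>
        (\<forall>I\<in>Exps - xadd L ` Exps. pcoeff s I = 0)"
    show "s = r"
    proof (rule poly_ext)
      fix I assume "I \<in> Exps"
      then show "pcoeff s I = pcoeff r I" using s r(2) c1 c0 by (cases "I \<in> xadd L ` Exps") auto
    qed (use s r in auto)
  qed
  then show "poly_shift mem R n L q \<in> Polys" "J \<in> Exps \<Longrightarrow>
      pcoeff (poly_shift mem R n L q) (xadd L J) = pcoeff q J"
    "I \<in> Exps \<Longrightarrow> (\<And>J. J \<in> Exps \<Longrightarrow>
        I \<noteq> xadd L J) \<Longrightarrow> pcoeff (poly_shift mem R n L q) I = 0"
    using r c1 c0 L by simp_all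
qed

text \<open>The summand in one stage of the recursion for \<open>poly_mult\<close>. It stands for
  the product with \<open>c\<close> times the monomial \<open>x\<^sup>L\<close>; the two are
  identified in \<open>poly_mult_mono\<close>.\<close>

definition mono_mult :: "'k \<Rightarrow> ('k, 'f) elt \<Rightarrow> ('k, 'f) elt \<Rightarrow> ('k, 'f) elt"
    where
  "mono_mult c L q = poly_scale mem R n c (poly_shift mem R n L q)"

lemma mono_mult:
  assumes "c \<in> R" and "L \<in> Exps" and "q \<in> Polys"
  shows "mono_mult c L q \<in> Polys" "J \<in> Exps \<Longrightarrow>
      pcoeff (mono_mult c L q) (xadd L J) = c * pcoeff q J"
    "I \<in> Exps \<Longrightarrow> (\<And>J. J \<in> Exps \<Longrightarrow>
        I \<noteq> xadd L J) \<Longrightarrow> pcoeff (mono_mult c L q) I = 0"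
  unfolding mono_mult_def using poly_shift[OF assms(2,3)] poly_scale[OF assms(1)] assms(2) by simp_all

section \<open>Definability of the operations on polynomials\<close>

lemma dfn_term_poly_add: "dfn_term \<Gamma> Polys t \<Longrightarrow>
    dfn_term \<Gamma> Polys s \<Longrightarrow> dfn_term \<Gamma> Polys (\<lambda>e. poly_add mem R n (t e)
    (s e))"
proof (rule dfn_term_graph2[where f = "poly_add mem R n" and Ya = Polys and Yb = Polys])
  have "dfn [Polys, Polys, Polys] (\<lambda>e. \<forall>I\<in>Exps. pcoeff (e 0) I = pcoeff (e (Suc 0)) I +
      pcoeff (e (Suc (Suc 0))) I)"
    by (intro dfn_ball dfn_nat_intros dfn_field_intros dfn_field_pcoeff dfn_term_var) auto
  then show "dfn [Polys, Polys, Polys] (\<lambda>e. e 0 = poly_add mem R n (e (Suc 0)) (e (Suc (Suc 0))))"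
  proof (rule dfn_congI)
    fix e assume "env [Polys, Polys, Polys] e"
    then have e: "e 0 \<in> Polys" "e (Suc 0) \<in> Polys" "e (Suc (Suc 0)) \<in> Polys"
        by (simp_all add: env_Cons)
    show "(e 0 = poly_add mem R n (e (Suc 0)) (e (Suc (Suc 0)))) =
      (\<forall>I\<in>Exps. pcoeff (e 0) I = pcoeff (e (Suc 0)) I + pcoeff (e (Suc (Suc 0))) I)"
      unfolding poly_eq_iff[OF e(1) poly_add(1)[OF e(2,3)]] using poly_add(2)[OF e(2,3)] by simp
  qed
qed (auto intro: poly_add)

lemma dfn_term_mono_poly: "dfn_term \<Gamma> (el ` R) t \<Longrightarrow>
    dfn_term \<Gamma> Exps s \<Longrightarrow> dfn_term \<Gamma> Polys (\<lambda>e. mono_poly (unel (t e)) (s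
    e))"
proof (rule dfn_term_graph2[where f = "\<lambda>y. mono_poly (unel y)" and Ya = "el ` R" and Yb = Exps])
  have "dfn [Polys, el ` R, Exps] (\<lambda>e. \<forall>I\<in>Exps. (I = e (Suc (Suc 0)) \<and>
      pcoeff (e 0) I = unel (e (Suc 0))) \<or>
      (I \<noteq> e (Suc (Suc 0)) \<and> pcoeff (e 0) I = 0))"
    by (intro dfn_ball dfn_nat_intros dfn_field_intros dfn_field_pcoeff dfn_eq[where Y = Exps and Z = Exps]
        dfn_term_var) auto
  then show "dfn [Polys, el ` R, Exps] (\<lambda>e. e 0 = mono_poly (unel (e (Suc 0))) (e (Suc (Suc 0))))"
  proof (rule dfn_congI)
    fix e assume "env [Polys, el ` R, Exps] e"
    then obtain c where e: "e 0 \<in> Polys" "e (Suc 0) = el c" "c \<in> R" "e (Suc (Suc 0)) \<in> Exps"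
        by (auto simp: env_Cons)
    show "(e 0 = mono_poly (unel (e (Suc 0))) (e (Suc (Suc 0)))) =
      (\<forall>I\<in>Exps. (I = e (Suc (Suc 0)) \<and> pcoeff (e 0) I = unel (e (Suc 0))) \<or>
      (I \<noteq> e (Suc (Suc 0)) \<and> pcoeff (e 0) I = 0))"
      unfolding e(2) unel_el poly_eq_iff[OF e(1) mono_poly(1)[OF e(3,4)]] using mono_poly(2)[OF e(3,4)] by auto
  qed
qed (auto intro: mono_poly)

lemma dfn_term_mono_mult: "dfn_term \<Gamma> (el ` R) t \<Longrightarrow>
    dfn_term \<Gamma> Exps s \<Longrightarrow> dfn_term \<Gamma> Polys q \<Longrightarrow>
    dfn_term \<Gamma> Polys (\<lambda>e. mono_mult (unel (t e)) (s e) (q e))"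
proof (rule dfn_term_graph3[where f = "\<lambda>y. mono_mult (unel y)" and Ya = "el ` R"
    and Yb = Exps and Yc = Polys])
  have "dfn [Polys, el ` R, Exps, Polys] (\<lambda>e. (\<forall>J\<in>Exps. pcoeff (e 0) (xadd (e (Suc (Suc
      0))) J) = unel (e (Suc 0)) * pcoeff (e (Suc (Suc (Suc 0)))) J) \<and>
     (\<forall>I\<in>Exps. (\<forall>J\<in>Exps. I \<noteq> xadd (e (Suc (Suc 0))) J) \<longrightarrow>
         pcoeff (e 0) I = 0))"
    by (intro dfn_ball dfn_nat_intros dfn_field_intros dfn_field_pcoeff dfn_eq[where Y = Exps and Z = Exps]
        dfn_term_xadd dfn_term_var) auto
  then show "dfn [Polys, el ` R, Exps, Polys] (\<lambda>e. e 0 = mono_mult (unel (e (Suc 0))) (e (Suc (Suc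
      0))) (e (Suc (Suc (Suc 0)))))"
  proof (rule dfn_congI)
    fix e assume "env [Polys, el ` R, Exps, Polys] e"
    then obtain c where e: "e 0 \<in> Polys" "e (Suc 0) = el c" "c \<in> R" "e (Suc (Suc 0)) \<in> Exps"
        "e (Suc (Suc (Suc 0))) \<in> Polys"
      by (auto simp: env_Cons)
    let ?L = "e (Suc (Suc 0))" and ?q = "e (Suc (Suc (Suc 0)))"
    note m = mono_mult[OF e(3,4,5)]
    have "(e 0 = mono_mult c ?L ?q) \<longleftrightarrow> (\<forall>I\<in>Exps. pcoeff (e 0) I = pcoeff
        (mono_mult c ?L ?q) I)"
      by (rule poly_eq_iff[OF e(1) m(1)])
    also have "\<dots> \<longleftrightarrow> (\<forall>J\<in>Exps. pcoeff (e 0) (xadd ?L J) = c * pcoeff ?q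
        J) \<and>
       (\<forall>I\<in>Exps. (\<forall>J\<in>Exps. I \<noteq> xadd ?L J) \<longrightarrow>
           pcoeff (e 0) I = 0)" (is "?l \<longleftrightarrow> ?r")
    proof
      assume ?l then show ?r using m(2,3) e(4) by simp
    next
      assume r: ?r
      show ?l
      proof
        fix I assume "I \<in> Exps"
        then show "pcoeff (e 0) I = pcoeff (mono_mult c ?L ?q) I"
          using r m(2,3) by (cases "\<exists>J\<in>Exps. I = xadd ?L J") auto
      qed
    qed
    finally show "(e 0 = mono_mult (unel (e (Suc 0))) ?L ?q) = ((\<forall>J\<in>Exps. pcoeff (e 0) (xadd ?L
        J) = unel (e (Suc 0)) * pcoeff ?q J) \<and>
     (\<forall>I\<in>Exps. (\<forall>J\<in>Exps. I \<noteq> xadd ?L J) \<longrightarrow>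
         pcoeff (e 0) I = 0))" using e(2) by simp
  qed
qed (auto intro: mono_mult)

end

section \<open>Leading exponents and generation of ideals\<close>

context hf_poly
begin

text \<open>As \<open>c \<noteq> 0\<close>, the domain of the first factor is \<open>{L}\<close>,
  and the recursion for the product has just the stages \<open>{}\<close> and \<open>{L}\<close>. So
  its solution can be written down explicitly.\<close>

lemma poly_mult_mono:
  assumes c: "c \<in> R" "c \<noteq> 0" and L: "L \<in> Exps" and q: "q \<in> Polys"
  shows "poly_mult mem R n (mono_poly c L) q = mono_mult c L q"
proof -
  let ?p = "mono_poly c L"
  have p: "?p \<in> Polys" using mono_poly c L by blast
  have D: "poly_dom mem R n ?p = {L}" unfolding poly_dom_eq[OF p] using mono_poly(2)[OF c(1) L] c L
      by (auto split: if_splits)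
  let ?A = "{A \<in> FP Exps. elems Exps A \<subseteq> {L}}"
  obtain A0 where A0: "A0 \<in> FP Exps" "elems Exps A0 = {}" using hfin_empty[OF dset_Exps]
      unfolding hfin_def by blast
  obtain A1 where A1: "A1 \<in> FP Exps" "elems Exps A1 = {L}" using hfin_single[OF dset_Exps L]
      unfolding hfin_def by blast
  have A01: "A = A0 \<longleftrightarrow> elems Exps A = {}" if "A \<in> FP Exps" for A
    using elems_inj[OF dset_Exps that A0(1)] A0(2) by auto
  have z: "poly_zero mem R n \<in> Polys" and m: "mono_mult c L q \<in> Polys"
      using poly_zero(1) mono_mult(1)[OF c(1) L q] by simp_all
  have dA: "dset ?A"
  proof -
    have "dset {A \<in> FP Exps. \<forall>I\<in>elems Exps A. I = L}"
      by (intro dset_Collect dset_FP dfn_ball_elems dfn_eq[where Y = Exps and Z = Exps] dfn_term_const'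
          dfn_term_var) (use L in auto)
    moreover have "?A = {A \<in> FP Exps. \<forall>I\<in>elems Exps A. I = L}" by blast
    ultimately show ?thesis by simp
  qed
  have cL: "pcoeff ?p L = c" using mono_poly(2)[OF c(1) L L] by simp
  have add0: "poly_add mem R n (poly_zero mem R n) (mono_mult c L q) = mono_mult c L q"
    unfolding poly_eq_iff[OF poly_add(1)[OF z m] m] using poly_add(2)[OF z m] poly_zero(2) by simp
  \<comment> \<open>There are only two hyperfinite subsets of \<open>{L}\<close>, coded by
    \<open>A0\<close> and \<open>A1\<close>; hence a case distinction defines the recursion.\<close>
  define G where "G A = (if A = A0 then poly_zero mem R n else mono_mult c L q)" for A
  have G: "definable_fun (Keq mem) ?A Polys G"
  proof (rule definable_funI[OF _ dA])
    show "dfn_term [?A] Polys (\<lambda>e. G (e 0))"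
    proof (rule dfn_term_graph1[where f = G and Y = ?A])
      have "dfn [Polys, ?A] (\<lambda>e. (e (Suc 0) = A0 \<and> e 0 = poly_zero mem R n) \<or>
          (e (Suc 0) \<noteq> A0 \<and> e 0 = mono_mult c L q))"
        by (intro dfn_intros dfn_eq[where Y = "FP Exps" and Z = "FP Exps"] dfn_eq[where Y = Polys and Z =
            Polys] dfn_term_const' dfn_term_var)
          (use A0 z m in auto)
      then show "dfn [Polys, ?A] (\<lambda>e. e 0 = G (e (Suc 0)))" by (rule dfn_congI) (simp add: G_def)
      show "dfn_term [?A] ?A (\<lambda>e. e 0)" by (rule dfn_term_var) (use dA in auto)
    qed (use z m dA in \<open>auto simp: G_def\<close>)
  qed
  let ?P = "\<lambda>G r. definable_fun (Keq mem) ?A Polys G \<and>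
      (\<forall>A\<in>?A. elems Exps A = {} \<longrightarrow> G A = poly_zero mem R n) \<and>
      (\<forall>A\<in>?A. \<forall>B\<in>?A. \<forall>I. I \<notin> elems Exps A \<and>
          elems Exps B = elems Exps A \<union> {I} \<longrightarrow>
        G B = poly_add mem R n (G A) (poly_scale mem R n (pcoeff ?p I) (poly_shift mem R n I q))) \<and>
      (\<exists>A\<in>?A. elems Exps A = {L} \<and> r = G A)"
  have "poly_mult mem R n ?p q = (THE r. \<exists>G. ?P G r)" unfolding poly_mult_def Let_def D by simp
  also have "\<dots> = mono_mult c L q"
  proof (rule the_equality)
    have step: "G B = poly_add mem R n (G A) (poly_scale mem R n (pcoeff ?p I) (poly_shift mem R n I q))"
      if "A \<in> ?A" "B \<in> ?A" "I \<notin> elems Exps A" "elems Exps B = elems Exps A \<union> {I}"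
          for A B I
    proof -
      have I: "I = L" using that(2,4) by blast
      have A: "elems Exps A = {}" using that(1,3) I by blast
      have B: "elems Exps B = {L}" using that(4) I A by simp
      have "G A = poly_zero mem R n" using A01[of A] that(1) A by (simp add: G_def)
      moreover have "G B = mono_mult c L q" using A01[of B] that(2) B by (simp add: G_def)
      ultimately show ?thesis by (simp only: I cL mono_mult_def[symmetric] add0)
    qed
    have "A1 \<noteq> A0" using A0 A1 by auto
    then have G1: "G A1 = mono_mult c L q" by (simp add: G_def)
    have "?P G (mono_mult c L q)"
    proof (intro conjI ballI allI impI G)
      fix A assume "A \<in> ?A" "elems Exps A = {}"
      then show "G A = poly_zero mem R n" using A01[of A] by (simp add: G_def)
    next
      show "\<exists>A\<in>?A. elems Exps A = {L} \<and> mono_mult c L q = G A" using A1 G1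
          by (intro bexI[of _ A1]) simp_all
    qed (use step in blast)
    then show "\<exists>G. ?P G (mono_mult c L q)" by (rule exI[where x = G])
    \<comment> \<open>Uniqueness: any solution is the zero polynomial at \<open>A0\<close>, and the
      step from \<open>A0\<close> to \<open>{L}\<close> then determines its final value.\<close>
    fix r assume "\<exists>G. ?P G r"
    then obtain G' where Pr: "?P G' r" by (elim exE)
    note G' = Pr[THEN conjunct2, THEN conjunct1] Pr[THEN conjunct2, THEN conjunct2, THEN conjunct1]
      Pr[THEN conjunct2, THEN conjunct2, THEN conjunct2]
    obtain A where A: "A \<in> ?A" "elems Exps A = {L}" "r = G' A" using G'(3) by blast
    have A0': "A0 \<in> ?A" using A0 by simp
    have "G' A = poly_add mem R n (G' A0) (poly_scale mem R n (pcoeff ?p L) (poly_shift mem R n L q))"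
      by (rule G'(2)[rule_format, OF A0' A(1)]) (simp add: A0 A(2))
    moreover have "G' A0 = poly_zero mem R n" using G'(1) A0' A0(2) by simp
    ultimately show "r = mono_mult c L q" unfolding A(3) by (simp only: cL mono_mult_def[symmetric] add0)
  qed
  finally show ?thesis .
qed

section \<open>The lexicographic order\<close>

definition lex_less :: "('k, 'f) elt \<Rightarrow> ('k, 'f) elt \<Rightarrow> bool" where
  "lex_less I J \<longleftrightarrow> (\<exists>j\<in>seg mem n. (\<forall>i\<in>seg mem j. xval I i = xval J
      i) \<and> nle (xval I j) (xval J j) \<and> xval I j \<noteq> xval J j)"

lemma dfn_lex_less: "dfn_term \<Gamma> Exps t \<Longrightarrow> dfn_term \<Gamma> Exps s \<Longrightarrow>
    dfn \<Gamma> (\<lambda>e. lex_less (t e) (s e))"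
proof (rule dfn_comp2[where P = lex_less and Ya = Exps and Yb = Exps])
  show "dfn [Exps, Exps] (\<lambda>e. lex_less (e 0) (e (Suc 0)))"
    unfolding lex_less_def by (intro dfn_bex_seg dfn_ball_seg dfn_nat_intros dfn_field_xval dfn_field_intros
        dfn_term_var) auto
qed

lemma seg_trans: "i \<in> seg mem j \<Longrightarrow> j \<in> seg mem m \<Longrightarrow> i \<in> seg mem m"
  unfolding seg_iff using nle_trans nle_antisym by blast

lemma seg_linear: "i \<in> NN mem \<Longrightarrow> j \<in> NN mem \<Longrightarrow> i = j \<or>
    i \<in> seg mem j \<or> j \<in> seg mem i"
  unfolding seg_iff using nle_linear by blast

lemma lex_less_irrefl: "\<not> lex_less I I"
  by (simp add: lex_less_def)

text \<open>The indices at which two exponents differ form a definable set, so there is a first one,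
  and it decides the comparison.\<close>

lemma lex_less_total:
  assumes I: "I \<in> Exps" "J \<in> Exps" "I \<noteq> J"
  shows "lex_less I J \<or> lex_less J I"
proof -
  let ?S = "{i. i \<in> seg mem n \<and> xval I i \<noteq> xval J i}"
  have "dset (el ` ?S :: ('k, 'f) elt set)"
    by (intro dset_Collectk dfn_nat_intros dfn_seg dfn_field_xval dfn_field_intros dfn_term_const') (use I in
        auto)
  moreover have "?S \<subseteq> NN mem" using seg_NN by blast
  moreover have "?S \<noteq> {}" using xval_ext[OF I(1,2)] I(3) by blast
  ultimately obtain j where j: "j \<in> ?S" "\<forall>i\<in>?S. nle j i" using NN_least[of ?S] by blast
  have "xval I i = xval J i" if "i \<in> seg mem j" for i
  proof (rule ccontr)
    assume "xval I i \<noteq> xval J i"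
    then have "nle j i" using j seg_trans[OF that] by blast
    then show False using that nle_antisym unfolding seg_iff by blast
  qed
  moreover have "nle (xval I j) (xval J j) \<or> nle (xval J j) (xval I j)" using nle_linear xval_NN I by blast
  ultimately show ?thesis using j(1) unfolding lex_less_def by (metis (mono_tags, lifting) mem_Collect_eq)
qed

lemma lex_less_trans:
  assumes "lex_less I J" "lex_less J L"
  shows "lex_less I L"
proof -
  obtain a where a: "a \<in> seg mem n" "\<And>i. i \<in> seg mem a \<Longrightarrow> xval I i = xval J i"
      "nle (xval I a) (xval J a)" "xval I a \<noteq> xval J a"
    using assms(1) unfolding lex_less_def by blast
  obtain b where b: "b \<in> seg mem n" "\<And>i. i \<in> seg mem b \<Longrightarrow> xval J i = xval L i"
      "nle (xval J b) (xval L b)" "xval J b \<noteq> xval L b"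
    using assms(2) unfolding lex_less_def by blast
  consider "a = b" | "a \<in> seg mem b" | "b \<in> seg mem a" using seg_linear[OF seg_NN[OF a(1)] seg_NN[OF
      b(1)]] by blast
  then show ?thesis
  proof cases
    case 1
    have "nle (xval I a) (xval L a)" using a(3) b(3) 1 nle_trans by blast
    moreover have "xval I a \<noteq> xval L a" using a(3,4) b(3) 1 nle_antisym by metis
    moreover have "xval I i = xval L i" if "i \<in> seg mem a" for i using a(2)[OF that] b(2) that 1 by simp
    ultimately show ?thesis unfolding lex_less_def using a(1) by blast
  next
    case 2
    then have "nle (xval I a) (xval L a)" "xval I a \<noteq> xval L a" using a(3,4) b(2)[OF 2] by simp_all
    moreover have "xval I i = xval L i" if "i \<in> seg mem a" for i using a(2)[OF that] b(2)[OF seg_trans[OF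
        that 2]] by simp
    ultimately show ?thesis unfolding lex_less_def using a(1) by blast
  next
    case 3
    then have "nle (xval I b) (xval L b)" "xval I b \<noteq> xval L b" using b(3,4) a(2)[OF 3] by simp_all
    moreover have "xval I i = xval L i" if "i \<in> seg mem b" for i using b(2)[OF that] a(2)[OF seg_trans[OF
        that 3]] by simp
    ultimately show ?thesis unfolding lex_less_def using b(1) by blast
  qed
qed

lemma lex_less_add:
  assumes "L \<in> Exps" "I \<in> Exps" "J \<in> Exps" "lex_less I J"
  shows "lex_less (xadd L I) (xadd L J)"
  using assms(4) unfolding lex_less_def xval_xadd[OF assms(1,2)] xval_xadd[OF assms(1,3)] by (simp add: nle_def)

text \<open>The least element is found one coordinate at a time, by an induction on the number
  \<open>k\<close> of coordinates for a predicate in which \<open>U\<close> is a fixed parameter.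
  This replaces well-foundedness of the order.\<close>

lemma lex_less_least:
  assumes U: "dset U" "U \<subseteq> Exps" "U \<noteq> {}"
  shows "\<exists>s\<in>U. \<forall>u\<in>U. u \<noteq> s \<longrightarrow> lex_less s u"
proof -
  \<comment> \<open>Restricted to the first \<open>k\<close> coordinates, \<open>s\<close> is equal
    to \<open>u\<close> or lexicographically smaller.\<close>
  define Q where "Q k s u \<longleftrightarrow> (\<forall>i\<in>seg mem k. xval s i = xval u i) \<or>
    (\<exists>j\<in>seg mem k. (\<forall>i\<in>seg mem j. xval s i = xval u i) \<and>
        nle (xval s j) (xval u j) \<and> xval s j \<noteq> xval u j)" for k s u
  have "\<exists>s\<in>U. \<forall>u\<in>U. Q n s u" using nN
  proof (induction n rule: NN_induct)
    case dfn
    show ?case unfolding Q_def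
      by (intro dfn_bex dfn_ball dfn_bex_seg dfn_ball_seg dfn_nat_intros dfn_field_xval dfn_field_intros
          dfn_term_var) (use U in auto)
  next
    case 0
    then show ?case using U(3) unfolding Q_def by auto
  next
    case (Suc k)
    then obtain s where s: "s \<in> U" "\<And>u. u \<in> U \<Longrightarrow> Q k s u" by blast
    \<comment> \<open>Among the members of \<open>U\<close> that share the first \<open>k\<close>
      coordinates with \<open>s\<close>, one with the least coordinate at \<open>k\<close> is
      minimal for \<open>k + 1\<close> coordinates.\<close>
    let ?S = "{a. \<exists>u\<in>U. (\<forall>i\<in>seg mem k. xval s i = xval u i) \<and> a = xval u k}"
    have "dset (el ` ?S :: ('k, 'f) elt set)"
      by (intro dset_Collectk dfn_bex dfn_ball_seg dfn_nat_intros dfn_field_xval dfn_field_intros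
          dfn_term_const' dfn_term_var) (use U s in auto)
    moreover have "?S \<subseteq> NN mem" using U(2) by auto
    moreover have "?S \<noteq> {}" using s(1) by auto
    ultimately obtain a where a: "a \<in> ?S" "\<forall>b\<in>?S. nle a b" using NN_least[of ?S] by blast
    then obtain t where t: "t \<in> U" "\<And>i. i \<in> seg mem k \<Longrightarrow> xval s i = xval t i"
        "a = xval t k" by blast
    have "Q (k + 1) t u" if u: "u \<in> U" for u
    proof (cases "\<forall>i\<in>seg mem k. xval s i = xval u i")
      case True
      then have "nle (xval t k) (xval u k)" using a(2) t(3) u by blast
      moreover have "\<forall>i\<in>seg mem k. xval t i = xval u i" using True t(2) by simp
      ultimately show ?thesis unfolding Q_def seg_Suc[OF Suc.hyps] by auto
    next
      case False
      then obtain j where j: "j \<in> seg mem k" "\<forall>i\<in>seg mem j. xval s i = xval u i"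
          "nle (xval s j) (xval u j)" "xval s j \<noteq> xval u j"
        using s(2)[OF u] unfolding Q_def by blast
      have "\<forall>i\<in>seg mem j. xval t i = xval u i" using j(2) t(2) seg_trans[OF _ j(1)] by metis
      moreover have "xval s j = xval t j" using t(2) j(1) by simp
      ultimately show ?thesis using j unfolding Q_def seg_Suc[OF Suc.hyps] by auto
    qed
    with t(1) show ?case by blast
  qed
  then obtain s where s: "s \<in> U" "\<forall>u\<in>U. Q n s u" by blast
  have "lex_less s u" if u: "u \<in> U" "u \<noteq> s" for u
  proof -
    have "\<not> (\<forall>i\<in>seg mem n. xval s i = xval u i)" using xval_ext[of s u] u s(1) U(2) by blast
    then show ?thesis using s(2) u(1) unfolding Q_def lex_less_def by blast
  qed
  with s(1) show ?thesis by blast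
qed

lemma lex_less_max:
  assumes D: "hfin Exps D" and ne: "D \<noteq> {}"
  shows "\<exists>s\<in>D. \<forall>u\<in>D. u \<noteq> s \<longrightarrow> lex_less u s"
proof -
  \<comment> \<open>Emptiness is written as a bounded quantifier, so that the rules for quantifiers
    over hyperfinite sets apply to the induction predicate.\<close>
  have "(\<forall>x\<in>D. False) \<or> (\<exists>s\<in>D. \<forall>u\<in>D. u \<noteq> s \<longrightarrow>
      lex_less u s) \<and> D \<subseteq> Exps"
  proof (rule hfin_induct[OF dset_Exps D])
    have "dfn [FP Exps] (\<lambda>e. (\<forall>x\<in>elems Exps (e 0). False) \<or>
        (\<exists>s\<in>elems Exps (e 0). \<forall>u\<in>elems Exps (e 0). u \<noteq> s \<longrightarrow>
        lex_less u s))"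
      by (intro dfn_ball_elems dfn_bex_elems dfn_intros dfn_lex_less dfn_const dfn_eq[where Y = Exps and Z =
          Exps] dfn_term_var) auto
    then show "dfn [FP Exps] (\<lambda>e. (\<forall>x\<in>elems Exps (e 0). False) \<or>
       (\<exists>s\<in>elems Exps (e 0). \<forall>u\<in>elems Exps (e 0). u \<noteq> s \<longrightarrow>
           lex_less u s) \<and> elems Exps (e 0) \<subseteq> Exps)"
      using elems_sub[OF dset_Exps] by simp
    fix S x assume S: "hfin Exps S" "(\<forall>x\<in>S. False) \<or>
        (\<exists>s\<in>S. \<forall>u\<in>S. u \<noteq> s \<longrightarrow> lex_less u s) \<and>
        S \<subseteq> Exps" "x \<in> Exps"
    have "\<exists>s\<in>insert x S. \<forall>u\<in>insert x S. u \<noteq> s \<longrightarrow> lex_less u s"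
    proof (cases "\<forall>x\<in>S. False")
      case False
      then obtain s where s: "s \<in> S" "\<And>u. u \<in> S \<Longrightarrow> u \<noteq> s \<Longrightarrow>
          lex_less u s" "S \<subseteq> Exps" using S(2) by blast
      consider "x = s" | "lex_less x s" | "lex_less s x" using lex_less_total[OF S(3), of s] s by blast
      then show ?thesis
      proof cases
        case 3
        then have "lex_less u x" if "u \<in> S" for u using s(2)[OF that] lex_less_trans by metis
        then show ?thesis by blast
      qed (use s in blast)+
    qed blast
    moreover have "insert x S \<subseteq> Exps" using S hfin_sub[OF dset_Exps] by blast
    ultimately show "(\<forall>x\<in>insert x S. False) \<or>
      (\<exists>s\<in>insert x S. \<forall>u\<in>insert x S. u \<noteq> s \<longrightarrow>
          lex_less u s) \<and> insert x S \<subseteq> Exps" by blast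
  qed blast
  with ne show ?thesis by blast
qed

section \<open>Leading exponents\<close>

definition Nonzero :: "('k, 'f) elt set" where
  "Nonzero = {p\<in>Polys. \<exists>I\<in>Exps. pcoeff p I \<noteq> 0}"

lemma dset_Nonzero [simp]: "dset Nonzero"
  unfolding Nonzero_def by (intro dset_Collect dset_Polys dfn_bex dfn_intros dfn_field_pcoeff
      dfn_field_intros dfn_term_var) auto

definition is_lead :: "('k, 'f) elt \<Rightarrow> ('k, 'f) elt \<Rightarrow> bool" where
  "is_lead p I \<longleftrightarrow> I \<in> Exps \<and> pcoeff p I \<noteq> 0 \<and>
      (\<forall>J\<in>Exps. pcoeff p J \<noteq> 0 \<longrightarrow> J \<noteq> I \<longrightarrow>
      lex_less J I)"

definition lead :: "('k, 'f) elt \<Rightarrow> ('k, 'f) elt" where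
  "lead p = (THE I. is_lead p I)"

lemma lead: "p \<in> Nonzero \<Longrightarrow> is_lead p (lead p)" and lead_unique: "p \<in> Nonzero
    \<Longrightarrow> is_lead p I \<longleftrightarrow> I = lead p"
proof -
  have un: "I = J" if "is_lead p I" "is_lead p J" for I J
    using that lex_less_trans lex_less_irrefl unfolding is_lead_def by metis
  assume p: "p \<in> Nonzero"
  then have "hfin Exps {I\<in>Exps. pcoeff p I \<noteq> 0}" "{I\<in>Exps. pcoeff p I \<noteq> 0} \<noteq> {}"
      using hfin_dom unfolding Nonzero_def by auto
  from lex_less_max[OF this] obtain I' where "is_lead p I'" unfolding is_lead_def by blast
  then have *: "\<exists>!I. is_lead p I" using un by blast
  from theI'[OF *] show "is_lead p (lead p)" unfolding lead_def .
  with un show "is_lead p I \<longleftrightarrow> I = lead p" by blast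
qed

lemma lead_Exps [simp]: "p \<in> Nonzero \<Longrightarrow> lead p \<in> Exps"
  using lead unfolding is_lead_def by blast

lemma dfn_term_lead: "dfn_term \<Gamma> Nonzero t \<Longrightarrow> dfn_term \<Gamma> Exps (\<lambda>e. lead
    (t e))"
proof (rule dfn_term_graph1[where f = lead and Y = Nonzero])
  have "dfn [Exps, Nonzero] (\<lambda>e. is_lead (e (Suc 0)) (e 0))"
    unfolding is_lead_def
    by (intro dfn_ball dfn_intros dfn_lex_less dfn_field_pcoeff dfn_field_intros dfn_mem[where Z = Exps]
        dfn_eq[where Y = Exps and Z = Exps] dfn_term_var)
      (auto simp: Nonzero_def)
  then show "dfn [Exps, Nonzero] (\<lambda>e. e 0 = lead (e (Suc 0)))"
    by (rule dfn_congI) (simp add: env_Cons lead_unique)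
qed auto

text \<open>Evaluates the description in \<open>hf_sum\<close> from a definable function of partial
  sums: two such functions agree by induction, which is available because both are
  definable.\<close>

lemma hf_sumI:
  assumes m: "m \<in> NN mem" and S: "dfn_term [el ` seg mem (m + 1)] Polys (\<lambda>e. S (e 0))"
    and S0: "S (el 0) = poly_zero mem R n"
    and S1: "\<And>k. k \<in> seg mem m \<Longrightarrow> S (el (k + 1)) = poly_add mem R n (S (el k)) (s k)"
  shows "hf_sum mem R n m s = S (el m)"
proof -
  let ?T = "seg mem m \<union> {m}"
  have T: "?T = seg mem (m + 1)" using seg_Suc[OF m] by simp
  show ?thesis unfolding hf_sum_def T
  proof (rule the_equality)
    have "definable_fun (Keq mem) (el ` seg mem (m + 1)) Polys S" by (rule definable_funI[OF S]) simp
    then show "\<exists>S'. definable_fun (Keq mem) (el ` seg mem (m + 1)) Polys S' \<and>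
        S' (el 0) = poly_zero mem R n \<and>
       (\<forall>k\<in>seg mem m. S' (el (k + 1)) = poly_add mem R n (S' (el k)) (s k)) \<and>
           S (el m) = S' (el m)"
      using S0 S1 by blast
    fix r assume "\<exists>S'. definable_fun (Keq mem) (el ` seg mem (m + 1)) Polys S' \<and>
        S' (el 0) = poly_zero mem R n \<and>
       (\<forall>k\<in>seg mem m. S' (el (k + 1)) = poly_add mem R n (S' (el k)) (s k)) \<and> r = S' (el m)"
    then obtain S' where S': "definable_fun (Keq mem) (el ` seg mem (m + 1)) Polys S'"
        "S' (el 0) = poly_zero mem R n"
      "\<And>k. k \<in> seg mem m \<Longrightarrow> S' (el (k + 1)) = poly_add mem R n (S' (el k)) (s k)"
          "r = S' (el m)" by blast
    note S'd = definable_funD[OF S'(1)]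
    \<comment> \<open>The functions \<open>S\<close> and \<open>S'\<close> are definable terms over
      the segment, while the induction variable runs through all of \<open>NN mem\<close>; hence the
      detour through an element \<open>j\<close> of the segment equal to it.\<close>
    have "\<forall>j\<in>seg mem (m + 1). j = m \<longrightarrow> S (el j) = S' (el j)" using m
    proof (induction m rule: NN_induct[where P = "\<lambda>k. \<forall>j\<in>seg mem (m + 1). j = k
        \<longrightarrow> S (el j) = S' (el j)"])
      case dfn
      have "dfn [NatU] (\<lambda>e. \<forall>y\<in>el ` seg mem (m + 1). y = e 0 \<longrightarrow> S y = S' y)"
        by (intro dfn_ball dfn_imp dfn_eq[where Y = FieldU and Z = FieldU] dfn_eq[where Y = Polys and Z = Polys]
          dfn_term_comp1[OF S] dfn_term_comp1[OF S'd] dfn_term_var) auto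
      then show ?case by (rule dfn_congI) (auto simp: env_Cons)
    next
      case 0
      then show ?case using S0 S'(2) by simp
    next
      case (Suc k)
      show ?case
      proof (intro ballI impI)
        fix j assume j: "j \<in> seg mem (m + 1)" "j = k + 1"
        then have km: "k \<in> seg mem m" using Suc(1) nle_add[of k 1 m] unfolding seg_iff by auto
        then have "k \<in> seg mem (m + 1)" unfolding seg_Suc[OF m] by blast
        then have "S (el k) = S' (el k)" using Suc(2) by blast
        then show "S (el j) = S' (el j)" using S1[OF km] S'(3)[OF km] j(2) by simp
      qed
    qed
    moreover have "m \<in> seg mem (m + 1)" unfolding seg_Suc[OF m] by simp
    ultimately show "r = S (el m)" using S'(4) by simp
  qed
qed

text \<open>\<open>F\<close> comes from the axiom of choice, but by uniqueness its graph coincides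
  with \<open>Q\<close> and is therefore definable.\<close>

lemma dfn_term_THE:
  assumes Q: "dfn [Polys, NatU] (\<lambda>e. Q (unel (e (Suc 0))) (e 0))"
    and un: "\<And>k. k \<in> NN mem \<Longrightarrow> \<exists>y\<in>Polys. \<forall>z\<in>Polys. Q k z
        \<longleftrightarrow> z = y"
  obtains F where "dfn_term [NatU] Polys (\<lambda>e. F (unel (e 0)))"
      "\<And>k. k \<in> NN mem \<Longrightarrow> F k \<in> Polys"
    "\<And>k z. k \<in> NN mem \<Longrightarrow> z \<in> Polys \<Longrightarrow> Q k z \<longleftrightarrow>
        z = F k"
proof -
  have "\<forall>k\<in>NN mem. \<exists>y. y \<in> Polys \<and>
      (\<forall>z\<in>Polys. Q k z \<longleftrightarrow> z = y)" using un by blast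
  then obtain F where F: "\<forall>k\<in>NN mem. F k \<in> Polys \<and>
      (\<forall>z\<in>Polys. Q k z \<longleftrightarrow> z = F k)" by (rule bchoice[THEN exE])
  have "dfn [Polys, NatU] (\<lambda>e. e 0 = F (unel (e (Suc 0))))"
    by (rule dfn_congI[OF Q]) (use F in \<open>auto simp: env_Cons\<close>)
  then have "dfn_term [NatU] Polys (\<lambda>e. F (unel (e 0)))"
    unfolding dfn_term_def using F by (auto simp: env_Cons)
  with F show ?thesis by (intro that) simp_all
qed

section \<open>Hyperfinite combinations as a definable predicate\<close>

abbreviation R0 :: "'k set" where "R0 \<equiv> R - {0}"

lemma dset_R0 [simp]: "dset (el ` R0 :: ('k, 'f) elt set)"
proof -
  have "dset (el ` {x. x \<in> R \<and> x \<noteq> 0} :: ('k, 'f) elt set)"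
    by (intro dset_Collectk dfn_intros dfn_memk Rd dfn_field_intros) auto
  then show ?thesis by (simp add: set_diff_eq)
qed

text \<open>A row \<open>(k, g, c, L)\<close> says that the summand at place \<open>k\<close> is
  \<open>g\<close> multiplied by \<open>c\<close> and by the monomial
  \<open>x\<^sup>L\<close>.\<close>

definition Step_tuples :: "('k, 'f) elt set \<Rightarrow> ('k, 'f) elt set" where
  "Step_tuples J = times_set NatU (times_set J (times_set (el ` R0) Exps))"

text \<open>A row \<open>(k, s)\<close> says that the sum of the summands at places below
  \<open>k\<close> is \<open>s\<close>.\<close>

definition Sum_pairs :: "('k, 'f) elt set" where
  "Sum_pairs = times_set NatU Polys"

lemma dset_Step_tuples [simp]: "dset J \<Longrightarrow> dset (Step_tuples J)"
  unfolding Step_tuples_def by (intro dset_times) simp_all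

lemma dset_Sum_pairs [simp]: "dset Sum_pairs"
  unfolding Sum_pairs_def by (intro dset_times) simp_all

text \<open>
  The sequences \<open>g\<^sub>k\<close>, \<open>c\<^sub>k\<close>, \<open>x\<^sup>L\<close> and the partial sums are kept as subsets of products with all of
  \<open>NN mem\<close>: the sets \<open>fpow\<close> of the products with \<open>seg mem m\<close> are chosen for each \<open>m\<close> separately, so that a
  quantifier over them would not be definable uniformly in \<open>m\<close>.
\<close>

definition steps :: "('k, 'f) elt set \<Rightarrow> 'k \<Rightarrow> ('k, 'f) elt set \<Rightarrow> bool" where
  "steps J m S1 \<longleftrightarrow>
     (\<forall>k\<in>seg mem m. \<exists>g\<in>J. \<exists>c\<in>R0. \<exists>L\<in>Exps. el k @ g @ el c @ L
         \<in> S1) \<and>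
     (\<forall>k\<in>NN mem. \<forall>g\<in>J. \<forall>c\<in>R0. \<forall>L\<in>Exps. el k @ g @ el c @ L
         \<in> S1 \<longrightarrow>
        k \<in> seg mem m \<and> (\<forall>g'\<in>J. \<forall>c'\<in>R0. \<forall>L'\<in>Exps. el k @ g' @ el
            c' @ L' \<in> S1 \<longrightarrow> g' @ el c' @ L' = g @ el c @ L))"

definition partial_sums :: "('k, 'f) elt set \<Rightarrow> 'k \<Rightarrow> ('k, 'f) elt set \<Rightarrow>
    ('k, 'f) elt set \<Rightarrow> ('k, 'f) elt \<Rightarrow> bool" where
  "partial_sums J m S1 S2 f \<longleftrightarrow>
     (\<forall>k\<in>seg mem (m + 1). \<exists>s\<in>Polys. el k @ s \<in> S2) \<and>
     (\<forall>k\<in>NN mem. \<forall>s\<in>Polys. el k @ s \<in> S2 \<longrightarrow>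
         k \<in> seg mem (m + 1) \<and> (\<forall>s'\<in>Polys. el k @ s' \<in> S2 \<longrightarrow>
         s' = s)) \<and>
     el 0 @ poly_zero mem R n \<in> S2 \<and> el m @ f \<in> S2 \<and>
     (\<forall>k\<in>seg mem m. \<forall>g\<in>J. \<forall>c\<in>R0. \<forall>L\<in>Exps.
         \<forall>s\<in>Polys. el k @ g @ el c @ L \<in> S1 \<longrightarrow>
         el k @ s \<in> S2 \<longrightarrow>
        el (k + 1) @ poly_add mem R n s (mono_mult c L g) \<in> S2)"

text \<open>Existence of the two tables for \<open>f\<close>, with quantifiers over elements of
  power sets instead of hyperfinite sets, which makes it first-order. The coefficients are single
  monomials, but the same \<open>g\<close> may occur at several places.\<close>

definition represented :: "('k, 'f) elt set \<Rightarrow> ('k, 'f) elt \<Rightarrow> bool" where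
  "represented J f \<longleftrightarrow> (\<exists>m\<in>NN mem. \<exists>q1\<in>FP (Step_tuples J).
      \<exists>q2\<in>FP Sum_pairs. steps J m (elems (Step_tuples J) q1) \<and>
      partial_sums J m (elems (Step_tuples J) q1) (elems Sum_pairs q2) f)"

lemma represented_iff: "represented J f \<longleftrightarrow> (\<exists>m\<in>NN mem. \<exists>S1 S2. hfin
    (Step_tuples J) S1 \<and> hfin Sum_pairs S2 \<and> steps J m S1 \<and> partial_sums J m S1 S2 f)"
  unfolding represented_def hfin_def by blast

text \<open>Because of this the leading exponents of the elements that are not represented form a
  definable set, and a least one can be chosen.\<close>

lemma dfn_represented:
  assumes J: "dset J" "J \<subseteq> Polys" and t: "dfn_term \<Gamma> Polys t"
  shows "dfn \<Gamma> (\<lambda>e. represented J (t e))"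
proof (rule dfn_comp1[OF _ t])
  let ?Z = "times_set J (times_set FieldU Exps)"
  have Z: "dset ?Z" by (intro dset_times J) simp_all
  have 1: "dfn [FieldU, FP (Step_tuples J)] (\<lambda>e. steps J (unel (e 0)) (elems (Step_tuples J) (e (Suc
      0))))"
    unfolding steps_def
    by (intro dfn_ball_seg dfn_ball dfn_bex dfn_nat_intros dfn_ballk[OF dset_R0] dfn_bexk[OF dset_R0] dfn_seg
        J dset_Exps
      dfn_xt'[where Z = "times_set FieldU ?Z"] dfn_eq[where Y = ?Z and Z = ?Z] dfn_term_append dfn_term_el
          dfn_field_intros dfn_term_var)
      (use J Z in auto)
  have 2: "dfn [FieldU, FP (Step_tuples J), FP Sum_pairs, Polys] (\<lambda>e. partial_sums J (unel (e 0))
      (elems (Step_tuples J) (e (Suc 0))) (elems Sum_pairs (e (Suc (Suc 0)))) (e (Suc (Suc (Suc 0)))))"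
    unfolding partial_sums_def
  proof (intro dfn_conj)
    show "dfn [FieldU, FP (Step_tuples J), FP Sum_pairs, Polys] (\<lambda>e. \<forall>k\<in>seg mem (unel (e
        0)). \<forall>g\<in>J. \<forall>c\<in>R0. \<forall>L\<in>Exps. \<forall>s\<in>Polys.
        el k @ g @ el c @ L \<in> elems (Step_tuples J) (e (Suc 0)) \<longrightarrow>
            el k @ s \<in> elems Sum_pairs (e (Suc (Suc 0))) \<longrightarrow>
        el (k + 1) @ poly_add mem R n s (mono_mult c L g) \<in> elems Sum_pairs (e (Suc (Suc 0))))"
      by (intro dfn_ball_seg dfn_ball dfn_nat_intros dfn_ballk[OF dset_R0] J dset_Exps dset_Polys
       dfn_xt'[where V = Sum_pairs and Z = "times_set FieldU Polys"] dfn_xt'[where V = "Step_tuples J"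
           and Z = "times_set FieldU ?Z"] dfn_term_append
       dfn_term_el dfn_term_poly_add dfn_term_mono_mult dfn_field_intros dfn_term_var)
       (use J Z in auto)
  qed (intro dfn_ball_seg dfn_ball dfn_bex dfn_nat_intros dfn_seg dset_Polys dfn_xt'[where Z = "times_set
      FieldU Polys"]
       dfn_eq[where Y = Polys and Z = Polys] dfn_term_append dfn_term_el dfn_field_intros dfn_term_var
           dfn_term_const'; use J poly_zero(1) in auto)+
  show "dfn [Polys] (\<lambda>e. represented J (e 0))" unfolding represented_def
  proof (intro dfn_bexk[OF dsetNN] dfn_bex dfn_conj)
    show "dset (FP (Step_tuples J))" "dset (FP Sum_pairs)" using J by simp_all
    show "dfn [FP Sum_pairs, FP (Step_tuples J), NatU, Polys] (\<lambda>e. steps J (unel (e (Suc (Suc 0))))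
        (elems (Step_tuples J) (e (Suc 0))))"
      by (rule dfn_comp2[where P = "\<lambda>m q. steps J (unel m) (elems (Step_tuples J) q)", OF 1]) (use J
          in \<open>auto intro!: dfn_term_var\<close>)
    show "dfn [FP Sum_pairs, FP (Step_tuples J), NatU, Polys] (\<lambda>e. partial_sums J (unel (e (Suc (Suc
        0)))) (elems (Step_tuples J) (e (Suc 0))) (elems Sum_pairs (e 0)) (e (Suc (Suc (Suc 0)))))"
      by (rule dfn_comp4[where P = "\<lambda>m q q' f. partial_sums J (unel m) (elems (Step_tuples J) q)
          (elems Sum_pairs q') f", OF 2]) (use J in \<open>auto intro!: dfn_term_var\<close>)
  qed
qed

text \<open>The empty sum: no summand, and one partial sum, at place 0.\<close>

lemma represented_zero:
  assumes J: "dset J"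
  shows "represented J (poly_zero mem R n)"
proof -
  have "el 0 @ poly_zero mem R n \<in> Sum_pairs" unfolding Sum_pairs_def using poly_zero(1)
      by (intro append_mem_times) auto
  then have "hfin Sum_pairs {el 0 @ poly_zero mem R n}" by (intro hfin_single dset_Sum_pairs)
  moreover have "hfin (Step_tuples J) {}" using J by simp
  moreover have "steps J 0 {}" by (simp add: steps_def)
  moreover have "seg mem (0 + 1) = {0}" using seg_Suc[OF NN_0] by simp
  then have "partial_sums J 0 {} {el 0 @ poly_zero mem R n} (poly_zero mem R n)"
    using poly_zero(1) by (auto simp: partial_sums_def el_append)
  ultimately show ?thesis unfolding represented_iff using NN_0 by blast
qed

text \<open>One row is appended to each table: the new summand at place \<open>m\<close> and the new
  total at place \<open>m + 1\<close>. The rest is checking that both tables remain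
  single-valued.\<close>

lemma represented_step:
  assumes J: "dset J" "J \<subseteq> Polys" and f: "represented J f" "f \<in> Polys" and g: "g \<in> J"
      and c: "c \<in> R0" and L: "L \<in> Exps"
  shows "represented J (poly_add mem R n f (mono_mult c L g))"
proof -
  obtain m S1 S2 where m: "m \<in> NN mem" and S1: "hfin (Step_tuples J) S1" and S2: "hfin Sum_pairs S2"
    and st: "steps J m S1" and su: "partial_sums J m S1 S2 f" using f(1) unfolding represented_iff by blast
  let ?f = "poly_add mem R n f (mono_mult c L g)"
  have gP: "g \<in> Polys" using g J by blast
  have fP: "?f \<in> Polys" using poly_add(1) mono_mult(1) f(2) gP c L by blast
  let ?p1 = "el m @ g @ el c @ L" and ?p2 = "el (m + 1) @ ?f"
  have p1: "?p1 \<in> Step_tuples J" unfolding Step_tuples_def using m g c L by (intro append_mem_times) auto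
  have p2: "?p2 \<in> Sum_pairs" unfolding Sum_pairs_def using NN_Suc[OF m] fP by (intro append_mem_times) auto
  have mm: "m \<notin> seg mem m" "m + 1 \<notin> seg mem (m + 1)" by (simp_all add: seg_iff)
  note sm = seg_Suc[OF m] seg_Suc[OF NN_Suc[OF m]]
  have i1: "el k @ g' @ el c' @ L' = ?p1 \<longleftrightarrow> k = m \<and> g' = g \<and> c' = c \<and>
      L' = L" if "g' \<in> J" for k g' c' L'
    using append_inj_dset[OF J(1) that g] by (simp add: el_append)
  have i2: "el k @ s = ?p2 \<longleftrightarrow> k = m + 1 \<and> s = ?f" for k s by (simp add: el_append)
  have st1: "\<exists>g\<in>J. \<exists>c\<in>R0. \<exists>L\<in>Exps. el k @ g @ el c @ L \<in> S1"
      if "k \<in> seg mem m" for k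
    using st that unfolding steps_def by blast
  have st2: "k \<in> seg mem m" if "el k @ g @ el c @ L \<in> S1" "k \<in> NN mem" "g \<in> J" "c \<in> R0"
      "L \<in> Exps" for k g c L
    using st that unfolding steps_def by blast
  have st3: "g' @ el c' @ L' = g @ el c @ L"
    if "el k @ g @ el c @ L \<in> S1" "k \<in> NN mem" "g \<in> J" "c \<in> R0" "L \<in> Exps"
      "el k @ g' @ el c' @ L' \<in> S1" "g' \<in> J" "c' \<in> R0" "L' \<in> Exps" for k g c L g' c' L'
    using st that unfolding steps_def by blast
  have su1: "\<exists>s\<in>Polys. el k @ s \<in> S2" if "k \<in> seg mem (m + 1)" for k using su that
      unfolding partial_sums_def by blast
  have su2: "k \<in> seg mem (m + 1)" if "el k @ s \<in> S2" "k \<in> NN mem" "s \<in> Polys" for k s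
    using su that unfolding partial_sums_def by blast
  have su3: "s' = s" if "el k @ s \<in> S2" "k \<in> NN mem" "s \<in> Polys" "el k @ s' \<in> S2"
      "s' \<in> Polys" for k s s'
    using su that unfolding partial_sums_def by blast
  have su4: "el 0 @ poly_zero mem R n \<in> S2" "el m @ f \<in> S2" using su unfolding partial_sums_def
      by blast+
  have su5: "el (k + 1) @ poly_add mem R n s (mono_mult c L g) \<in> S2"
    if "k \<in> seg mem m" "g \<in> J" "c \<in> R0" "L \<in> Exps" "s \<in> Polys"
        "el k @ g @ el c @ L \<in> S1" "el k @ s \<in> S2" for k g c L s
    using su that unfolding partial_sums_def by blast
  have "steps J (m + 1) (insert ?p1 S1)"
    unfolding steps_def
  proof (intro conjI ballI impI)
    fix k assume "k \<in> seg mem (m + 1)"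
    then show "\<exists>g'\<in>J. \<exists>c'\<in>R0. \<exists>L'\<in>Exps. el k @ g' @ el c' @ L' \<in>
        insert ?p1 S1"
      unfolding sm using st1[of k] g c L by blast
  next
    fix k g' c' L' assume a: "k \<in> NN mem" "g' \<in> J" "c' \<in> R0" "L' \<in> Exps"
        "el k @ g' @ el c' @ L' \<in> insert ?p1 S1"
    show "k \<in> seg mem (m + 1)" unfolding sm using a i1[OF a(2)] st2 by blast
    fix g2 c2 L2 assume b: "g2 \<in> J" "c2 \<in> R0" "L2 \<in> Exps" "el k @ g2 @ el c2 @ L2 \<in> insert
        ?p1 S1"
    show "g2 @ el c2 @ L2 = g' @ el c' @ L'"
    proof (cases "k = m")
      case True
      \<comment> \<open>The rows of \<open>S1\<close> have places in \<open>seg mem m\<close>, so at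
        place \<open>m\<close> there is only the new one.\<close>
      then have "el k @ g' @ el c' @ L' = ?p1" "el k @ g2 @ el c2 @ L2 = ?p1" using a b st2 mm by blast+
      then show ?thesis unfolding i1[OF a(2)] i1[OF b(1)] by simp
    next
      case False
      then have "el k @ g' @ el c' @ L' \<in> S1" "el k @ g2 @ el c2 @ L2 \<in> S1"
        using a(5) b(4) i1[OF a(2)] i1[OF b(1)] by blast+
      then show ?thesis using st3 a b by blast
    qed
  qed
  moreover have "partial_sums J (m + 1) (insert ?p1 S1) (insert ?p2 S2) ?f"
    unfolding partial_sums_def
  proof (intro conjI ballI impI)
    fix k assume "k \<in> seg mem (m + 1 + 1)"
    then show "\<exists>s\<in>Polys. el k @ s \<in> insert ?p2 S2" unfolding sm(2) using su1[of k] fP by blast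
  next
    fix k s assume a: "k \<in> NN mem" "s \<in> Polys" "el k @ s \<in> insert ?p2 S2"
    show "k \<in> seg mem (m + 1 + 1)" unfolding sm(2) using a i2 su2 by blast
    fix s' assume b: "s' \<in> Polys" "el k @ s' \<in> insert ?p2 S2"
    show "s' = s"
    proof (cases "k = m + 1")
      case True
      then have "el k @ s = ?p2" "el k @ s' = ?p2" using a b su2 mm by blast+
      then show ?thesis unfolding i2 by simp
    next
      case False
      then have "el k @ s \<in> S2" "el k @ s' \<in> S2" using a(3) b(2) i2 by blast+
      then show ?thesis using su3 a b by blast
    qed
  next
    fix k g' c' L' s
    assume a: "k \<in> seg mem (m + 1)" "g' \<in> J" "c' \<in> R0" "L' \<in> Exps" "s \<in> Polys"
      "el k @ g' @ el c' @ L' \<in> insert ?p1 S1" "el k @ s \<in> insert ?p2 S2"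
    have kN: "k \<in> NN mem" using a(1) seg_NN by blast
    have "k \<noteq> m + 1" using a(1) mm by blast
    then have s: "el k @ s \<in> S2" using a(7) i2 by blast
    show "el (k + 1) @ poly_add mem R n s (mono_mult c' L' g') \<in> insert ?p2 S2"
    proof (cases "k = m")
      case True
      then have "el k @ g' @ el c' @ L' = ?p1" using a st2 mm kN by blast
      then have e: "g' = g" "c' = c" "L' = L" unfolding i1[OF a(2)] by simp_all
      \<comment> \<open>The last summand is added to the old total: the stored partial sum at place
        \<open>m\<close> is \<open>f\<close>, as \<open>S2\<close> is single-valued.\<close>
      have "s = f" using su3[OF su4(2) m f(2)] s True a(5) by blast
      then show ?thesis using True e by simp
    next
      case False
      then have "el k @ g' @ el c' @ L' \<in> S1" using a(6) i1[OF a(2)] by blast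
      then have "el (k + 1) @ poly_add mem R n s (mono_mult c' L' g') \<in> S2"
        using su5[OF st2 a(2-5) _ s] kN a by blast
      then show ?thesis by blast
    qed
  qed (use su4 in blast)+
  moreover have "hfin (Step_tuples J) (insert ?p1 S1)" "hfin Sum_pairs (insert ?p2 S2)"
    by (intro hfin_insert dset_Step_tuples dset_Sum_pairs J S1 S2 p1 p2)+
  ultimately show ?thesis unfolding represented_iff using NN_Suc[OF m] by blast
qed

text \<open>Decodes the tables: the columns become definable functions of the place,
  \<open>hf_fun_ex\<close> turns the generators and the monomial coefficients into hyperfinite
  sequences, and the column of partial sums is the function that evaluates
  \<open>hf_sum\<close>.\<close>

lemma represented_sum:
  assumes J: "dset J" "J \<subseteq> Polys" and f: "represented J f" "f \<in> Polys"
  shows "\<exists>m\<in>NN mem. \<exists>g\<in>hf_fun mem m J. \<exists>a\<in>hf_fun mem m Polys.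
    f = hf_sum mem R n m (\<lambda>i. poly_mult mem R n (hf_app mem m Polys a i) (hf_app mem m J g i))"
proof -
  obtain m q1 q2 where m: "m \<in> NN mem" and q1: "q1 \<in> FP (Step_tuples J)" and q2: "q2 \<in> FP Sum_pairs"
    and st: "steps J m (elems (Step_tuples J) q1)" and su: "partial_sums J m (elems (Step_tuples J) q1)
        (elems Sum_pairs q2) f"
    using f(1) unfolding represented_def by blast
  let ?S1 = "elems (Step_tuples J) q1" and ?S2 = "elems Sum_pairs q2" and ?zero = "poly_zero mem R n"
  have z: "?zero \<in> Polys" by (rule poly_zero)
  have st1: "\<exists>g\<in>J. \<exists>c\<in>R0. \<exists>L\<in>Exps. el k @ g @ el c @ L \<in> ?S1"
      if "k \<in> seg mem m" for k
    using st that unfolding steps_def by blast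
  have st3: "g' = g \<and> c' = c \<and> L' = L"
    if a: "el k @ g @ el c @ L \<in> ?S1" "k \<in> seg mem m" "g \<in> J" "c \<in> R0" "L \<in> Exps"
      "el k @ g' @ el c' @ L' \<in> ?S1" "g' \<in> J" "c' \<in> R0" "L' \<in> Exps" for k g c L g' c' L'
  proof -
    have "g' @ el c' @ L' = g @ el c @ L" using st a seg_NN unfolding steps_def by blast
    then show ?thesis using append_inj_dset[OF J(1) a(7) a(3)] by (simp add: el_append)
  qed
  let ?Z = "times_set FieldU (times_set J (times_set FieldU Exps))"
  have Z: "dset ?Z" by (intro dset_times J) simp_all
  \<comment> \<open>Outside the segment the zero polynomial is a default value, so that a function
    on all of \<open>NN mem\<close> is obtained. The default need not lie in \<open>J\<close>, which
    is why the range is \<open>Polys\<close>.\<close>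
  define Qg where "Qg k z \<longleftrightarrow> (k \<in> seg mem m \<and> (\<exists>g\<in>J. g = z \<and>
      (\<exists>c\<in>R0. \<exists>L\<in>Exps. el k @ g @ el c @ L \<in> ?S1))) \<or>
      (k \<notin> seg mem m \<and> z = ?zero)" for k z
  have dpQg: "dfn [Polys, NatU] (\<lambda>e. Qg (unel (e (Suc 0))) (e 0))"
    unfolding Qg_def
      by (intro dfn_bex dfn_nat_intros dfn_bexk[OF dset_R0] dfn_seg J dset_Exps dfn_xt'[where Z = ?Z]
          dfn_eq[where Y = Polys and Z = Polys]
         dfn_term_append dfn_term_el dfn_field_intros dfn_term_var dfn_term_const') (use J q1 z in auto)
  have unQg: "\<exists>y\<in>Polys. \<forall>z\<in>Polys. Qg k z \<longleftrightarrow> z = y"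
      if "k \<in> NN mem" for k
  proof (cases "k \<in> seg mem m")
    case True
    then obtain g c L where g: "g \<in> J" "c \<in> R0" "L \<in> Exps" "el k @ g @ el c @ L \<in> ?S1"
        using st1 by blast
    have "(\<exists>g'\<in>J. g' = z \<and> (\<exists>c\<in>R0. \<exists>L\<in>Exps. el k @ g' @ el c @ L
        \<in> ?S1)) \<longleftrightarrow> z = g" for z
      using g st3[OF g(4) True g(1-3)] by blast
    then have "Qg k z \<longleftrightarrow> z = g" for z using True unfolding Qg_def by simp
    then show ?thesis using g(1) J(2) by blast
  next
    case False
    then have "Qg k y \<longleftrightarrow> y = ?zero" for y unfolding Qg_def by simp
    then show ?thesis using z by blast
  qed
  obtain Fg where Fg: "dfn_term [NatU] Polys (\<lambda>e. Fg (unel (e 0)))"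
      "\<And>k. k \<in> NN mem \<Longrightarrow> Fg k \<in> Polys"
    and FgQ: "\<And>k z. k \<in> NN mem \<Longrightarrow> z \<in> Polys \<Longrightarrow>
        Qg k z \<longleftrightarrow> z = Fg k"
    by (rule dfn_term_THE[OF dpQg]) (rule unQg, assumption, rule that, assumption+)
  have Fg': "(\<exists>g\<in>J. g = z \<and> (\<exists>c\<in>R0. \<exists>L\<in>Exps. el k @ g @ el c @ L
      \<in> ?S1)) \<longleftrightarrow> z = Fg k" if "k \<in> seg mem m" "z \<in> Polys" for k z
    using FgQ[OF seg_NN[OF that(1)] that(2)] that(1) unfolding Qg_def by simp
  define Qa where "Qa k z \<longleftrightarrow> (k \<in> seg mem m \<and>
      (\<exists>g\<in>J. \<exists>c\<in>R0. \<exists>L\<in>Exps. z = mono_poly c L \<and>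
      el k @ g @ el c @ L \<in> ?S1)) \<or> (k \<notin> seg mem m \<and> z = ?zero)" for k z
  have dpQa: "dfn [Polys, NatU] (\<lambda>e. Qa (unel (e (Suc 0))) (e 0))"
    unfolding Qa_def
      by (intro dfn_bex dfn_nat_intros dfn_bexk[OF dset_R0] dfn_seg J dset_Exps dfn_xt'[where Z = ?Z]
          dfn_eq[where Y = Polys and Z = Polys]
         dfn_term_mono_poly dfn_term_append dfn_term_el dfn_field_intros dfn_term_var dfn_term_const') (use J
             q1 z in auto)
  have unQa: "\<exists>y\<in>Polys. \<forall>z\<in>Polys. Qa k z \<longleftrightarrow> z = y"
      if "k \<in> NN mem" for k
  proof (cases "k \<in> seg mem m")
    case True
    then obtain g c L where g: "g \<in> J" "c \<in> R0" "L \<in> Exps" "el k @ g @ el c @ L \<in> ?S1"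
        using st1 by blast
    have "(\<exists>g'\<in>J. \<exists>c\<in>R0. \<exists>L\<in>Exps. z = mono_poly c L \<and>
        el k @ g' @ el c @ L \<in> ?S1) \<longleftrightarrow> z = mono_poly c L" for z
      using g st3[OF g(4) True g(1-3)] by blast
    then have "Qa k z \<longleftrightarrow> z = mono_poly c L" for z using True unfolding Qa_def by simp
    moreover have "mono_poly c L \<in> Polys" using g mono_poly(1) by blast
    ultimately show ?thesis by blast
  next
    case False
    then have "Qa k y \<longleftrightarrow> y = ?zero" for y unfolding Qa_def by simp
    then show ?thesis using z by blast
  qed
  obtain Fa where Fa: "dfn_term [NatU] Polys (\<lambda>e. Fa (unel (e 0)))"
      "\<And>k. k \<in> NN mem \<Longrightarrow> Fa k \<in> Polys"
    and FaQ: "\<And>k z. k \<in> NN mem \<Longrightarrow> z \<in> Polys \<Longrightarrow>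
        Qa k z \<longleftrightarrow> z = Fa k"
    by (rule dfn_term_THE[OF dpQa]) (rule unQa, assumption, rule that, assumption+)
  have Fa': "(\<exists>g\<in>J. \<exists>c\<in>R0. \<exists>L\<in>Exps. z = mono_poly c L \<and>
      el k @ g @ el c @ L \<in> ?S1) \<longleftrightarrow> z = Fa k" if "k \<in> seg mem m" "z \<in> Polys"
      for k z
    using FaQ[OF seg_NN[OF that(1)] that(2)] that(1) unfolding Qa_def by simp
  define QS where "QS k z \<longleftrightarrow> (k \<in> seg mem (m + 1) \<and> el k @ z \<in> ?S2) \<or>
      (k \<notin> seg mem (m + 1) \<and> z = ?zero)" for k z
  have dpQS: "dfn [Polys, NatU] (\<lambda>e. QS (unel (e (Suc 0))) (e 0))"
    unfolding QS_def
      by (intro dfn_nat_intros dfn_seg dfn_xt'[where Z = "times_set FieldU Polys"] dfn_eq[where Y = Polys and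
          Z = Polys]
         dfn_term_append dfn_term_el dfn_field_intros dfn_term_var dfn_term_const') (use q2 z in auto)
  have unQS: "\<exists>y\<in>Polys. \<forall>z\<in>Polys. QS k z \<longleftrightarrow> z = y"
      if "k \<in> NN mem" for k
  proof (cases "k \<in> seg mem (m + 1)")
    case True
    then obtain s where s: "s \<in> Polys" "el k @ s \<in> ?S2" using su unfolding partial_sums_def by blast
    have "el k @ z \<in> ?S2 \<longleftrightarrow> z = s" if "z \<in> Polys" for z
      using s su seg_NN[OF True] that unfolding partial_sums_def by blast
    then have "QS k z \<longleftrightarrow> z = s" if "z \<in> Polys" for z using True that unfolding QS_def
        by simp
    then show ?thesis using s(1) by blast
  next
    case False
    then have "QS k y \<longleftrightarrow> y = ?zero" for y unfolding QS_def by simp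
    then show ?thesis using z by blast
  qed
  obtain FS where FS: "dfn_term [NatU] Polys (\<lambda>e. FS (unel (e 0)))"
      "\<And>k. k \<in> NN mem \<Longrightarrow> FS k \<in> Polys"
    and FSQ: "\<And>k z. k \<in> NN mem \<Longrightarrow> z \<in> Polys \<Longrightarrow>
        QS k z \<longleftrightarrow> z = FS k"
    by (rule dfn_term_THE[OF dpQS]) (rule unQS, assumption, rule that, assumption+)
  have FS': "el k @ z \<in> ?S2 \<longleftrightarrow> z = FS k" if "k \<in> seg mem (m + 1)" "z \<in> Polys"
      for k z
    using FSQ[OF seg_NN[OF that(1)] that(2)] that(1) unfolding QS_def by simp
  have data: "\<exists>c\<in>R0. \<exists>L\<in>Exps. Fg k \<in> J \<and> Fa k = mono_poly c L \<and>
      el k @ Fg k @ el c @ L \<in> ?S1" if k: "k \<in> seg mem m" for k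
  proof -
    obtain g c L where g: "g \<in> J" "c \<in> R0" "L \<in> Exps" "el k @ g @ el c @ L \<in> ?S1"
        using st1[OF k] by blast
    have "g = Fg k" using Fg'[OF k, of g] g J(2) by blast
    moreover have "mono_poly c L = Fa k"
    proof -
      have "mono_poly c L \<in> Polys" using g mono_poly(1) by blast
      from Fa'[OF k this] show ?thesis using g by blast
    qed
    ultimately show ?thesis using g by (intro bexI[of _ c] bexI[of _ L]) simp_all
  qed
  obtain g where g: "g \<in> hf_fun mem m J" "\<forall>i\<in>seg mem m. hf_app mem m J g i = Fg i"
    using hf_fun_ex[where F = Fg, OF J(1) m Fg(1)] data by blast
  have FaP: "Fa k \<in> Polys" if "k \<in> seg mem m" for k using data[OF that] mono_poly(1) by fastforce
  obtain a where a: "a \<in> hf_fun mem m Polys" "\<forall>i\<in>seg mem m. hf_app mem m Polys a i = Fa i"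
    using hf_fun_ex[where F = Fa, OF dset_Polys m Fa(1)] FaP by blast
  have "hf_sum mem R n m (\<lambda>i. poly_mult mem R n (hf_app mem m Polys a i) (hf_app mem m J g i)) = FS
      (unel (el m :: ('k, 'f) elt))"
  proof (rule hf_sumI[OF m, where S = "\<lambda>y. FS (unel y)"])
    show "dfn_term [el ` seg mem (m + 1)] Polys (\<lambda>e. FS (unel (e 0)))"
      by (rule dfn_term_comp1[where f = "\<lambda>y. FS (unel y)", OF FS(1)]) (auto intro!: dfn_term_var
          simp: seg_NN)
    \<comment> \<open>The point is that \<open>0 \<noteq> m + 1\<close>: otherwise \<open>m\<close>
      would be \<open>- 1\<close>.\<close>
    have "0 \<in> seg mem (m + 1)" unfolding seg_iff using m NN_m1 nle_0[OF NN_Suc[OF m]]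
      by (auto simp: eq_neg_iff_add_eq_0[symmetric])
    moreover have "el 0 @ ?zero \<in> ?S2" using su unfolding partial_sums_def by blast
    ultimately show "FS (unel (el 0 :: ('k, 'f) elt)) = ?zero" using FS' z by auto
    fix k assume k: "k \<in> seg mem m"
    then obtain c L where cL: "c \<in> R0" "L \<in> Exps" "Fg k \<in> J" "Fa k = mono_poly c L"
        "el k @ Fg k @ el c @ L \<in> ?S1"
      using data by blast
    have kS: "k \<in> seg mem (m + 1)" using k seg_Suc[OF m] by simp
    have kS': "k + 1 \<in> seg mem (m + 1)" using k NN_Suc nle_add[of k 1 m] unfolding seg_iff by auto
    have FSk: "FS k \<in> Polys" using FS(2) seg_NN[OF k] by blast
    have gP: "Fg k \<in> Polys" using cL(3) J(2) by blast
    have "el k @ FS k \<in> ?S2" using FS'[OF kS FSk] by simp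
    then have in2: "el (k + 1) @ poly_add mem R n (FS k) (mono_mult c L (Fg k)) \<in> ?S2"
      using su k cL FSk unfolding partial_sums_def by blast
    have cR: "c \<in> R" "c \<noteq> 0" using cL(1) by simp_all
    have "poly_add mem R n (FS k) (mono_mult c L (Fg k)) \<in> Polys"
      by (rule poly_add(1)[OF FSk mono_mult(1)[OF cR(1) cL(2) gP]])
    then have "FS (k + 1) = poly_add mem R n (FS k) (mono_mult c L (Fg k))" using FS'[OF kS'] in2 by simp
    moreover have "poly_mult mem R n (Fa k) (Fg k) = mono_mult c L (Fg k)"
      unfolding cL(4) by (rule poly_mult_mono[OF cR cL(2) gP])
    ultimately show "FS (unel (el (k + 1) :: ('k, 'f) elt)) = poly_add mem R n (FS (unel (el k :: ('k, 'f)
        elt)))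
        (poly_mult mem R n (hf_app mem m Polys a k) (hf_app mem m J g k))"
      using g(2) a(2) k by simp
  qed
  moreover have "FS m = f"
  proof -
    have "m \<in> seg mem (m + 1)" using seg_Suc[OF m] by simp
    moreover have "el m @ f \<in> ?S2" using su unfolding partial_sums_def by blast
    ultimately show ?thesis using FS' f(2) by blast
  qed
  ultimately show ?thesis using m g(1) a(1) by (intro bexI[of _ m] bexI[of _ g] bexI[of _ a]) simp_all
qed

section \<open>Reduction of leading terms in an ideal\<close>

lemma mono_mult_minus:
  assumes "c \<in> R" "L \<in> Exps" "q \<in> Polys" "I \<in> Exps"
  shows "pcoeff (mono_mult (- c) L q) I = - pcoeff (mono_mult c L q) I"
proof (cases "\<exists>J\<in>Exps. I = xadd L J")
  case True
  then show ?thesis using mono_mult(2)[OF assms(1-3)] mono_mult(2)[OF R_closed(5)[OF assms(1)] assms(2,3)]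
      by auto
next
  case False
  then have "pcoeff (mono_mult c L q) I = 0" "pcoeff (mono_mult (- c) L q) I = 0"
    using mono_mult(3)[OF assms(1-3) assms(4)] mono_mult(3)[OF R_closed(5)[OF assms(1)] assms(2,3) assms(4)]
        by auto
  then show ?thesis by simp
qed

text \<open>The ideal hypothesis enters through closure under \<open>poly_add\<close> and under
  multiplication by polynomials. The reduction step itself is computed on coefficients.\<close>

theorem ideal_hf_generated:
  assumes Id: "dset \<I>" and Ii: "ideal \<I> (def_poly_ring mem R n)"
  shows "hf_generated mem R n \<I>"
proof -
  let ?R = "def_poly_ring mem R n"
  interpret I: ideal \<I> ?R by (rule Ii)
  have ring: "carrier ?R = Polys" "x \<otimes>\<^bsub>?R\<^esub> y = poly_mult mem R n x y"
      "x \<oplus>\<^bsub>?R\<^esub> y = poly_add mem R n x y"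
    "\<zero>\<^bsub>?R\<^esub> = poly_zero mem R n" for x y by (simp_all add: def_poly_ring_def)
  have IP: "\<I> \<subseteq> Polys" using I.a_subset ring(1) by simp
  have Iadd: "poly_add mem R n x y \<in> \<I>" if "x \<in> \<I>" "y \<in> \<I>" for x y
    using additive_subgroup.a_closed[OF I.is_additive_subgroup that] by (simp add: ring)
  have Imult: "poly_mult mem R n x y \<in> \<I>" if "x \<in> Polys" "y \<in> \<I>" for x y
    using I.I_l_closed[OF that(2), of x] that(1) by (simp add: ring)
  \<comment> \<open>Leading exponents make sense only for non-zero elements, so these are the
    elements to which \<open>dickson\<close> is applied.\<close>
  define U where "U = {p\<in>\<I>. p \<in> Nonzero}"
  have U: "dset U" unfolding U_def by (intro dset_Collect Id dfn_mem[where Z = Polys] dfn_term_var) (use IP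
      in auto)
  have UZ: "U \<subseteq> Nonzero" by (auto simp: U_def)
  have "\<exists>B. hfin U B \<and> (\<forall>u\<in>U. \<exists>b\<in>B. \<forall>i\<in>seg mem n. nle (xval
      (lead b) i) (xval (lead u) i))"
  proof (rule dickson[OF U _ _ nN, where d = "\<lambda>u i. xval (lead u) i"])
    show "dfn_field \<Gamma> (\<lambda>e. xval (lead (t e)) (s e))" if "dfn_term \<Gamma> U t"
        "dfn_field \<Gamma> s" for \<Gamma> t s
      by (intro dfn_field_xval dfn_term_lead that(2) dfn_term_sub[OF that(1)] dset_Nonzero) (use
          dfn_term_in[OF that(1)] UZ in blast)
    show "xval (lead u) i \<in> NN mem" if "u \<in> U" for u i using that UZ by (intro xval_NN lead_Exps) auto
  qed
  then obtain J where J: "hfin U J" "\<And>u. u \<in> U \<Longrightarrow>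
      \<exists>b\<in>J. \<forall>i\<in>seg mem n. nle (xval (lead b) i) (xval (lead u) i)" by blast
  have JU: "J \<subseteq> U" by (rule hfin_sub[OF U J(1)])
  have Jd: "dset J" by (rule hfin_dset[OF U J(1)])
  have JP: "J \<subseteq> Polys" using JU UZ unfolding Nonzero_def by blast
  have represented: "represented J f" if f0: "f \<in> \<I>" for f
  proof (rule ccontr)
    assume nf: "\<not> represented J f"
    \<comment> \<open>The zero polynomial is the empty combination, so an element that is not
      represented has a leading exponent.\<close>
    have BadZ: "h \<in> Nonzero" if h: "h \<in> \<I>" "\<not> represented J h" for h
    proof (rule ccontr)
      assume "h \<notin> Nonzero"
      then have "h = poly_zero mem R n" using h(1) IP poly_zero unfolding Nonzero_def by (intro poly_ext) auto
      then show False using represented_zero[OF Jd] h(2) by simp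
    qed
    let ?B = "{f\<in>U. \<not> represented J f}"
    have dB: "dset ?B"
      by (intro dset_Collect U dfn_Not dfn_represented[OF Jd JP] dfn_term_var) (use UZ in \<open>auto simp:
          Nonzero_def\<close>)
    \<comment> \<open>The order compares exponents, so the minimum is taken over the definable set
      of leading exponents and then realised by some \<open>h\<close>.\<close>
    let ?L = "{I\<in>Exps. \<exists>h\<in>?B. I = lead h}"
    have "dset ?L"
      by (intro dset_Collect dset_Exps dfn_bex dB dfn_eq[where Y = Exps and Z = Exps] dfn_term_lead
          dfn_term_var) (use UZ in auto)
    moreover have "?L \<noteq> {}"
    proof -
      have fB: "f \<in> ?B" using f0 nf BadZ unfolding U_def by blast
      then have "lead f \<in> Exps" using UZ by (intro lead_Exps) blast
      with fB have "lead f \<in> ?L" by blast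
      then show ?thesis by blast
    qed
    moreover have "?L \<subseteq> Exps" by blast
    ultimately have "\<exists>s\<in>?L. \<forall>u\<in>?L. u \<noteq> s \<longrightarrow> lex_less s u"
        by (intro lex_less_least)
    then obtain I0 where I0: "I0 \<in> ?L" "\<forall>u\<in>?L. u \<noteq> I0 \<longrightarrow> lex_less I0 u"
        by (rule bexE)
    from I0(1) obtain h where h: "h \<in> U" "\<not> represented J h" "I0 = lead h" by blast
    have hZ: "h \<in> Nonzero" and hP: "h \<in> Polys" and hI: "h \<in> \<I>" using h(1) UZ
        unfolding U_def Nonzero_def by blast+
    obtain g where g: "g \<in> J" "\<And>i. i \<in> seg mem n \<Longrightarrow>
        nle (xval (lead g) i) (xval (lead h) i)" using J(2)[OF h(1)] by blast
    have gZ: "g \<in> Nonzero" and gP: "g \<in> Polys" and gI: "g \<in> \<I>" using g(1) JU UZ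
        unfolding U_def Nonzero_def by blast+
    obtain L where L: "L \<in> Exps" "lead h = xadd L (lead g)"
        using xadd_divide[OF lead_Exps[OF hZ] lead_Exps[OF gZ] g(2)] by blast
    note lh = lead[OF hZ, unfolded is_lead_def] and lg = lead[OF gZ, unfolded is_lead_def]
    \<comment> \<open>With this factor the multiple of \<open>g\<close> cancels the leading
      coefficient of \<open>h\<close>; the quotient lies in \<open>R\<close> because
      \<open>R\<close> is a subfield.\<close>
    define c where "c = - (pcoeff h (lead h) / pcoeff g (lead g))"
    have c0: "c \<noteq> 0" using lh lg unfolding c_def by simp
    have cR: "c \<in> R" unfolding c_def
      by (intro R_closed(5,6) pcoeff_iff(2) hP gP lead_Exps hZ gZ)
    note m = mono_mult[OF cR L(1) gP]
    let ?h = "poly_add mem R n h (mono_mult c L g)"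
    have hP': "?h \<in> Polys" by (rule poly_add(1)[OF hP m(1)])
    have "mono_poly c L \<in> Polys" using mono_poly(1) cR L by blast
    then have "mono_mult c L g \<in> \<I>" using Imult[OF _ gI] poly_mult_mono[OF cR c0 L(1) gP] by metis
    then have hI': "?h \<in> \<I>" using Iadd hI by blast
    \<comment> \<open>An exponent of the multiple of \<open>g\<close> has the form
      \<open>xadd L K\<close> with \<open>K\<close> below \<open>lead g\<close> or equal to it.
      Equality is the cancelled case, and otherwise compatibility of the order with addition gives
      the comparison.\<close>
    have small: "lex_less I (lead h)" if I: "I \<in> Exps" "pcoeff ?h I \<noteq> 0" for I
    proof -
      have s: "pcoeff ?h I = pcoeff h I + pcoeff (mono_mult c L g) I" by (rule poly_add(2)[OF hP m(1) I(1)])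
      have ne: "I \<noteq> lead h"
      proof
        assume "I = lead h"
        then have "pcoeff ?h I = pcoeff h (lead h) + c * pcoeff g (lead g)"
            using s m(2)[OF lead_Exps[OF gZ]] L(2) by simp
        also have "\<dots> = 0" using lg unfolding c_def by simp
        finally show False using I(2) by simp
      qed
      show ?thesis
      proof (cases "pcoeff h I = 0")
        case False
        then show ?thesis using lh I(1) ne by blast
      next
        case True
        then have n0: "pcoeff (mono_mult c L g) I \<noteq> 0" using s I(2) by simp
        then obtain K where K: "K \<in> Exps" "I = xadd L K" using m(3)[OF I(1)] by blast
        have "pcoeff g K \<noteq> 0" using n0 m(2)[OF K(1)] K(2) by auto
        moreover have "K \<noteq> lead g" using ne K(2) L(2) by auto
        ultimately have "lex_less K (lead g)" using lg K(1) by blast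
        then show ?thesis unfolding K(2) L(2) by (intro lex_less_add L K lead_Exps gZ)
      qed
    qed
    have Rh: "represented J ?h"
    proof (rule ccontr)
      assume n: "\<not> represented J ?h"
      have Z: "?h \<in> Nonzero" by (rule BadZ[OF hI' n])
      then have l: "lex_less (lead ?h) (lead h)" using small lead[OF Z] unfolding is_lead_def by blast
      have "?h \<in> ?B" using Z hI' n unfolding U_def by blast
      then have "lead ?h \<in> ?L" using lead_Exps[OF Z] by blast
      moreover have "lead ?h \<noteq> lead h" using l lex_less_irrefl[of "lead h"] by auto
      ultimately have "lex_less (lead h) (lead ?h)" using I0(2) unfolding h(3) by blast
      then show False using lex_less_trans[OF l] lex_less_irrefl by blast
    qed
    have mc: "- c \<in> R0" using cR c0 R_closed(5) by simp
    then have mR: "- c \<in> R" by simp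
    \<comment> \<open>Adding the opposite multiple of \<open>g\<close> recovers \<open>h\<close>
      from the smaller element, so \<open>h\<close> would be represented after all.\<close>
    have "represented J (poly_add mem R n ?h (mono_mult (- c) L g))"
        by (rule represented_step[OF Jd JP Rh hP' g(1) mc L(1)])
    moreover have "poly_add mem R n ?h (mono_mult (- c) L g) = h"
    proof (rule poly_ext)
      show "poly_add mem R n ?h (mono_mult (- c) L g) \<in> Polys" by (intro poly_add(1) hP' mono_mult(1) mR
          L gP)
      fix I assume "I \<in> Exps"
      then show "pcoeff (poly_add mem R n ?h (mono_mult (- c) L g)) I = pcoeff h I"
        using poly_add(2)[OF hP' mono_mult(1)[OF mR L(1) gP]] poly_add(2)[OF hP m(1)] mono_mult_minus[OF cR
            L(1) gP] by simp
    qed (rule hP)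
    ultimately show False using h(2) by simp
  qed
  have "J \<subseteq> \<I>" using JU unfolding U_def by blast
  moreover have "hyperfinite (Keq mem) J" by (rule hfin_hyperfinite[OF U J(1)])
  ultimately show ?thesis unfolding hf_generated_def using represented_sum[OF Jd JP represented] IP by blast
qed

end

theorem theorem9p10:
  fixes mem :: "'k::field \<Rightarrow> 'f \<Rightarrow> bool" and R :: "'k set" and n :: 'k
    and \<I> :: "('k, 'f) elt set"
  assumes "fin_field mem"
    and "def_char_zero mem"
    and "subfield R (ring_of_type_algebra :: 'k ring)"
    and "definable (Keq mem) (el ` R :: ('k, 'f) elt set)"
    and "n \<in> NN mem"
    and "definable (Keq mem) \<I>"
    and "ideal \<I> (def_poly_ring mem R n)"
  shows "hf_generated mem R n \<I>"
proof -
  interpret hf_field mem by (rule hf_field.intro) (rule assms)+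
  interpret hf_poly mem R n
    by (intro hf_poly.intro hf_poly_axioms.intro hf_field_axioms assms) (use assms(4) in \<open>simp add: definable_iff\<close>)
  show ?thesis by (rule ideal_hf_generated) (use assms in \<open>auto simp: definable_iff\<close>)
qed

end
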